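(* Let $S$ be a spray on $T_0M$ and let $\widetilde F$ be a Finsler structure on $M$ with metric tensor $\widetilde g_{ij}=\frac12\frac{\partial^2\widetilde F^2}{\partial y^i\partial y^j}$. Let $\nabla$ be the dynamical covariant derivative induced by $S$. (i) The spray $S$ is projectively related to the Finsler structure $\widetilde F$ if and only if there exists a positively $1$-homogeneous function $P\in C^\infty(T_0M)$ such that for all $i,j$ $$\nabla\widetilde g_{ij}=2P\,\widetilde g_{ij}+\frac{\partial P}{\partial y^i}\widetilde g_{kj}y^k+\frac{\partial P}{\partial y^j}\widetilde g_{ik}y^k .$$ (ii) If the spray $S$ is projectively related to the Finsler structure $\widetilde F$, then for all $i,j$ $$\nabla\left(\frac{1}{\widetilde F}\left(\widetilde g_{ij}-\frac{\partial\widetilde F}{\partial y^i}\frac{\partial\widetilde F}{\partial y^j}\right)\right)=0 .$$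
   Context: $M$ is a connected, $n$-dimensional smooth manifold with local coordinates $(x^i)$; $TM$ is its tangent bundle, $T_0M=TM\setminus\{0\}$ is the slit tangent bundle (zero section removed), with induced local coordinates $(x^i,y^i)$. Summation over repeated indices is understood. Homogeneity always means positive homogeneity in the fibre coordinates $y$. Finsler structure: a continuous positive function $F:TM\to\mathbb{R}$ (positive on $T_0M$), smooth on $T_0M$, positively homogeneous of order $1$ in the fibre coordinates, such that the metric tensor $g_{ij}(x,y)=\frac12\frac{\partial^2F^2}{\partial y^i\partial y^j}(x,y)$ is non-degenerate on $T_0M$. Spray: a vector field $S$ on $T_0M$ that is locally of the form $S=y^i\frac{\partial}{\partial x^i}-2G^i(x,y)\frac{\partial}{\partial y^i}$ with $G^i$ smooth locally defined functions on $T_0M$, homogeneous of order $2$ in $y$ (equivalently $JS=\mathcal{C}$ and $[\mathcal{C},S]=S$, where $\mathcal{C}=y^i\frac{\partial}{\partial y^i}$ and $J=\frac{\partial}{\partial y^i}\otimes dx^i$). Geodesic spray of $F$: the unique spray $S$ satisfying $S\left(\frac{\partial F^2}{\partial y^i}\right)-\frac{\partial F^2}{\partial x^i}=0$ for all $i$. Projective relation: a geodesic of $S$ is a regular curve $\gamma$ in $M$ with $S\circ\gamma'=\gamma''$, i.e. locally $\frac{d^2x^i}{dt^2}+2G^i(x,\frac{dx}{dt})=0$. Two sprays $S$ and $\widetilde S$ are projectively related if their geodesics coincide up to an orientation preserving reparametrization; equivalently, there is a smooth function $P$ on $T_0M$, positively homogeneous of order $1$, with $\widetilde S=S-2P\mathcal{C}$.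 A spray $S$ is projectively related to a Finsler structure $\widetilde F$ if it is projectively related to the geodesic spray of $\widetilde F$. Dynamical covariant derivative induced by $S$: put $N^i_j=\frac{\partial G^i}{\partial y^j}$. On functions $\nabla f=S(f)$, and on the components of a $(0,2)$-type tensor field on $T_0M$, $\nabla g_{ij}=S(g_{ij})-N^k_i g_{kj}-N^k_j g_{ik}$. *)

theory Defs
  imports "HOL-Analysis.Analysis"
begin

section \<open>Smooth maps between normed spaces\<close>

text \<open>Intended for open \<open>S\<close> and finite-dimensional domain: \<open>Ck_on k S f\<close> says that all
  (iterated directional) derivatives of \<open>f\<close> up to order \<open>k\<close> exist and are continuous on \<open>S\<close>.\<close>

primrec Ck_on :: "nat \<Rightarrow> 'e::real_normed_vector set \<Rightarrow> ('e \<Rightarrow> 'f::real_normed_vector) \<Rightarrow> bool" where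
  "Ck_on 0 S f \<longleftrightarrow> continuous_on S f"
| "Ck_on (Suc k) S f \<longleftrightarrow>
     (\<forall>x\<in>S. f differentiable (at x)) \<and> (\<forall>v. Ck_on k S (\<lambda>x. frechet_derivative f (at x) v))"

definition smooth_on :: "'e::real_normed_vector set \<Rightarrow> ('e \<Rightarrow> 'f::real_normed_vector) \<Rightarrow> bool" where
  "smooth_on S f \<longleftrightarrow> (\<forall>k. Ck_on k S f)"


section \<open>Smooth manifolds\<close>

text \<open>A chart is a domain together with a coordinate map; the values of the map outside the
  domain are irrelevant.\<close>

type_synonym ('a, 'e) chart = "'a set \<times> ('a \<Rightarrow> 'e)"

abbreviation chart_dom :: "('a, 'e) chart \<Rightarrow> 'a set" where
  "chart_dom c \<equiv> fst c"

abbreviation chart_map :: "('a, 'e) chart \<Rightarrow> 'a \<Rightarrow> 'e" where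
  "chart_map c \<equiv> snd c"

definition chart_image :: "('a, 'e) chart \<Rightarrow> 'e set" where
  "chart_image c = chart_map c ` chart_dom c"

definition chart_inv :: "('a, 'e) chart \<Rightarrow> 'e \<Rightarrow> 'a" where
  "chart_inv c = inv_into (chart_dom c) (chart_map c)"

definition transition :: "('a, 'e) chart \<Rightarrow> ('a, 'e) chart \<Rightarrow> 'e \<Rightarrow> 'e" where
  "transition c d = chart_map d \<circ> chart_inv c"

text \<open>\<open>A\<close> is any smooth atlas (not necessarily the maximal one) on the space \<open>M\<close>.\<close>

definition smooth_manifold :: "'a topology \<Rightarrow> ('a, 'e::euclidean_space) chart set \<Rightarrow> bool" where
  "smooth_manifold M A \<longleftrightarrow>
     Hausdorff_space M \<and> second_countable M \<and>
     (\<Union>c\<in>A. chart_dom c) = topspace M \<and>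
     (\<forall>c\<in>A. openin M (chart_dom c) \<and> open (chart_image c) \<and>
        homeomorphic_map (subtopology M (chart_dom c)) (top_of_set (chart_image c)) (chart_map c)) \<and>
     (\<forall>c\<in>A. \<forall>d\<in>A. smooth_on (chart_map c ` (chart_dom c \<inter> chart_dom d)) (transition c d))"

definition coord_rep :: "('a, 'e) chart \<Rightarrow> ('a \<Rightarrow> 'b) \<Rightarrow> 'e \<Rightarrow> 'b" where
  "coord_rep c f = f \<circ> chart_inv c"

definition continuous_fun :: "('a, 'e::euclidean_space) chart set \<Rightarrow> ('a \<Rightarrow> real) \<Rightarrow> bool" where
  "continuous_fun A f \<longleftrightarrow> (\<forall>c\<in>A. continuous_on (chart_image c) (coord_rep c f))"

definition smooth_fun :: "('a, 'e::euclidean_space) chart set \<Rightarrow> ('a \<Rightarrow> real) \<Rightarrow> bool" where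
  "smooth_fun A f \<longleftrightarrow> (\<forall>c\<in>A. smooth_on (chart_image c) (coord_rep c f))"


section \<open>Tangent bundle and slit tangent bundle\<close>

text \<open>A tangent vector at \<open>p\<close> is a family \<open>v\<close> of component vectors, one for each chart around \<open>p\<close>,
  which transform by the Jacobians of the transition maps. For all other charts \<open>v\<close> is set to 0,
  so that equality of families is equality of tangent vectors.\<close>

type_synonym ('a, 'e) tangent = "'a \<times> (('a, 'e) chart \<Rightarrow> 'e)"

definition tangent_bundle :: "('a, 'e::euclidean_space) chart set \<Rightarrow> ('a, 'e) tangent set" where
  "tangent_bundle A = {(p, v).
     p \<in> (\<Union>c\<in>A. chart_dom c) \<and>
     (\<forall>c. \<not> (c \<in> A \<and> p \<in> chart_dom c) \<longrightarrow> v c = 0) \<and>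
     (\<forall>c\<in>A. \<forall>d\<in>A. p \<in> chart_dom c \<inter> chart_dom d \<longrightarrow>
        v d = frechet_derivative (transition c d) (at (chart_map c p)) (v c))}"

definition slit_tangent_bundle :: "('a, 'e::euclidean_space) chart set \<Rightarrow> ('a, 'e) tangent set" where
  "slit_tangent_bundle A = {u \<in> tangent_bundle A. snd u \<noteq> (\<lambda>c. 0)}"

definition scale_tangent :: "real \<Rightarrow> ('a, 'e::euclidean_space) tangent \<Rightarrow> ('a, 'e) tangent" where
  "scale_tangent r u = (fst u, \<lambda>c. r *\<^sub>R snd u c)"

text \<open>The induced charts \<open>(x, y)\<close> on \<open>TM\<close> and on \<open>T\<^sub>0M\<close>; they make \<open>T\<^sub>0M\<close> itself a manifold modelled
  on \<open>'e \<times> 'e\<close>, to which the constructions above apply again.\<close>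

definition tangent_chart ::
  "('a, 'e::euclidean_space) chart set \<Rightarrow> ('a, 'e) chart \<Rightarrow> (('a, 'e) tangent, 'e \<times> 'e) chart" where
  "tangent_chart A c =
     ({u \<in> tangent_bundle A. fst u \<in> chart_dom c}, \<lambda>u. (chart_map c (fst u), snd u c))"

definition tangent_atlas ::
  "('a, 'e::euclidean_space) chart set \<Rightarrow> (('a, 'e) tangent, 'e \<times> 'e) chart set" where
  "tangent_atlas A = tangent_chart A ` A"

definition slit_chart ::
  "('a, 'e::euclidean_space) chart set \<Rightarrow> ('a, 'e) chart \<Rightarrow> (('a, 'e) tangent, 'e \<times> 'e) chart" where
  "slit_chart A c =
     ({u \<in> slit_tangent_bundle A. fst u \<in> chart_dom c}, \<lambda>u. (chart_map c (fst u), snd u c))"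

definition slit_atlas ::
  "('a, 'e::euclidean_space) chart set \<Rightarrow> (('a, 'e) tangent, 'e \<times> 'e) chart set" where
  "slit_atlas A = slit_chart A ` A"

definition pos_homogeneous_on ::
  "('a, 'e::euclidean_space) tangent set \<Rightarrow> nat \<Rightarrow> (('a, 'e) tangent \<Rightarrow> real) \<Rightarrow> bool" where
  "pos_homogeneous_on D k f \<longleftrightarrow> (\<forall>u\<in>D. \<forall>r>0. f (scale_tangent r u) = r ^ k * f u)"


section \<open>Vector fields, curves and their velocities\<close>

definition vf_comp :: "('b, 'e) chart \<Rightarrow> ('b \<Rightarrow> ('b, 'e) tangent) \<Rightarrow> 'b \<Rightarrow> 'e" where
  "vf_comp C X u = snd (X u) C"

definition vector_field ::
  "('b, 'e::euclidean_space) chart set \<Rightarrow> ('b \<Rightarrow> ('b, 'e) tangent) \<Rightarrow> bool" where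
  "vector_field B X \<longleftrightarrow>
     (\<forall>u\<in>(\<Union>C\<in>B. chart_dom C). X u \<in> tangent_bundle B \<and> fst (X u) = u) \<and>
     (\<forall>C\<in>B. smooth_on (chart_image C) (coord_rep C (vf_comp C X)))"

text \<open>The derivative \<open>X(f)\<close> in the chart \<open>C\<close>, where \<open>f\<close> is a function of the coordinates.\<close>

definition vf_apply ::
  "('b, 'e::euclidean_space) chart \<Rightarrow> ('b \<Rightarrow> ('b, 'e) tangent) \<Rightarrow> ('e \<Rightarrow> real) \<Rightarrow> 'e \<Rightarrow> real" where
  "vf_apply C X f z = frechet_derivative f (at z) (coord_rep C (vf_comp C X) z)"

definition open_interval :: "real set \<Rightarrow> bool" where
  "open_interval I \<longleftrightarrow> open I \<and> connected I \<and> I \<noteq> {}"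

definition smooth_curve ::
  "'a topology \<Rightarrow> ('a, 'e::euclidean_space) chart set \<Rightarrow> real set \<Rightarrow> (real \<Rightarrow> 'a) \<Rightarrow> bool" where
  "smooth_curve M A I \<gamma> \<longleftrightarrow>
     continuous_map (top_of_set I) M \<gamma> \<and>
     (\<forall>c\<in>A. smooth_on {t \<in> I. \<gamma> t \<in> chart_dom c} (chart_map c \<circ> \<gamma>))"

definition velocity ::
  "('a, 'e::euclidean_space) chart set \<Rightarrow> (real \<Rightarrow> 'a) \<Rightarrow> real \<Rightarrow> ('a, 'e) tangent" where
  "velocity A \<gamma> t =
     (\<gamma> t, \<lambda>c. if c \<in> A \<and> \<gamma> t \<in> chart_dom c
               then vector_derivative (chart_map c \<circ> \<gamma>) (at t) else 0)"


section \<open>Sprays, geodesics and projective relation\<close>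

text \<open>From here on \<open>C\<close> ranges over the induced charts of \<open>T\<^sub>0M\<close>, and \<open>z = (x, y)\<close> over its image.
  The coefficients \<open>G\<close> are read off from the second block \<open>-2G\<close> of the components of \<open>S\<close>; they are
  smooth because \<open>S\<close> is.\<close>

definition spray_coeff ::
  "('b, (real^'n) \<times> (real^'n)) chart \<Rightarrow> ('b \<Rightarrow> ('b, (real^'n) \<times> (real^'n)) tangent) \<Rightarrow>
   (real^'n) \<times> (real^'n) \<Rightarrow> real^'n" where
  "spray_coeff C S z = - (1/2) *\<^sub>R snd (coord_rep C (vf_comp C S) z)"

definition spray ::
  "('a, real^'n) chart set \<Rightarrow>
   (('a, real^'n) tangent \<Rightarrow> (('a, real^'n) tangent, (real^'n) \<times> (real^'n)) tangent) \<Rightarrow> bool" where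
  "spray A S \<longleftrightarrow>
     vector_field (slit_atlas A) S \<and>
     (\<forall>C\<in>slit_atlas A. \<forall>(x, y)\<in>chart_image C.
        coord_rep C (vf_comp C S) (x, y) = (y, - 2 *\<^sub>R spray_coeff C S (x, y)) \<and>
        (\<forall>r>0. spray_coeff C S (x, r *\<^sub>R y) = r\<^sup>2 *\<^sub>R spray_coeff C S (x, y)))"

text \<open>A geodesic is a regular curve (its velocity stays in \<open>T\<^sub>0M\<close>) with \<open>S \<circ> \<gamma>' = \<gamma>''\<close>; here
  \<open>\<gamma>''\<close> is the velocity of the curve \<open>\<gamma>'\<close> in the manifold \<open>T\<^sub>0M\<close>.\<close>

definition geodesic ::
  "'a topology \<Rightarrow> ('a, real^'n) chart set \<Rightarrow>
   (('a, real^'n) tangent \<Rightarrow> (('a, real^'n) tangent, (real^'n) \<times> (real^'n)) tangent) \<Rightarrow>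
   real set \<Rightarrow> (real \<Rightarrow> 'a) \<Rightarrow> bool" where
  "geodesic M A S I \<gamma> \<longleftrightarrow>
     open_interval I \<and> smooth_curve M A I \<gamma> \<and>
     (\<forall>t\<in>I. velocity A \<gamma> t \<in> slit_tangent_bundle A \<and>
        S (velocity A \<gamma> t) = velocity (slit_atlas A) (velocity A \<gamma>) t)"

definition orientation_preserving_reparam :: "real set \<Rightarrow> real set \<Rightarrow> (real \<Rightarrow> real) \<Rightarrow> bool" where
  "orientation_preserving_reparam J I \<phi> \<longleftrightarrow>
     open_interval J \<and> smooth_on J \<phi> \<and> \<phi> ` J = I \<and> (\<forall>t\<in>J. deriv \<phi> t > 0)"

definition projectively_related ::
  "'a topology \<Rightarrow> ('a, real^'n) chart set \<Rightarrow>
   (('a, real^'n) tangent \<Rightarrow> (('a, real^'n) tangent, (real^'n) \<times> (real^'n)) tangent) \<Rightarrow>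
   (('a, real^'n) tangent \<Rightarrow> (('a, real^'n) tangent, (real^'n) \<times> (real^'n)) tangent) \<Rightarrow> bool" where
  "projectively_related M A S S' \<longleftrightarrow>
     (\<forall>I \<gamma>. geodesic M A S I \<gamma> \<longrightarrow>
        (\<exists>J \<phi>. orientation_preserving_reparam J I \<phi> \<and> geodesic M A S' J (\<gamma> \<circ> \<phi>))) \<and>
     (\<forall>I \<gamma>. geodesic M A S' I \<gamma> \<longrightarrow>
        (\<exists>J \<phi>. orientation_preserving_reparam J I \<phi> \<and> geodesic M A S J (\<gamma> \<circ> \<phi>)))"


section \<open>Finsler structures\<close>

definition pd_x :: "'n::finite \<Rightarrow> ((real^'n) \<times> (real^'n) \<Rightarrow> real) \<Rightarrow> (real^'n) \<times> (real^'n) \<Rightarrow> real" where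
  "pd_x i f z = frechet_derivative f (at z) (axis i 1, 0)"

definition pd_y :: "'n::finite \<Rightarrow> ((real^'n) \<times> (real^'n) \<Rightarrow> real) \<Rightarrow> (real^'n) \<times> (real^'n) \<Rightarrow> real" where
  "pd_y i f z = frechet_derivative f (at z) (0, axis i 1)"

definition metric_tensor ::
  "('b, (real^'n) \<times> (real^'n)) chart \<Rightarrow> ('b \<Rightarrow> real) \<Rightarrow> (real^'n) \<times> (real^'n) \<Rightarrow> real^'n^'n" where
  "metric_tensor C F z = (\<chi> i j. (1/2) * pd_y i (pd_y j (\<lambda>w. (coord_rep C F w)\<^sup>2)) z)"

definition finsler :: "('a, real^'n) chart set \<Rightarrow> (('a, real^'n) tangent \<Rightarrow> real) \<Rightarrow> bool" where
  "finsler A F \<longleftrightarrow>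
     continuous_fun (tangent_atlas A) F \<and>
     (\<forall>u\<in>slit_tangent_bundle A. F u > 0) \<and>
     smooth_fun (slit_atlas A) F \<and>
     pos_homogeneous_on (tangent_bundle A) 1 F \<and>
     (\<forall>C\<in>slit_atlas A. \<forall>z\<in>chart_image C. invertible (metric_tensor C F z))"

definition is_geodesic_spray ::
  "('a, real^'n) chart set \<Rightarrow> (('a, real^'n) tangent \<Rightarrow> real) \<Rightarrow>
   (('a, real^'n) tangent \<Rightarrow> (('a, real^'n) tangent, (real^'n) \<times> (real^'n)) tangent) \<Rightarrow> bool" where
  "is_geodesic_spray A F S \<longleftrightarrow>
     spray A S \<and>
     (\<forall>C\<in>slit_atlas A. \<forall>z\<in>chart_image C. \<forall>i.
        vf_apply C S (pd_y i (\<lambda>w. (coord_rep C F w)\<^sup>2)) z - pd_x i (\<lambda>w. (coord_rep C F w)\<^sup>2) z = 0)"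

text \<open>Non-degeneracy of the metric tensor makes the geodesic spray of \<open>F\<close> unique on \<open>T\<^sub>0M\<close>.\<close>

definition projectively_related_finsler ::
  "'a topology \<Rightarrow> ('a, real^'n) chart set \<Rightarrow>
   (('a, real^'n) tangent \<Rightarrow> (('a, real^'n) tangent, (real^'n) \<times> (real^'n)) tangent) \<Rightarrow>
   (('a, real^'n) tangent \<Rightarrow> real) \<Rightarrow> bool" where
  "projectively_related_finsler M A S F \<longleftrightarrow>
     (\<exists>S'. is_geodesic_spray A F S' \<and> projectively_related M A S S')"


section \<open>Dynamical covariant derivative\<close>

text \<open>\<open>N\<^sup>k\<^sub>i\<close> is \<open>nonlin_conn C S k i\<close>.\<close>

definition nonlin_conn ::
  "('b, (real^'n) \<times> (real^'n)) chart \<Rightarrow> ('b \<Rightarrow> ('b, (real^'n) \<times> (real^'n)) tangent) \<Rightarrow>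
   'n \<Rightarrow> 'n \<Rightarrow> (real^'n) \<times> (real^'n) \<Rightarrow> real" where
  "nonlin_conn C S k i z = pd_y i (\<lambda>w. spray_coeff C S w $ k) z"

definition nabla ::
  "('b, (real^'n) \<times> (real^'n)) chart \<Rightarrow> ('b \<Rightarrow> ('b, (real^'n) \<times> (real^'n)) tangent) \<Rightarrow>
   ((real^'n) \<times> (real^'n) \<Rightarrow> real^'n^'n) \<Rightarrow> (real^'n) \<times> (real^'n) \<Rightarrow> real^'n^'n" where
  "nabla C S h z = (\<chi> i j.
     vf_apply C S (\<lambda>w. h w $ i $ j) z
     - (\<Sum>k\<in>UNIV. nonlin_conn C S k i z * h z $ k $ j)
     - (\<Sum>k\<in>UNIV. nonlin_conn C S k j z * h z $ i $ k))"

end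

theory Submission
  imports Defs
begin

text \<open>The theorem is about \<open>\<omega>\<^sub>i = S(\<partial>L/\<partial>y\<^sup>i) - \<partial>L/\<partial>x\<^sup>i\<close>, the Euler-Lagrange expressions of a function \<open>L\<close>.
  Commuting \<open>\<partial>/\<partial>y\<^sup>j\<close> with \<open>S\<close> and symmetrising in \<open>i\<close> and \<open>j\<close> yields
  \<open>2 \<nabla>(\<partial>\<^sup>2L/\<partial>y\<^sup>i\<partial>y\<^sup>j) = \<partial>\<omega>\<^sub>i/\<partial>y\<^sup>j + \<partial>\<omega>\<^sub>j/\<partial>y\<^sup>i\<close> (lemma \<open>cov_deriv_fibre_hessian\<close>), and both parts are
  read off from this identity.

  Part (i) takes \<open>L = F\<^sup>2\<close>, whose fibre Hessian is \<open>2g\<close>. A spray is projectively related to \<open>F\<close> iff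
  \<open>\<omega>\<^sub>i = 2P \<partial>F\<^sup>2/\<partial>y\<^sup>i\<close> for some factor \<open>P\<close>, and inserting this into the identity gives the equation for
  \<open>\<nabla>g\<close>. Conversely, the equation says that \<open>\<eta>\<^sub>i = \<omega>\<^sub>i - 2P \<partial>F\<^sup>2/\<partial>y\<^sup>i\<close> has a skew-symmetric fibre derivative;
  since \<open>\<eta>\<^sub>i\<close> is homogeneous of degree 2, Euler's identity forces it to vanish
  (\<open>skew_homogeneous_zero\<close>). Then \<open>S - 2PC\<close>, with the Liouville field \<open>C\<close>, is a geodesic spray of \<open>F\<close>.

  Part (ii) takes \<open>L = F\<close>, whose fibre Hessian is the tensor in question. The geodesic spray conserves \<open>F\<close>, so
  its Euler-Lagrange expressions vanish for \<open>F\<close> as well as for \<open>F\<^sup>2\<close>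
  (\<open>euler_lagrange_energy_imp_length\<close>). A projective change does not affect those of \<open>F\<close>, because
  \<open>\<partial>F/\<partial>y\<^sup>i\<close> is homogeneous of degree 0.

  Projective relation is defined by geodesics, so it also has to be translated into \<open>S' = S - 2PC\<close>. One
  direction needs a geodesic of \<open>S\<close> through every point of the slit tangent bundle, supplied by Picard's
  theorem, along which the two accelerations are compared (\<open>related_imp_projective_factor\<close>). In the
  other direction an explicit reparametrisation by two quadratures turns geodesics of \<open>S\<close> into geodesics
  of \<open>S'\<close> (\<open>geodesic_reparam\<close>). That \<open>P\<close> and \<open>S'\<close> are globally defined rests on the invariance of the
  Liouville field under changes of charts (\<open>liouville_chart_change\<close>).\<close>

section \<open>Smooth functions\<close>

text \<open>Equality of the derivatives holds even where they do not exist: on an open set the two functions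
  have the same candidate derivatives, and \<open>frechet_derivative\<close> selects from these.\<close>

lemma frechet_derivative_cong_open:
  assumes "open S" "x \<in> S" "\<And>x. x \<in> S \<Longrightarrow> f x = g x"
  shows "frechet_derivative f (at x) = frechet_derivative g (at x)"
    and "f differentiable (at x) \<longleftrightarrow> g differentiable (at x)"
proof -
  have "(f has_derivative D) (at x) \<longleftrightarrow> (g has_derivative D) (at x)" for D
    using has_derivative_transform_within_open[OF _ assms(1,2)] assms(3) by metis
  then show "frechet_derivative f (at x) = frechet_derivative g (at x)"
    and "f differentiable (at x) \<longleftrightarrow> g differentiable (at x)"
    by (simp_all add: frechet_derivative_def differentiable_def)
qed

lemma Ck_on_cong:
  assumes "open S" "\<And>x. x \<in> S \<Longrightarrow> f x = g x"
  shows "Ck_on k S f \<longleftrightarrow> Ck_on k S g"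
  using assms(2)
proof (induction k arbitrary: f g)
  case 0
  then show ?case by (simp cong: continuous_on_cong)
next
  case (Suc k)
  have "Ck_on k S (\<lambda>x. frechet_derivative f (at x) v) \<longleftrightarrow>
      Ck_on k S (\<lambda>x. frechet_derivative g (at x) v)" for v
    by (rule Suc.IH) (simp add: frechet_derivative_cong_open(1)[OF assms(1) _ Suc.prems])
  then show ?case
    using frechet_derivative_cong_open(2)[OF assms(1) _ Suc.prems] by simp
qed

text \<open>The induction step of every closure property below: an explicit formula \<open>f'\<close> for the derivative
  reduces the order by one.\<close>

lemma Ck_on_SucI:
  assumes "open S" "\<And>x. x \<in> S \<Longrightarrow> (f has_derivative f' x) (at x)"
    "\<And>v. Ck_on k S (\<lambda>x. f' x v)"
  shows "Ck_on (Suc k) S f"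
proof -
  have "Ck_on k S (\<lambda>x. frechet_derivative f (at x) v) \<longleftrightarrow> Ck_on k S (\<lambda>x. f' x v)" for v
    using frechet_derivative_at[OF assms(2)] by (intro Ck_on_cong[OF assms(1)]) metis
  then show ?thesis
    using assms(2,3) by (auto simp: differentiable_def)
qed

lemma Ck_on_SucD: "Ck_on (Suc k) S f \<Longrightarrow> Ck_on k S f"
proof (induction k arbitrary: f)
  case 0
  then show ?case
    by (auto intro!: continuous_at_imp_continuous_on differentiable_imp_continuous_within)
qed auto

lemma Ck_on_subset: "Ck_on k S f \<Longrightarrow> T \<subseteq> S \<Longrightarrow> Ck_on k T f"
  by (induction k arbitrary: f) (auto intro: continuous_on_subset)

lemma Ck_on_has_derivative:
  "Ck_on (Suc k) S f \<Longrightarrow> x \<in> S \<Longrightarrow> (f has_derivative frechet_derivative f (at x)) (at x)"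
  by (simp add: frechet_derivative_works)

lemma Ck_on_const: "Ck_on k S (\<lambda>x. c)"
  by (induction k arbitrary: c) auto

lemma Ck_on_add:
  assumes "open S" "Ck_on k S f" "Ck_on k S g"
  shows "Ck_on k S (\<lambda>x. f x + g x)"
  using assms(2,3)
proof (induction k arbitrary: f g)
  case 0
  then show ?case by (auto intro: continuous_on_add)
next
  case (Suc k)
  then show ?case
    by (intro Ck_on_SucI[OF assms(1), where f' = "\<lambda>x v. frechet_derivative f (at x) v + frechet_derivative g (at x) v"]
        has_derivative_add Ck_on_has_derivative) auto
qed

lemma Ck_on_bounded_linear:
  assumes "bounded_linear L" "open S" "Ck_on k S f"
  shows "Ck_on k S (\<lambda>x. L (f x))"
  using assms(3)
proof (induction k arbitrary: f)
  case 0
  then show ?case using bounded_linear.continuous_on[OF assms(1)] by auto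
next
  case (Suc k)
  then show ?case
    by (intro Ck_on_SucI[OF assms(2), where f' = "\<lambda>x v. L (frechet_derivative f (at x) v)"]
        bounded_linear.has_derivative[OF assms(1)] Ck_on_has_derivative) auto
qed

lemma Ck_on_bounded_bilinear:
  assumes "bounded_bilinear p" "open S" "Ck_on k S f" "Ck_on k S g"
  shows "Ck_on k S (\<lambda>x. p (f x) (g x))"
  using assms(3,4)
proof (induction k arbitrary: f g)
  case 0
  then show ?case using bounded_bilinear.continuous_on[OF assms(1)] by auto
next
  case (Suc k)
  note fg = Ck_on_SucD[OF Suc.prems(1)] Ck_on_SucD[OF Suc.prems(2)]
  show ?case
  proof (rule Ck_on_SucI[OF assms(2)])
    show "((\<lambda>x. p (f x) (g x)) has_derivative
        (\<lambda>v. p (f x) (frechet_derivative g (at x) v) + p (frechet_derivative f (at x) v) (g x))) (at x)"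
      if "x \<in> S" for x
      using Suc.prems that
      by (intro bounded_bilinear.FDERIV[OF assms(1)] Ck_on_has_derivative) auto
    show "Ck_on k S (\<lambda>x. p (f x) (frechet_derivative g (at x) v)
        + p (frechet_derivative f (at x) v) (g x))" for v
      using Suc fg by (intro Ck_on_add[OF assms(2)]) auto
  qed
qed

lemma Ck_on_sum:
  assumes "open S" "\<And>i. i \<in> I \<Longrightarrow> Ck_on k S (f i)"
  shows "Ck_on k S (\<lambda>x. \<Sum>i\<in>I. f i x)"
  using assms(2)
proof (induction I rule: infinite_finite_induct)
  case (insert i I)
  then show ?case using Ck_on_add[OF assms(1), of k "f i" "\<lambda>x. \<Sum>i\<in>I. f i x"] by simp
qed (simp_all add: Ck_on_const)

lemma linear_basis_expansion:
  fixes D :: "'b::euclidean_space \<Rightarrow> 'c::real_vector"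
  assumes "linear D"
  shows "D v = (\<Sum>b\<in>Basis. (v \<bullet> b) *\<^sub>R D b)"
proof -
  have "D v = D (\<Sum>b\<in>Basis. (v \<bullet> b) *\<^sub>R b)" by (simp only: euclidean_representation)
  then show ?thesis by (simp add: linear_sum[OF assms] linear_scale[OF assms])
qed

text \<open>The chain rule alone does not reduce the order, because the vector to which the derivative of \<open>g\<close> is
  applied varies with the point. Expanding it in a basis leaves finitely many products of directional
  derivatives, each of them accessible to the induction hypothesis.\<close>

lemma Ck_on_compose:
  fixes f :: "'a::real_normed_vector \<Rightarrow> 'b::euclidean_space" and g :: "'b \<Rightarrow> 'c::real_normed_vector"
  assumes "open S" "open T" "f ` S \<subseteq> T" "Ck_on k S f" "Ck_on k T g"
  shows "Ck_on k S (\<lambda>x. g (f x))"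
  using assms(4,5)
proof (induction k arbitrary: g)
  case 0
  then show ?case using assms(3) by (auto intro: continuous_on_compose2)
next
  case (Suc k)
  note f = Ck_on_SucD[OF Suc.prems(1)]
  have T: "f x \<in> T" if "x \<in> S" for x using assms(3) that by auto
  show ?case
  proof (rule Ck_on_SucI[OF assms(1)])
    fix x assume x: "x \<in> S"
    have lin: "linear (frechet_derivative g (at (f x)))"
      using Suc.prems(2) T[OF x] by (auto intro: linear_frechet_derivative)
    have "((\<lambda>x. g (f x)) has_derivative
        (\<lambda>v. frechet_derivative g (at (f x)) (frechet_derivative f (at x) v))) (at x)"
      using diff_chain_at[OF Ck_on_has_derivative[OF Suc.prems(1) x]
          Ck_on_has_derivative[OF Suc.prems(2) T[OF x]]] by (simp add: o_def)
    then show "((\<lambda>x. g (f x)) has_derivative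
        (\<lambda>v. \<Sum>b\<in>Basis. (frechet_derivative f (at x) v \<bullet> b) *\<^sub>R frechet_derivative g (at (f x)) b)) (at x)"
      by (subst (asm) linear_basis_expansion[OF lin])
  next
    fix v
    have "Ck_on k S (\<lambda>x. frechet_derivative g (at (f x)) b)" for b
      using Suc.prems(2) by (intro Suc.IH[OF f]) auto
    moreover have "Ck_on k S (\<lambda>x. frechet_derivative f (at x) v \<bullet> b)" for b
      using Suc.prems(1) by (intro Ck_on_bounded_linear[OF bounded_linear_inner_left assms(1)]) auto
    ultimately show "Ck_on k S (\<lambda>x. \<Sum>b\<in>Basis.
        (frechet_derivative f (at x) v \<bullet> b) *\<^sub>R frechet_derivative g (at (f x)) b)"
      by (intro Ck_on_sum[OF assms(1)] Ck_on_bounded_bilinear[OF bounded_bilinear_scaleR assms(1)])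
  qed
qed

lemma smooth_on_cong:
  "open S \<Longrightarrow> (\<And>x. x \<in> S \<Longrightarrow> f x = g x) \<Longrightarrow> smooth_on S f \<longleftrightarrow> smooth_on S g"
  by (simp add: smooth_on_def Ck_on_cong[of S f g])

lemma smooth_on_subset: "smooth_on S f \<Longrightarrow> T \<subseteq> S \<Longrightarrow> smooth_on T f"
  by (auto simp: smooth_on_def intro: Ck_on_subset)

lemma smooth_on_has_derivative:
  "smooth_on S f \<Longrightarrow> x \<in> S \<Longrightarrow> (f has_derivative frechet_derivative f (at x)) (at x)"
  by (meson smooth_on_def Ck_on_has_derivative)

lemma smooth_on_frechet_derivative:
  "smooth_on S f \<Longrightarrow> smooth_on S (\<lambda>x. frechet_derivative f (at x) v)"
  unfolding smooth_on_def by (metis Ck_on.simps(2))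

lemma smooth_on_continuous_on: "smooth_on S f \<Longrightarrow> continuous_on S f"
  unfolding smooth_on_def by (metis Ck_on.simps(1))

lemma smooth_on_const: "smooth_on S (\<lambda>x. c)"
  by (simp add: smooth_on_def Ck_on_const)

lemma smooth_on_add:
  "open S \<Longrightarrow> smooth_on S f \<Longrightarrow> smooth_on S g \<Longrightarrow> smooth_on S (\<lambda>x. f x + g x)"
  by (simp add: smooth_on_def Ck_on_add)

lemma smooth_on_sum:
  "open S \<Longrightarrow> (\<And>i. i \<in> I \<Longrightarrow> smooth_on S (f i)) \<Longrightarrow> smooth_on S (\<lambda>x. \<Sum>i\<in>I. f i x)"
  by (simp add: smooth_on_def Ck_on_sum)

lemma smooth_on_bounded_linear:
  "bounded_linear L \<Longrightarrow> open S \<Longrightarrow> smooth_on S f \<Longrightarrow> smooth_on S (\<lambda>x. L (f x))"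
  by (simp add: smooth_on_def Ck_on_bounded_linear)

lemma smooth_on_bounded_bilinear:
  "bounded_bilinear p \<Longrightarrow> open S \<Longrightarrow> smooth_on S f \<Longrightarrow> smooth_on S g \<Longrightarrow>
    smooth_on S (\<lambda>x. p (f x) (g x))"
  by (simp add: smooth_on_def Ck_on_bounded_bilinear)

lemma smooth_on_compose:
  fixes f :: "'a::real_normed_vector \<Rightarrow> 'b::euclidean_space"
  shows "open S \<Longrightarrow> open T \<Longrightarrow> f ` S \<subseteq> T \<Longrightarrow> smooth_on S f \<Longrightarrow> smooth_on T g \<Longrightarrow>
    smooth_on S (\<lambda>x. g (f x))"
  unfolding smooth_on_def by (rule allI, rule Ck_on_compose[where T = T and f = f]) simp_all

lemma smooth_on_ident: "open S \<Longrightarrow> smooth_on S (\<lambda>x. x)"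
proof -
  assume S: "open S"
  have "Ck_on k S (\<lambda>x. x)" for k
  proof (cases k)
    case (Suc m)
    show ?thesis unfolding Suc
      by (rule Ck_on_SucI[OF S, where f' = "\<lambda>x v. v"]) (auto intro: Ck_on_const)
  qed simp
  then show ?thesis by (simp add: smooth_on_def)
qed

lemma smooth_on_linear: "bounded_linear L \<Longrightarrow> open S \<Longrightarrow> smooth_on S L"
  using smooth_on_bounded_linear[OF _ _ smooth_on_ident] .

lemmas smooth_on_scaleR = smooth_on_bounded_bilinear[OF bounded_bilinear_scaleR]
lemmas smooth_on_mult = smooth_on_bounded_bilinear[OF bounded_bilinear_mult]
lemmas smooth_on_inner = smooth_on_bounded_bilinear[OF bounded_bilinear_inner]

lemma smooth_on_fst: "open S \<Longrightarrow> smooth_on S f \<Longrightarrow> smooth_on S (\<lambda>x. fst (f x))"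
  and smooth_on_snd: "open S \<Longrightarrow> smooth_on S f \<Longrightarrow> smooth_on S (\<lambda>x. snd (f x))"
  by (auto intro: smooth_on_bounded_linear bounded_linear_fst bounded_linear_snd)

lemma smooth_on_minus: "open S \<Longrightarrow> smooth_on S f \<Longrightarrow> smooth_on S (\<lambda>x. - f x)"
  by (rule smooth_on_bounded_linear[OF bounded_linear_minus[OF bounded_linear_ident]])

lemma smooth_on_diff:
  "open S \<Longrightarrow> smooth_on S f \<Longrightarrow> smooth_on S g \<Longrightarrow> smooth_on S (\<lambda>x. f x - g x)"
  using smooth_on_add[of S f "\<lambda>x. - g x"] smooth_on_minus by fastforce

lemma smooth_on_Pair:
  assumes "open S" "smooth_on S f" "smooth_on S g"
  shows "smooth_on S (\<lambda>x. (f x, g x))"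
proof -
  have "smooth_on S (\<lambda>x. (f x, 0) + (0, g x))"
    using assms by (intro smooth_on_add smooth_on_bounded_linear[of "\<lambda>y. (y, 0)"]
        smooth_on_bounded_linear[of "\<lambda>y. (0, y)"] bounded_linear_Pair bounded_linear_ident
        bounded_linear_zero)
  then show ?thesis by simp
qed

text \<open>Bootstrapping: if \<open>z\<close> is of class \<open>C\<^sup>k\<close>, then so is \<open>z' = f \<circ> z\<close>, hence \<open>z\<close> is of class \<open>C\<^sup>k\<^sup>+\<^sup>1\<close>.
  Besides geodesics this covers the exponential function (\<open>z' = z\<close>), the reciprocal (\<open>z' = - z\<^sup>2\<close>)
  and inverses of monotone functions.\<close>

lemma smooth_on_autonomous_solution:
  fixes z :: "real \<Rightarrow> 'e::euclidean_space"
  assumes "open I" "open U" "smooth_on U f" "z ` I \<subseteq> U"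
    and z: "\<And>t. t \<in> I \<Longrightarrow> (z has_vector_derivative f (z t)) (at t)"
  shows "smooth_on I z"
proof -
  have "Ck_on k I z" for k
  proof (induction k)
    case 0
    show ?case
      using z by (auto intro!: continuous_at_imp_continuous_on has_vector_derivative_continuous)
  next
    case (Suc k)
    have "Ck_on k I (\<lambda>t. v *\<^sub>R f (z t))" for v
      using Ck_on_compose[OF assms(1,2,4) Suc] assms(3)
      by (intro Ck_on_bounded_linear[OF bounded_linear_scaleR_right assms(1)])
        (auto simp: smooth_on_def)
    then show ?case
      using z by (intro Ck_on_SucI[OF assms(1), where f' = "\<lambda>t v. v *\<^sub>R f (z t)"])
        (auto simp: has_vector_derivative_def)
  qed
  then show ?thesis by (simp add: smooth_on_def)
qed

lemma smooth_on_antiderivative: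
  fixes z :: "real \<Rightarrow> 'e::real_normed_vector"
  assumes "open I" "smooth_on I f"
    and z: "\<And>t. t \<in> I \<Longrightarrow> (z has_vector_derivative f t) (at t)"
  shows "smooth_on I z"
proof -
  have "Ck_on (Suc k) I z" for k
    using z assms(2)
    by (intro Ck_on_SucI[OF assms(1), where f' = "\<lambda>t v. v *\<^sub>R f t"])
      (auto simp: has_vector_derivative_def smooth_on_def
        intro!: Ck_on_bounded_linear[OF bounded_linear_scaleR_right assms(1)])
  then show ?thesis by (metis Ck_on_SucD smooth_on_def)
qed

lemma smooth_on_exp:
  fixes f :: "'a::real_normed_vector \<Rightarrow> real"
  assumes "open S" "smooth_on S f"
  shows "smooth_on S (\<lambda>x. exp (f x))"
proof -
  have "smooth_on UNIV (exp :: real \<Rightarrow> real)"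
    by (rule smooth_on_autonomous_solution[OF _ _ smooth_on_ident[of UNIV]])
      (auto simp flip: has_real_derivative_iff_has_vector_derivative)
  then show ?thesis using smooth_on_compose[OF assms(1) open_UNIV _ assms(2)] by auto
qed

lemma smooth_on_inverse:
  fixes f :: "'a::real_normed_vector \<Rightarrow> real"
  assumes "open S" "smooth_on S f" "\<And>x. x \<in> S \<Longrightarrow> f x \<noteq> 0"
  shows "smooth_on S (\<lambda>x. inverse (f x))"
proof -
  have "smooth_on (UNIV :: real set) (\<lambda>x. - (x * x))"
    by (intro smooth_on_minus smooth_on_mult smooth_on_ident) auto
  then have "smooth_on (- {0}) (inverse :: real \<Rightarrow> real)"
    by (rule smooth_on_autonomous_solution[where U = UNIV, rotated 2])
      (auto simp flip: has_real_derivative_iff_has_vector_derivative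
        intro!: derivative_eq_intros simp: power2_eq_square)
  moreover have "f ` S \<subseteq> - {0}" using assms(3) by auto
  ultimately show ?thesis
    using smooth_on_compose[OF assms(1) _ _ assms(2), of "- {0}" inverse] by (simp add: open_Compl)
qed

lemma smooth_on_divide:
  fixes f g :: "'a::real_normed_vector \<Rightarrow> real"
  shows "open S \<Longrightarrow> smooth_on S f \<Longrightarrow> smooth_on S g \<Longrightarrow> (\<And>x. x \<in> S \<Longrightarrow> g x \<noteq> 0) \<Longrightarrow>
    smooth_on S (\<lambda>x. f x / g x)"
  unfolding divide_inverse by (intro smooth_on_mult smooth_on_inverse)

section \<open>Symmetry of second derivatives\<close>

lemma derivative_along_line:
  fixes f :: "'e::real_normed_vector \<Rightarrow> real"
  assumes "(f has_derivative D) (at (p + s *\<^sub>R a))"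
  shows "((\<lambda>s. f (p + s *\<^sub>R a)) has_real_derivative D a) (at s)"
proof -
  have "((\<lambda>s. p + s *\<^sub>R a) has_derivative (\<lambda>r. r *\<^sub>R a)) (at s)"
    by (auto intro!: derivative_eq_intros)
  from diff_chain_at[OF this assms]
  have "((\<lambda>s. f (p + s *\<^sub>R a)) has_derivative (\<lambda>r. D (r *\<^sub>R a))) (at s)"
    by (simp add: o_def)
  moreover have "D (r *\<^sub>R a) = D a * r" for r
    using has_derivative_linear[OF assms] by (simp add: linear_scale)
  ultimately show ?thesis by (simp add: has_field_derivative_def)
qed

text \<open>The mean value theorem, applied first along \<open>a\<close> to the increment along \<open>b\<close> and then along \<open>b\<close>. The left-hand
  side is symmetric in \<open>a\<close> and \<open>b\<close>, which is what makes mixed derivatives symmetric in the limit.\<close>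

lemma second_difference_eq_mixed_derivative:
  fixes f :: "'e::real_normed_vector \<Rightarrow> real"
  assumes smooth: "smooth_on U f" and "t > 0"
    and U: "\<And>r s. 0 \<le> r \<Longrightarrow> r \<le> t \<Longrightarrow> 0 \<le> s \<Longrightarrow> s \<le> t \<Longrightarrow> z + r *\<^sub>R a + s *\<^sub>R b \<in> U"
  obtains r s where "0 < r" "r < t" "0 < s" "s < t"
    "f (z + t *\<^sub>R a + t *\<^sub>R b) - f (z + t *\<^sub>R a) - f (z + t *\<^sub>R b) + f z =
      t * t * frechet_derivative (\<lambda>w. frechet_derivative f (at w) a) (at (z + r *\<^sub>R a + s *\<^sub>R b)) b"
proof -
  let ?Da = "\<lambda>w. frechet_derivative f (at w) a"
  have "((\<lambda>r. f ((z + t *\<^sub>R b) + r *\<^sub>R a) - f (z + r *\<^sub>R a)) has_real_derivative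
      ?Da ((z + t *\<^sub>R b) + r *\<^sub>R a) - ?Da (z + r *\<^sub>R a)) (at r)" if "0 \<le> r" "r \<le> t" for r
    using U[OF that, of 0] U[OF that, of t] assms(2)
    by (intro DERIV_diff derivative_along_line smooth_on_has_derivative[OF smooth])
      (auto simp: algebra_simps)
  from MVT2[OF assms(2) this] obtain r where r: "0 < r" "r < t"
    and 1: "f (z + t *\<^sub>R b + t *\<^sub>R a) - f (z + t *\<^sub>R a) - (f (z + t *\<^sub>R b) - f z) =
      t * (?Da (z + t *\<^sub>R b + r *\<^sub>R a) - ?Da (z + r *\<^sub>R a))" by auto
  have "((\<lambda>s. ?Da ((z + r *\<^sub>R a) + s *\<^sub>R b)) has_real_derivative
      frechet_derivative ?Da (at ((z + r *\<^sub>R a) + s *\<^sub>R b)) b) (at s)" if "0 \<le> s" "s \<le> t" for s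
    using U[of r s] r that
    by (intro derivative_along_line smooth_on_has_derivative[OF smooth_on_frechet_derivative[OF smooth]])
      auto
  from MVT2[OF assms(2) this] obtain s where s: "0 < s" "s < t"
    and 2: "?Da (z + r *\<^sub>R a + t *\<^sub>R b) - ?Da (z + r *\<^sub>R a) =
      t * frechet_derivative ?Da (at (z + r *\<^sub>R a + s *\<^sub>R b)) b" by auto
  have "f (z + t *\<^sub>R a + t *\<^sub>R b) - f (z + t *\<^sub>R a) - f (z + t *\<^sub>R b) + f z =
      t * (?Da (z + r *\<^sub>R a + t *\<^sub>R b) - ?Da (z + r *\<^sub>R a))"
    using 1 by (simp add: algebra_simps)
  then show thesis using that r s 2 by (simp add: mult.assoc)
qed

lemma second_derivative_symmetric:
  fixes f :: "'e::real_normed_vector \<Rightarrow> real"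
  assumes "open U" "smooth_on U f" "z \<in> U"
  shows "frechet_derivative (\<lambda>w. frechet_derivative f (at w) a) (at z) b =
    frechet_derivative (\<lambda>w. frechet_derivative f (at w) b) (at z) a"
    (is "?Dab z = ?Dba z")
proof (rule ccontr)
  assume neq: "?Dab z \<noteq> ?Dba z"
  define e where "e = \<bar>?Dab z - ?Dba z\<bar> / 2"
  have "e > 0" using neq by (simp add: e_def)
  have cont: "isCont ?Dab z" "isCont ?Dba z"
    using assms smooth_on_continuous_on[OF smooth_on_frechet_derivative[OF
          smooth_on_frechet_derivative[OF assms(2)]]]
    by (auto simp: continuous_on_eq_continuous_at)
  obtain d1 where d1: "d1 > 0" "\<And>w. dist w z < d1 \<Longrightarrow> dist (?Dab w) (?Dab z) < e"
    using cont(1) \<open>e > 0\<close> unfolding continuous_at_eps_delta by blast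
  obtain d2 where d2: "d2 > 0" "\<And>w. dist w z < d2 \<Longrightarrow> dist (?Dba w) (?Dba z) < e"
    using cont(2) \<open>e > 0\<close> unfolding continuous_at_eps_delta by blast
  obtain d3 where d3: "d3 > 0" "\<And>w. dist w z < d3 \<Longrightarrow> w \<in> U"
    using assms(1,3) unfolding open_dist by blast
  define d where "d = Min {d1, d2, d3}"
  have d: "d > 0" "d \<le> d1" "d \<le> d2" "d \<le> d3" using d1 d2 d3 by (auto simp: d_def)
  define t where "t = d / (norm a + norm b + 1)"
  have "t > 0" using d by (simp add: t_def add_nonneg_pos)
  have small: "dist (z + r *\<^sub>R a + s *\<^sub>R b) z < d" if "0 \<le> r" "r \<le> t" "0 \<le> s" "s \<le> t" for r s
  proof -
    have "dist (z + r *\<^sub>R a + s *\<^sub>R b) z \<le> r * norm a + s * norm b"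
      using norm_triangle_ineq[of "r *\<^sub>R a" "s *\<^sub>R b"] that by (simp add: dist_norm add.assoc)
    also have "\<dots> \<le> t * norm a + t * norm b"
      using that by (intro add_mono mult_right_mono) auto
    also have "\<dots> < t * (norm a + norm b + 1)" using \<open>t > 0\<close> by (simp add: algebra_simps)
    also have "\<dots> = d"
      unfolding t_def using add_nonneg_pos[of "norm a + norm b" 1] by simp
    finally show ?thesis .
  qed
  obtain r s where 1: "0 < r" "r < t" "0 < s" "s < t"
    "f (z + t *\<^sub>R a + t *\<^sub>R b) - f (z + t *\<^sub>R a) - f (z + t *\<^sub>R b) + f z = t * t * ?Dab (z + r *\<^sub>R a + s *\<^sub>R b)"
    using small d3 d(4)
    by (elim second_difference_eq_mixed_derivative[OF assms(2) \<open>t > 0\<close>, of z a b, rotated]) force+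
  obtain r' s' where 2: "0 < r'" "r' < t" "0 < s'" "s' < t"
    "f (z + t *\<^sub>R b + t *\<^sub>R a) - f (z + t *\<^sub>R b) - f (z + t *\<^sub>R a) + f z = t * t * ?Dba (z + r' *\<^sub>R b + s' *\<^sub>R a)"
    using small d3 d(4)
    by (elim second_difference_eq_mixed_derivative[OF assms(2) \<open>t > 0\<close>, of z b a, rotated])
      (force simp: add.assoc add.commute[of "_ *\<^sub>R b"])+
  have "t * t * ?Dab (z + r *\<^sub>R a + s *\<^sub>R b) = t * t * ?Dba (z + r' *\<^sub>R b + s' *\<^sub>R a)"
    unfolding 1(5)[symmetric] 2(5)[symmetric] by (simp add: algebra_simps)
  then have "?Dab (z + r *\<^sub>R a + s *\<^sub>R b) = ?Dba (z + r' *\<^sub>R b + s' *\<^sub>R a)"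
    using \<open>t > 0\<close> by simp
  moreover have "dist (?Dab (z + r *\<^sub>R a + s *\<^sub>R b)) (?Dab z) < e"
    using small[of r s] 1 d by (intro d1) auto
  moreover have "dist (?Dba (z + r' *\<^sub>R b + s' *\<^sub>R a)) (?Dba z) < e"
    using small[of s' r'] 2 d by (intro d2) (auto simp: algebra_simps)
  ultimately have "\<bar>?Dab z - ?Dba z\<bar> < 2 * e" unfolding dist_real_def by linarith
  then show False by (simp add: e_def)
qed

text \<open>Differentiating \<open>X(f)\<close> in the direction \<open>v\<close> gives \<open>X(v(f)) + (D\<^sub>v X)(f)\<close>; the symmetry of second
  derivatives moves the constant direction \<open>v\<close> inside. For a spray and a vertical \<open>v\<close> this is the
  commutator \<open>[\<partial>/\<partial>y\<^sup>j, S] = \<partial>/\<partial>x\<^sup>j - 2 N\<^sup>k\<^sub>j \<partial>/\<partial>y\<^sup>k\<close>.\<close>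

lemma has_derivative_along_field:
  fixes f :: "'e::euclidean_space \<Rightarrow> real"
  assumes U: "open U" "smooth_on U f" "z \<in> U" and X: "(X has_derivative X') (at z)"
  shows "((\<lambda>w. frechet_derivative f (at w) (X w)) has_derivative
    (\<lambda>v. frechet_derivative (\<lambda>w. frechet_derivative f (at w) v) (at z) (X z) +
      frechet_derivative f (at z) (X' v))) (at z)"
proof -
  let ?D = "\<lambda>v w. frechet_derivative f (at w) v"
  have lin: "linear (frechet_derivative f (at w))" if "w \<in> U" for w
    using has_derivative_linear[OF smooth_on_has_derivative[OF U(2) that]] .
  have D: "(?D v has_derivative frechet_derivative (?D v) (at z)) (at z)" for v
    by (intro smooth_on_has_derivative[OF smooth_on_frechet_derivative[OF U(2)] U(3)])
  have "((\<lambda>w. \<Sum>b\<in>Basis. (X w \<bullet> b) * ?D b w) has_derivative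
      (\<lambda>v. \<Sum>b\<in>Basis. (X z \<bullet> b) * frechet_derivative (?D b) (at z) v + (X' v \<bullet> b) * ?D b z)) (at z)"
    by (intro has_derivative_sum has_derivative_mult has_derivative_inner_left X D)
  moreover have "(\<Sum>b\<in>Basis. (X z \<bullet> b) * frechet_derivative (?D b) (at z) v + (X' v \<bullet> b) * ?D b z) =
      frechet_derivative (?D v) (at z) (X z) + ?D (X' v) z" for v
  proof -
    have "(\<Sum>b\<in>Basis. (X z \<bullet> b) * frechet_derivative (?D b) (at z) v) =
        (\<Sum>b\<in>Basis. (X z \<bullet> b) * frechet_derivative (?D v) (at z) b)"
      by (simp add: second_derivative_symmetric[OF U, of _ v])
    also have "\<dots> = frechet_derivative (?D v) (at z) (X z)"
      using linear_basis_expansion[OF has_derivative_linear[OF D], of v "X z"] by simp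
    finally show ?thesis
      using linear_basis_expansion[OF lin[OF U(3)], of "X' v"] by (simp add: sum.distrib)
  qed
  ultimately have "((\<lambda>w. \<Sum>b\<in>Basis. (X w \<bullet> b) * ?D b w) has_derivative
      (\<lambda>v. frechet_derivative (?D v) (at z) (X z) + ?D (X' v) z)) (at z)" by simp
  then show ?thesis
    using has_derivative_transform_within_open[OF _ U(1,3)] linear_basis_expansion[OF lin]
    by fastforce
qed

section \<open>Homogeneous Lagrangians and sprays in coordinates\<close>

definition fibre_homogeneous ::
  "((real^'n) \<times> (real^'n)) set \<Rightarrow> nat \<Rightarrow> ((real^'n) \<times> (real^'n) \<Rightarrow> real) \<Rightarrow> bool" where
  "fibre_homogeneous U k f \<longleftrightarrow>
     (\<forall>x y. \<forall>r>0. (x, y) \<in> U \<longrightarrow> f (x, r *\<^sub>R y) = r ^ k * f (x, y))"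

definition fibre_hessian ::
  "((real^'n) \<times> (real^'n) \<Rightarrow> real) \<Rightarrow> (real^'n) \<times> (real^'n) \<Rightarrow> real^'n^'n" where
  "fibre_hessian L z = (\<chi> i j. pd_y i (pd_y j L) z)"

text \<open>With \<open>X\<close> the coordinate expression of a spray, this is the Euler-Lagrange expression
  \<open>S(\<partial>L/\<partial>y\<^sup>i) - \<partial>L/\<partial>x\<^sup>i\<close>; for \<open>L = F\<^sup>2\<close> it vanishes exactly when \<open>S\<close> is the geodesic spray of \<open>F\<close>.\<close>

definition euler_lagrange ::
  "((real^'n) \<times> (real^'n) \<Rightarrow> (real^'n) \<times> (real^'n)) \<Rightarrow> ((real^'n) \<times> (real^'n) \<Rightarrow> real) \<Rightarrow>
   'n \<Rightarrow> (real^'n) \<times> (real^'n) \<Rightarrow> real" where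
  "euler_lagrange X L i z = frechet_derivative (pd_y i L) (at z) (X z) - pd_x i L z"

text \<open>The components of \<open>\<nabla>h\<close> written in terms of the coordinate expression \<open>X = (y, -2G)\<close> alone. Since
  \<open>G = - snd X / 2\<close>, the terms \<open>- N\<^sup>k\<^sub>i h\<^sub>k\<^sub>j\<close> carry the factor \<open>+ 1/2\<close>.\<close>

definition cov_deriv ::
  "((real^'n) \<times> (real^'n) \<Rightarrow> (real^'n) \<times> (real^'n)) \<Rightarrow> ((real^'n) \<times> (real^'n) \<Rightarrow> real^'n^'n) \<Rightarrow>
   (real^'n) \<times> (real^'n) \<Rightarrow> 'n \<Rightarrow> 'n \<Rightarrow> real" where
  "cov_deriv X h z i j = frechet_derivative (\<lambda>w. h w $ i $ j) (at z) (X z)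
     + (1/2) * (\<Sum>k\<in>UNIV. snd (frechet_derivative X (at z) (0, axis i 1)) $ k * h z $ k $ j)
     + (1/2) * (\<Sum>k\<in>UNIV. snd (frechet_derivative X (at z) (0, axis j 1)) $ k * h z $ i $ k)"

lemma pd_y_eqI: "(f has_derivative f') (at z) \<Longrightarrow> pd_y i f z = f' (0, axis i 1)"
  and pd_x_eqI: "(f has_derivative f') (at z) \<Longrightarrow> pd_x i f z = f' (axis i 1, 0)"
  using frechet_derivative_at[of f f' z] by (auto simp: pd_y_def pd_x_def)

lemma smooth_on_pd_y: "smooth_on U f \<Longrightarrow> smooth_on U (pd_y i f)"
  and smooth_on_pd_x: "smooth_on U f \<Longrightarrow> smooth_on U (pd_x i f)"
  using smooth_on_frechet_derivative[of U f] by (simp_all add: pd_y_def[abs_def] pd_x_def[abs_def])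

lemma pd_y_cong:
  assumes "open U" "z \<in> U" "\<And>w. w \<in> U \<Longrightarrow> f w = g w"
  shows "pd_y i f z = pd_y i g z"
  by (simp add: pd_y_def frechet_derivative_cong_open(1)[OF assms])

lemma vertical_linear_expansion:
  fixes D :: "'a::real_normed_vector \<times> (real^'n) \<Rightarrow> real"
  assumes "linear D"
  shows "D (0, v) = (\<Sum>k\<in>UNIV. v $ k * D (0, axis k 1))"
proof -
  have "linear (\<lambda>v. D (0, v))"
    using linear_compose[OF bounded_linear.linear[OF bounded_linear_Pair[OF bounded_linear_zero
          bounded_linear_ident]] assms] by (simp add: o_def)
  from linear_sum[OF this, of "\<lambda>k. v $ k *\<^sub>R axis k 1" UNIV] linear_scale[OF this]
  have "D (0, \<Sum>k\<in>UNIV. v $ k *\<^sub>R axis k 1) = (\<Sum>k\<in>UNIV. v $ k * D (0, axis k 1))" by simp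
  moreover have "(\<Sum>k\<in>UNIV. v $ k *\<^sub>R axis k 1) = v"
    using basis_expansion[of v] by (simp add: scalar_mult_eq_scaleR)
  ultimately show ?thesis by simp
qed

lemma vertical_derivative:
  assumes "smooth_on U f" "z \<in> U"
  shows "frechet_derivative f (at z) (0, v) = (\<Sum>k\<in>UNIV. v $ k * pd_y k f z)"
  using vertical_linear_expansion[OF has_derivative_linear[OF smooth_on_has_derivative[OF assms]], of v]
  by (simp add: pd_y_def)

lemma pd_y_commute:
  "open U \<Longrightarrow> smooth_on U f \<Longrightarrow> z \<in> U \<Longrightarrow> pd_y i (pd_y j f) z = pd_y j (pd_y i f) z"
  unfolding pd_y_def[abs_def] by (rule second_derivative_symmetric)

lemma pd_x_pd_y_commute:
  "open U \<Longrightarrow> smooth_on U f \<Longrightarrow> z \<in> U \<Longrightarrow> pd_x i (pd_y j f) z = pd_y j (pd_x i f) z"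
  unfolding pd_y_def[abs_def] pd_x_def[abs_def] by (rule second_derivative_symmetric)

lemma pd_y_mult:
  assumes "smooth_on U f" "smooth_on U g" "z \<in> U"
  shows "pd_y i (\<lambda>w. f w * g w) z = f z * pd_y i g z + pd_y i f z * g z"
  using pd_y_eqI[OF has_derivative_mult[OF assms(1,2)[THEN smooth_on_has_derivative, OF assms(3)]]]
  by (simp add: pd_y_def)

lemma pd_y_sum_fibre_coordinate:
  fixes \<eta> :: "'n::finite \<Rightarrow> (real^'n) \<times> (real^'n) \<Rightarrow> real"
  assumes "\<And>j. smooth_on U (\<eta> j)" "z \<in> U"
  shows "pd_y i (\<lambda>w. \<Sum>j\<in>UNIV. snd w $ j * \<eta> j w) z = \<eta> i z + (\<Sum>j\<in>UNIV. snd z $ j * pd_y i (\<eta> j) z)"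
proof -
  have "((\<lambda>w. \<Sum>j\<in>UNIV. snd w $ j * \<eta> j w) has_derivative
      (\<lambda>v. \<Sum>j\<in>UNIV. snd z $ j * frechet_derivative (\<eta> j) (at z) v + snd v $ j * \<eta> j z)) (at z)"
    by (intro has_derivative_sum has_derivative_mult smooth_on_has_derivative[OF assms]
        bounded_linear.has_derivative[OF bounded_linear_vec_nth] has_derivative_snd has_derivative_ident)
  from pd_y_eqI[OF this, of i] show ?thesis
    by (simp add: pd_y_def sum.distrib axis_def if_distrib[of "\<lambda>c. c * _"] cong: if_cong)
qed

text \<open>A spray in one chart: \<open>U\<close> is the coordinate domain in the slit tangent bundle, a cone in the fibre
  direction, and \<open>X = (y, -2G)\<close> with \<open>G\<close> homogeneous of degree 2.\<close>

locale spray_domain =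
  fixes U :: "((real^'n) \<times> (real^'n)) set" and X :: "(real^'n) \<times> (real^'n) \<Rightarrow> (real^'n) \<times> (real^'n)"
  assumes open_U: "open U"
    and cone: "(x, y) \<in> U \<Longrightarrow> r > 0 \<Longrightarrow> (x, r *\<^sub>R y) \<in> U"
    and smooth_X: "smooth_on U X"
    and fst_X: "z \<in> U \<Longrightarrow> fst (X z) = snd z"
    and snd_X: "(x, y) \<in> U \<Longrightarrow> r > 0 \<Longrightarrow> snd (X (x, r *\<^sub>R y)) = r\<^sup>2 *\<^sub>R snd (X (x, y))"
begin

lemma has_derivative_smooth: "smooth_on U f \<Longrightarrow> z \<in> U \<Longrightarrow> (f has_derivative frechet_derivative f (at z)) (at z)"
  by (rule smooth_on_has_derivative)

lemma linear_derivative: "smooth_on U f \<Longrightarrow> z \<in> U \<Longrightarrow> linear (frechet_derivative f (at z))"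
  by (rule has_derivative_linear[OF smooth_on_has_derivative])

lemma fst_derivative_X:
  assumes "z \<in> U"
  shows "fst (frechet_derivative X (at z) v) = snd v"
proof -
  have "((\<lambda>w. fst (X w)) has_derivative (\<lambda>v. fst (frechet_derivative X (at z) v))) (at z)"
    by (intro has_derivative_fst has_derivative_smooth smooth_X assms)
  then have "(snd has_derivative (\<lambda>v. fst (frechet_derivative X (at z) v))) (at z)"
    by (rule has_derivative_transform_within_open[OF _ open_U assms]) (rule fst_X)
  moreover have "(snd has_derivative snd) (at z)"
    by (intro bounded_linear_imp_has_derivative bounded_linear_snd)
  ultimately show ?thesis using has_derivative_unique by metis
qed

lemma has_derivative_along_X:
  fixes f :: "(real^'n) \<times> (real^'n) \<Rightarrow> real"
  assumes "smooth_on U f" "z \<in> U"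
  shows "((\<lambda>w. frechet_derivative f (at w) (X w)) has_derivative
    (\<lambda>v. frechet_derivative (\<lambda>w. frechet_derivative f (at w) v) (at z) (X z) +
      frechet_derivative f (at z) (frechet_derivative X (at z) v))) (at z)"
  by (intro has_derivative_along_field[OF open_U] has_derivative_smooth smooth_X assms)

lemma smooth_on_derivative_along_X:
  fixes f :: "(real^'n) \<times> (real^'n) \<Rightarrow> real"
  assumes "smooth_on U f"
  shows "smooth_on U (\<lambda>w. frechet_derivative f (at w) (X w))"
proof -
  have 1: "smooth_on U (\<lambda>w. \<Sum>b\<in>Basis. (X w \<bullet> b) *\<^sub>R frechet_derivative f (at w) b)"
    by (intro smooth_on_sum smooth_on_scaleR smooth_on_inner smooth_on_const
        smooth_on_frechet_derivative open_U smooth_X assms)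
  have 2: "frechet_derivative f (at w) (X w) =
      (\<Sum>b\<in>Basis. (X w \<bullet> b) *\<^sub>R frechet_derivative f (at w) b)" if "w \<in> U" for w
    by (rule linear_basis_expansion[OF linear_derivative[OF assms that]])
  show ?thesis
    by (rule smooth_on_cong[OF open_U 2, THEN iffD2, OF _ 1])
qed

lemma smooth_on_euler_lagrange: "smooth_on U L \<Longrightarrow> smooth_on U (euler_lagrange X L i)"
  unfolding euler_lagrange_def[abs_def]
  by (intro smooth_on_diff open_U smooth_on_derivative_along_X smooth_on_pd_y smooth_on_pd_x)

lemma pd_y_euler_lagrange:
  assumes "smooth_on U L" "z \<in> U"
  shows "pd_y j (euler_lagrange X L i) z =
    frechet_derivative (pd_y j (pd_y i L)) (at z) (X z) + pd_x j (pd_y i L) z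
    + (\<Sum>k\<in>UNIV. snd (frechet_derivative X (at z) (0, axis j 1)) $ k * pd_y k (pd_y i L) z)
    - pd_y j (pd_x i L) z"
proof -
  note L = smooth_on_pd_y[OF assms(1), of i]
  have "(euler_lagrange X L i has_derivative (\<lambda>v.
      frechet_derivative (\<lambda>w. frechet_derivative (pd_y i L) (at w) v) (at z) (X z)
      + frechet_derivative (pd_y i L) (at z) (frechet_derivative X (at z) v)
      - frechet_derivative (pd_x i L) (at z) v)) (at z)"
    unfolding euler_lagrange_def[abs_def]
    by (intro has_derivative_diff has_derivative_along_X L has_derivative_smooth
        smooth_on_pd_x assms)
  note pd_y_eqI[OF this, of j]
  moreover have "frechet_derivative X (at z) (0, axis j 1) =
      (axis j 1, 0) + (0, snd (frechet_derivative X (at z) (0, axis j 1)))"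
    using fst_derivative_X[OF assms(2), of "(0, axis j 1)"] by (simp add: prod_eq_iff)
  then have "frechet_derivative (pd_y i L) (at z) (frechet_derivative X (at z) (0, axis j 1)) =
      pd_x j (pd_y i L) z
      + (\<Sum>k\<in>UNIV. snd (frechet_derivative X (at z) (0, axis j 1)) $ k * pd_y k (pd_y i L) z)"
    using linear_add[OF linear_derivative[OF L assms(2)], of "(axis j 1, 0)"
        "(0, snd (frechet_derivative X (at z) (0, axis j 1)))"]
      vertical_derivative[OF L assms(2), of "snd (frechet_derivative X (at z) (0, axis j 1))"]
    by (simp add: pd_x_def)
  ultimately show ?thesis by (simp add: pd_y_def[abs_def])
qed

text \<open>The identity on which both parts of the theorem rest: the dynamical covariant derivative of a fibre
  Hessian is the symmetrised fibre derivative of the Euler-Lagrange expressions. The mixed terms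
  \<open>\<partial>\<^sup>2L/\<partial>x\<^sup>j\<partial>y\<^sup>i\<close> from the commutator cancel against those from \<open>\<partial>L/\<partial>x\<^sup>i\<close> in the symmetrisation.\<close>

lemma cov_deriv_fibre_hessian:
  assumes "smooth_on U L" "z \<in> U"
  shows "2 * cov_deriv X (fibre_hessian L) z i j =
    pd_y j (euler_lagrange X L i) z + pd_y i (euler_lagrange X L j) z"
proof -
  have "pd_y j (pd_y i L) w = pd_y i (pd_y j L) w" if "w \<in> U" for w
    using pd_y_commute[OF open_U assms(1) that] .
  then have "frechet_derivative (pd_y j (pd_y i L)) (at z) = frechet_derivative (pd_y i (pd_y j L)) (at z)"
    by (intro frechet_derivative_cong_open[OF open_U assms(2)])
  moreover have "pd_y i (pd_y k L) z = pd_y k (pd_y i L) z" for k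
    by (rule pd_y_commute[OF open_U assms])
  ultimately show ?thesis
    unfolding pd_y_euler_lagrange[OF assms]
    by (simp add: cov_deriv_def fibre_hessian_def pd_x_pd_y_commute[OF open_U assms] algebra_simps)
qed

lemma homogeneous_derivative:
  assumes "fibre_homogeneous U k f" "smooth_on U f" "(x, y) \<in> U" "r > 0"
  shows "frechet_derivative f (at (x, r *\<^sub>R y)) (a, r *\<^sub>R b) = r ^ k * frechet_derivative f (at (x, y)) (a, b)"
proof -
  let ?s = "\<lambda>w :: (real^'n) \<times> (real^'n). (fst w, r *\<^sub>R snd w)"
  have "(?s has_derivative ?s) (at (x, y))"
    by (intro bounded_linear_imp_has_derivative bounded_linear_Pair bounded_linear_fst
        bounded_linear_compose[OF bounded_linear_scaleR_right] bounded_linear_snd)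
  moreover have "(f has_derivative frechet_derivative f (at (x, r *\<^sub>R y))) (at (?s (x, y)))"
    using has_derivative_smooth[OF assms(2) cone[OF assms(3,4)]] by simp
  ultimately have "((\<lambda>w. f (?s w)) has_derivative (\<lambda>v. frechet_derivative f (at (x, r *\<^sub>R y)) (?s v))) (at (x, y))"
    using diff_chain_at by (fastforce simp: o_def)
  then have "((\<lambda>w. r ^ k * f w) has_derivative (\<lambda>v. frechet_derivative f (at (x, r *\<^sub>R y)) (?s v))) (at (x, y))"
    using assms(1,4)
    by (elim has_derivative_transform_within_open[OF _ open_U assms(3)]) (auto simp: fibre_homogeneous_def)
  moreover have "((\<lambda>w. r ^ k * f w) has_derivative (\<lambda>v. r ^ k * frechet_derivative f (at (x, y)) v)) (at (x, y))"
    by (intro has_derivative_mult_right has_derivative_smooth assms)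
  ultimately have "(\<lambda>v. frechet_derivative f (at (x, r *\<^sub>R y)) (?s v)) =
      (\<lambda>v. r ^ k * frechet_derivative f (at (x, y)) v)"
    by (rule has_derivative_unique)
  from fun_cong[OF this, of "(a, b)"] show ?thesis by simp
qed

lemma homogeneous_pd_x:
  assumes "fibre_homogeneous U k f" "smooth_on U f"
  shows "fibre_homogeneous U k (pd_x i f)"
  using homogeneous_derivative[OF assms, of _ _ _ "axis i 1" 0]
  by (auto simp: fibre_homogeneous_def pd_x_def)

lemma homogeneous_pd_y:
  assumes "fibre_homogeneous U (Suc k) f" "smooth_on U f"
  shows "fibre_homogeneous U k (pd_y i f)"
  unfolding fibre_homogeneous_def pd_y_def
proof (intro allI impI)
  fix x y and r :: real assume *: "r > 0" "(x, y) \<in> U"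
  have "r * frechet_derivative f (at (x, r *\<^sub>R y)) (0, axis i 1) =
      frechet_derivative f (at (x, r *\<^sub>R y)) (0, r *\<^sub>R axis i 1)"
    using linear_scale[OF linear_derivative[OF assms(2) cone[OF *(2,1)]], of r "(0, axis i 1)"] by simp
  also have "\<dots> = r * (r ^ k * frechet_derivative f (at (x, y)) (0, axis i 1))"
    using homogeneous_derivative[OF assms *(2,1)] by simp
  finally show "frechet_derivative f (at (x, r *\<^sub>R y)) (0, axis i 1) =
      r ^ k * frechet_derivative f (at (x, y)) (0, axis i 1)"
    using *(1) by simp
qed

lemma homogeneous_derivative_along_X:
  assumes "fibre_homogeneous U k f" "smooth_on U f"
  shows "fibre_homogeneous U (Suc k) (\<lambda>w. frechet_derivative f (at w) (X w))"
  unfolding fibre_homogeneous_def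
proof (intro allI impI)
  fix x y and r :: real assume *: "r > 0" "(x, y) \<in> U"
  have "X (x, r *\<^sub>R y) = r *\<^sub>R (y, r *\<^sub>R snd (X (x, y)))"
    using fst_X[OF cone[OF *(2,1)]] snd_X[OF *(2,1)] by (simp add: prod_eq_iff power2_eq_square)
  then have "frechet_derivative f (at (x, r *\<^sub>R y)) (X (x, r *\<^sub>R y)) =
      r * (r ^ k * frechet_derivative f (at (x, y)) (y, snd (X (x, y))))"
    using linear_scale[OF linear_derivative[OF assms(2) cone[OF *(2,1)]], of r "(y, r *\<^sub>R snd (X (x, y)))"]
      homogeneous_derivative[OF assms *(2,1), of y "snd (X (x, y))"] by simp
  moreover have "(y, snd (X (x, y))) = X (x, y)" using fst_X[OF *(2)] by (simp add: prod_eq_iff)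
  ultimately show "frechet_derivative f (at (x, r *\<^sub>R y)) (X (x, r *\<^sub>R y)) =
      r ^ Suc k * frechet_derivative f (at (x, y)) (X (x, y))" by simp
qed

lemma euler_identity:
  assumes "fibre_homogeneous U k f" "smooth_on U f" "z \<in> U"
  shows "frechet_derivative f (at z) (0, snd z) = k * f z"
proof -
  obtain x y where z: "z = (x, y)" by fastforce
  have "((\<lambda>s. f ((x, 0) + s *\<^sub>R (0, y))) has_real_derivative frechet_derivative f (at z) (0, y)) (at 1)"
    using has_derivative_smooth[OF assms(2,3)] by (intro derivative_along_line) (simp add: z)
  then have "((\<lambda>s. s ^ k * f z) has_real_derivative frechet_derivative f (at z) (0, y)) (at 1)"
    using assms(1,3) unfolding z
    by (elim has_field_derivative_transform_within_open[where S = "{0<..}"])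
      (auto simp: fibre_homogeneous_def)
  moreover have "((\<lambda>s. s ^ k * f z) has_real_derivative k * f z) (at 1)"
    by (auto intro!: derivative_eq_intros)
  ultimately show ?thesis using DERIV_unique by (fastforce simp: z)
qed

lemma euler_identity_sum:
  assumes "fibre_homogeneous U k f" "smooth_on U f" "z \<in> U"
  shows "(\<Sum>j\<in>UNIV. snd z $ j * pd_y j f z) = k * f z"
  using euler_identity[OF assms] vertical_derivative[OF assms(2,3)] by simp

lemma homogeneous_euler_lagrange:
  assumes "fibre_homogeneous U 2 L" "smooth_on U L"
  shows "fibre_homogeneous U 2 (euler_lagrange X L i)"
proof -
  have "fibre_homogeneous U 1 (pd_y i L)"
    using homogeneous_pd_y[of 1 L] assms by (simp add: numeral_2_eq_2)
  then have "fibre_homogeneous U 2 (\<lambda>w. frechet_derivative (pd_y i L) (at w) (X w))"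
    using homogeneous_derivative_along_X[of 1 "pd_y i L"] smooth_on_pd_y[OF assms(2)]
    by (simp add: numeral_2_eq_2)
  with homogeneous_pd_x[OF assms] show ?thesis
    by (simp add: fibre_homogeneous_def euler_lagrange_def algebra_simps)
qed

text \<open>By Euler's identity \<open>y\<^sup>i S(\<partial>L/\<partial>y\<^sup>i)\<close> counts the horizontal part \<open>y\<^sup>i \<partial>L/\<partial>x\<^sup>i\<close> of \<open>S(L)\<close> twice and the vertical
  part once, and the surplus is \<open>y\<^sup>i \<partial>L/\<partial>x\<^sup>i\<close>. So a spray that solves the Euler-Lagrange equations
  of \<open>L\<close> conserves \<open>L\<close>.\<close>

lemma contracted_euler_lagrange:
  assumes "fibre_homogeneous U 2 L" "smooth_on U L" "z \<in> U"
  shows "(\<Sum>i\<in>UNIV. snd z $ i * euler_lagrange X L i z) = frechet_derivative L (at z) (X z)"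
proof -
  let ?D = "\<lambda>v w. frechet_derivative L (at w) v"
  obtain x y where z: "z = (x, y)" by fastforce
  have X: "X z = (y, 0) + (0, snd (X z))" using fst_X[OF assms(3)] by (simp add: z prod_eq_iff)
  have sD: "smooth_on U (?D v)" for v by (rule smooth_on_frechet_derivative[OF assms(2)])
  have lin: "linear (\<lambda>v. ?D v w)" if "w \<in> U" for w using linear_derivative[OF assms(2) that] .
  have hor: "fibre_homogeneous U 2 (?D (v, 0))" for v
    using homogeneous_derivative[OF assms(1,2), of _ _ _ v 0] by (auto simp: fibre_homogeneous_def)
  have ver: "fibre_homogeneous U 1 (?D (0, v))" for v
    unfolding fibre_homogeneous_def
  proof (intro allI impI)
    fix x y and r :: real assume *: "r > 0" "(x, y) \<in> U"
    have "(0, r *\<^sub>R v) = r *\<^sub>R (0 :: real^'n, v)" by simp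
    then have "?D (0, r *\<^sub>R v) (x, r *\<^sub>R y) = r * ?D (0, v) (x, r *\<^sub>R y)"
      using linear_scale[OF lin[OF cone[OF *(2,1)]], of r "(0, v)"] by (simp only: real_scaleR_def)
    moreover have "?D (0, r *\<^sub>R v) (x, r *\<^sub>R y) = r * (r * ?D (0, v) (x, y))"
      using homogeneous_derivative[OF assms(1,2) *(2,1), of 0 v] by (simp add: power2_eq_square)
    ultimately have "r * ?D (0, v) (x, r *\<^sub>R y) = r * (r * ?D (0, v) (x, y))" by (rule trans[OF sym])
    then show "?D (0, v) (x, r *\<^sub>R y) = r ^ 1 * ?D (0, v) (x, y)"
      using * by (simp only: mult_left_cancel[of r] power_one_right)
  qed
  have "(\<Sum>i\<in>UNIV. snd z $ i * frechet_derivative (pd_y i L) (at z) v) =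
      frechet_derivative (?D v) (at z) (0, y)" for v
    using vertical_derivative[OF sD assms(3), of v y]
    by (simp add: pd_y_def[abs_def] z
        second_derivative_symmetric[OF open_U assms(2) assms(3)[unfolded z], of "(0, axis _ 1)" v])
  moreover have "(\<Sum>i\<in>UNIV. snd z $ i * frechet_derivative (pd_y i L) (at z) (X z)) =
      (\<Sum>i\<in>UNIV. snd z $ i * frechet_derivative (pd_y i L) (at z) (y, 0))
      + (\<Sum>i\<in>UNIV. snd z $ i * frechet_derivative (pd_y i L) (at z) (0, snd (X z)))"
    using linear_add[OF linear_derivative[OF smooth_on_pd_y[OF assms(2)] assms(3)], of _ "(y, 0)" "(0, snd (X z))"]
    by (subst X) (simp add: sum.distrib[symmetric] algebra_simps)
  ultimately have "(\<Sum>i\<in>UNIV. snd z $ i * frechet_derivative (pd_y i L) (at z) (X z)) =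
      2 * ?D (y, 0) z + ?D (0, snd (X z)) z"
    using euler_identity[OF hor sD assms(3)] euler_identity[OF ver sD assms(3)] by (simp add: z)
  moreover have "(\<Sum>i\<in>UNIV. snd z $ i * pd_x i L z) = ?D (y, 0) z"
  proof -
    have "linear (\<lambda>w :: (real^'n) \<times> (real^'n). ?D (snd w, 0) z)"
      using linear_compose[OF bounded_linear.linear[OF bounded_linear_Pair[OF bounded_linear_snd
            bounded_linear_zero]] lin[OF assms(3)]] by (simp add: o_def)
    from vertical_linear_expansion[OF this, of y] show ?thesis by (simp add: pd_x_def z)
  qed
  moreover have "?D (X z) z = ?D (y, 0) z + ?D (0, snd (X z)) z"
    using linear_add[OF lin[OF assms(3)]] X by metis
  ultimately show ?thesis
    by (simp add: euler_lagrange_def right_diff_distrib sum_subtractf)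
qed

text \<open>Contracting \<open>\<partial>\<^sub>j\<eta>\<^sub>i + \<partial>\<^sub>i\<eta>\<^sub>j = 0\<close> with \<open>y\<^sup>i y\<^sup>j\<close> gives \<open>\<theta> = y\<^sup>i \<eta>\<^sub>i = 0\<close> by Euler's identity. Then
  \<open>0 = \<partial>\<^sub>i\<theta> = \<eta>\<^sub>i + y\<^sup>j \<partial>\<^sub>i\<eta>\<^sub>j = \<eta>\<^sub>i - y\<^sup>j \<partial>\<^sub>j\<eta>\<^sub>i = - \<eta>\<^sub>i\<close>, where the degree 2 enters in the last step.\<close>

lemma skew_homogeneous_zero:
  fixes \<eta> :: "'n \<Rightarrow> (real^'n) \<times> (real^'n) \<Rightarrow> real"
  assumes hom: "\<And>i. fibre_homogeneous U 2 (\<eta> i)" and smooth: "\<And>i. smooth_on U (\<eta> i)"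
    and skew: "\<And>i j z. z \<in> U \<Longrightarrow> pd_y j (\<eta> i) z + pd_y i (\<eta> j) z = 0"
    and z: "z \<in> U"
  shows "\<eta> i z = 0"
proof -
  let ?\<theta> = "\<lambda>w. \<Sum>j\<in>UNIV. snd w $ j * \<eta> j w"
  have contr: "(\<Sum>j\<in>UNIV. snd w $ j * pd_y i (\<eta> j) w) = - 2 * \<eta> i w" if "w \<in> U" for w i
  proof -
    have "(\<Sum>j\<in>UNIV. snd w $ j * pd_y i (\<eta> j) w) = - (\<Sum>j\<in>UNIV. snd w $ j * pd_y j (\<eta> i) w)"
    proof -
      have "pd_y i (\<eta> j) w = - pd_y j (\<eta> i) w" for j using skew[OF that, of j i] by linarith
      then show ?thesis by (simp add: sum_negf)
    qed
    then show ?thesis using euler_identity_sum[OF hom smooth that] by simp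
  qed
  have "?\<theta> w = 0" if "w \<in> U" for w
  proof -
    have "- 2 * ?\<theta> w = (\<Sum>i\<in>UNIV. snd w $ i * (\<Sum>j\<in>UNIV. snd w $ j * pd_y i (\<eta> j) w))"
      using contr[OF that] by (simp add: sum_distrib_left algebra_simps sum_negf)
    also have "\<dots> = (\<Sum>j\<in>UNIV. snd w $ j * (\<Sum>i\<in>UNIV. snd w $ i * pd_y i (\<eta> j) w))"
      unfolding sum_distrib_left by (subst sum.swap) (simp add: algebra_simps)
    also have "\<dots> = 2 * ?\<theta> w"
      using euler_identity_sum[OF hom smooth that] by (simp add: sum_distrib_left algebra_simps)
    finally show ?thesis by simp
  qed
  then have "pd_y i ?\<theta> z = 0"
    using pd_y_cong[OF open_U z, of ?\<theta> "\<lambda>_. 0"] by (simp add: pd_y_def)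
  then show ?thesis
    using pd_y_sum_fibre_coordinate[OF smooth z, of i] contr[OF z, of i] by simp
qed

end

section \<open>Projective change of a spray in coordinates\<close>

lemma cov_deriv_cong:
  assumes "open U" "z \<in> U" "\<And>w. w \<in> U \<Longrightarrow> h w = h' w"
  shows "cov_deriv X h z i j = cov_deriv X h' z i j"
proof -
  have "frechet_derivative (\<lambda>w. h w $ i $ j) (at z) = frechet_derivative (\<lambda>w. h' w $ i $ j) (at z)"
    by (rule frechet_derivative_cong_open(1)[OF assms(1,2)]) (simp add: assms(3))
  then show ?thesis by (simp add: cov_deriv_def assms)
qed

lemma cov_deriv_scale:
  assumes "(\<lambda>w. h w $ i $ j) differentiable (at z)"
  shows "cov_deriv X (\<lambda>w. \<chi> i j. c * h w $ i $ j) z i j = c * cov_deriv X h z i j"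
proof -
  have "((\<lambda>w. c * h w $ i $ j) has_derivative (\<lambda>v. c * frechet_derivative (\<lambda>w. h w $ i $ j) (at z) v)) (at z)"
    using assms by (intro has_derivative_mult_right) (simp add: frechet_derivative_works)
  from frechet_derivative_at[OF this, symmetric] show ?thesis
    by (simp add: cov_deriv_def algebra_simps sum_distrib_left)
qed

context spray_domain
begin

text \<open>\<open>S\<close> and \<open>S - 2PC\<close> differ by a multiple of the Liouville field \<open>C\<close>, which acts on the homogeneous
  function \<open>\<partial>L/\<partial>y\<^sup>i\<close> as multiplication by its degree.\<close>

lemma euler_lagrange_projective_change:
  assumes "fibre_homogeneous U (Suc k) L" "smooth_on U L" "z \<in> U"
  shows "euler_lagrange (\<lambda>w. X w - (0, (2 * P w) *\<^sub>R snd w)) L i z =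
    euler_lagrange X L i z - 2 * P z * (k * pd_y i L z)"
proof -
  note L = smooth_on_pd_y[OF assms(2), of i]
  note lin = linear_derivative[OF L assms(3)]
  have "frechet_derivative (pd_y i L) (at z) (X z - (0, (2 * P z) *\<^sub>R snd z)) =
      frechet_derivative (pd_y i L) (at z) (X z)
      - (2 * P z) * frechet_derivative (pd_y i L) (at z) (0, snd z)"
    using linear_diff[OF lin, of "X z"] linear_scale[OF lin, of "2 * P z" "(0, snd z)"] by simp
  moreover have "frechet_derivative (pd_y i L) (at z) (0, snd z) = k * pd_y i L z"
    by (intro euler_identity homogeneous_pd_y L assms)
  ultimately show ?thesis by (simp add: euler_lagrange_def)
qed

text \<open>For \<open>\<eta>\<^sub>i\<close>, the Euler-Lagrange expression of \<open>E\<close> minus \<open>2P \<partial>E/\<partial>y\<^sup>i\<close>, the equation on the right is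
  \<open>\<eta>\<^sub>i = 0\<close> and the one on the left is \<open>\<partial>\<eta>\<^sub>i/\<partial>y\<^sup>j + \<partial>\<eta>\<^sub>j/\<partial>y\<^sup>i = 0\<close>. They are equivalent because \<open>\<eta>\<^sub>i\<close> has
  degree 2.\<close>

lemma projective_equation_iff:
  assumes E: "smooth_on U E" "fibre_homogeneous U 2 E" and P: "smooth_on U P" "fibre_homogeneous U 1 P"
  shows "(\<forall>z\<in>U. \<forall>i j. 2 * cov_deriv X (fibre_hessian E) z i j =
      pd_y j (\<lambda>w. 2 * P w * pd_y i E w) z + pd_y i (\<lambda>w. 2 * P w * pd_y j E w) z) \<longleftrightarrow>
    (\<forall>z\<in>U. \<forall>i. euler_lagrange X E i z = 2 * P z * pd_y i E z)"
    (is "?L \<longleftrightarrow> ?R")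
proof
  assume ?R
  then have "pd_y j (euler_lagrange X E i) z = pd_y j (\<lambda>w. 2 * P w * pd_y i E w) z" if "z \<in> U" for z i j
    using that by (intro pd_y_cong[OF open_U]) auto
  then show ?L using cov_deriv_fibre_hessian[OF E(1)] by simp
next
  assume L: ?L
  define \<eta> where "\<eta> i w = euler_lagrange X E i w - 2 * P w * pd_y i E w" for i w
  have sE: "smooth_on U (euler_lagrange X E i)" for i by (rule smooth_on_euler_lagrange[OF E(1)])
  have sP: "smooth_on U (\<lambda>w. 2 * P w * pd_y i E w)" for i
    by (intro smooth_on_mult smooth_on_pd_y smooth_on_const E P open_U)
  have s: "smooth_on U (\<eta> i)" for i
    unfolding \<eta>_def[abs_def] by (intro smooth_on_diff sE sP open_U)
  have hE: "fibre_homogeneous U 1 (pd_y i E)" for i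
    using homogeneous_pd_y[of 1 E] E by (simp add: numeral_2_eq_2)
  have h: "fibre_homogeneous U 2 (\<eta> i)" for i
    using homogeneous_euler_lagrange[OF E(2,1), of i] hE[of i] P(2)
    by (simp add: fibre_homogeneous_def \<eta>_def power2_eq_square algebra_simps)
  have d: "pd_y j (\<eta> i) z = pd_y j (euler_lagrange X E i) z - pd_y j (\<lambda>w. 2 * P w * pd_y i E w) z"
    if "z \<in> U" for i j z
    unfolding \<eta>_def[abs_def]
    using pd_y_eqI[OF has_derivative_diff[OF has_derivative_smooth[OF sE that] has_derivative_smooth[OF sP that]]]
    by (simp add: pd_y_def)
  have "\<eta> i z = 0" if "z \<in> U" for i z
  proof (rule skew_homogeneous_zero[OF h s _ that])
    fix i j z assume z: "z \<in> U"
    show "pd_y j (\<eta> i) z + pd_y i (\<eta> j) z = 0"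
      using L z cov_deriv_fibre_hessian[OF E(1) z, of i j] unfolding d[OF z] by force
  qed
  then show ?R by (simp add: \<eta>_def)
qed

text \<open>By Euler's identity \<open>g\<^sub>i\<^sub>k y\<^sup>k = (1/2) \<partial>E/\<partial>y\<^sup>i\<close>, so the right-hand side of the equation for \<open>\<nabla>g\<close> is what the
  product rule makes of the symmetrised fibre derivative of \<open>(1/2) P \<partial>E/\<partial>y\<^sup>i\<close>.\<close>

lemma metric_equation_iff:
  assumes E: "smooth_on U E" "fibre_homogeneous U 2 E" and P: "smooth_on U P"
    and z: "z \<in> U" and g: "g = (\<lambda>w. \<chi> i j. (1/2) * pd_y i (pd_y j E) w)"
  shows "cov_deriv X g z i j = 2 * P z * g z $ i $ j
      + pd_y i P z * (\<Sum>k\<in>UNIV. g z $ k $ j * snd z $ k) + pd_y j P z * (\<Sum>k\<in>UNIV. g z $ i $ k * snd z $ k)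
    \<longleftrightarrow> 2 * cov_deriv X (fibre_hessian E) z i j =
      pd_y j (\<lambda>w. 2 * P w * pd_y i E w) z + pd_y i (\<lambda>w. 2 * P w * pd_y j E w) z"
proof -
  have sE: "smooth_on U (pd_y i E)" for i by (rule smooth_on_pd_y[OF E(1)])
  have hE: "fibre_homogeneous U 1 (pd_y i E)" for i
    using homogeneous_pd_y[of 1 E] E by (simp add: numeral_2_eq_2)
  have contr: "(\<Sum>k\<in>UNIV. pd_y k (pd_y i E) z * snd z $ k) = pd_y i E z" for i
    using euler_identity_sum[OF hE sE z, of i] by (simp add: mult.commute)
  have 1: "(\<Sum>k\<in>UNIV. g z $ k $ j * snd z $ k) = pd_y j E z / 2"
    using contr[of j] by (simp add: g sum_divide_distrib[symmetric])
  have 2: "(\<Sum>k\<in>UNIV. g z $ i $ k * snd z $ k) = pd_y i E z / 2"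
    using contr[of i] by (simp add: g sum_divide_distrib[symmetric] pd_y_commute[OF open_U E(1) z, of i])
  have "cov_deriv X g z i j = cov_deriv X (\<lambda>w. \<chi> i j. (1/2) * fibre_hessian E w $ i $ j) z i j"
    by (simp add: g fibre_hessian_def)
  also have "\<dots> = (1/2) * cov_deriv X (fibre_hessian E) z i j"
    using has_derivative_smooth[OF smooth_on_pd_y[OF sE] z]
    by (intro cov_deriv_scale) (auto simp: fibre_hessian_def differentiable_def)
  finally have 3: "cov_deriv X g z i j = (1/2) * cov_deriv X (fibre_hessian E) z i j" .
  have 4: "pd_y j (\<lambda>w. 2 * P w * pd_y i E w) z = 2 * P z * pd_y j (pd_y i E) z + 2 * pd_y j P z * pd_y i E z" for i j
  proof -
    have "smooth_on U (\<lambda>w. 2 * P w)" by (intro smooth_on_mult smooth_on_const P open_U)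
    from pd_y_mult[OF this sE z, of j i] pd_y_mult[OF smooth_on_const[of U 2] P z, of j]
    show ?thesis by (simp add: pd_y_def[of _ "\<lambda>_. 2"])
  qed
  have "g z $ i $ j = pd_y i (pd_y j E) z / 2" by (simp add: g)
  then show ?thesis
    unfolding 1 2 3 4 pd_y_commute[OF open_U E(1) z, of j i] by (auto simp: field_simps)
qed

lemma angular_metric_eq_fibre_hessian:
  assumes F: "smooth_on U F" "z \<in> U" "F z \<noteq> 0"
  shows "(1 / F z) * ((1/2) * pd_y i (pd_y j (\<lambda>w. (F w)\<^sup>2)) z - pd_y i F z * pd_y j F z) =
    pd_y i (pd_y j F) z"
proof -
  have "pd_y j (\<lambda>w. (F w)\<^sup>2) w = 2 * (F w * pd_y j F w)" if "w \<in> U" for w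
    using pd_y_mult[OF F(1,1) that, of j] by (simp add: power2_eq_square)
  then have "pd_y i (pd_y j (\<lambda>w. (F w)\<^sup>2)) z = pd_y i (\<lambda>w. 2 * (F w * pd_y j F w)) z"
    by (rule pd_y_cong[OF open_U F(2)])
  also have "\<dots> = 2 * pd_y i (\<lambda>w. F w * pd_y j F w) z"
    using pd_y_mult[OF smooth_on_const[of U 2] smooth_on_mult[OF open_U F(1) smooth_on_pd_y[OF F(1)]] F(2), of i j]
    by (simp add: pd_y_def[of _ "\<lambda>_. 2"])
  finally show ?thesis
    using F(3) by (simp add: pd_y_mult[OF F(1) smooth_on_pd_y[OF F(1)] F(2)] field_simps)
qed

text \<open>The Euler-Lagrange expression of \<open>F\<^sup>2\<close> is \<open>2F\<close> times that of \<open>F\<close> plus \<open>2 S(F) \<partial>F/\<partial>y\<^sup>i\<close>, and \<open>S(F) = 0\<close>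
  because \<open>F\<^sup>2\<close> is conserved.\<close>

lemma euler_lagrange_energy_imp_length:
  assumes F: "smooth_on U F" "fibre_homogeneous U 1 F" "\<And>z. z \<in> U \<Longrightarrow> F z > 0"
    and EL: "\<And>i. euler_lagrange X (\<lambda>w. (F w)\<^sup>2) i z = 0" and z: "z \<in> U"
  shows "euler_lagrange X F i z = 0"
proof -
  let ?E = "\<lambda>w. (F w)\<^sup>2"
  have sE: "smooth_on U ?E" unfolding power2_eq_square by (intro smooth_on_mult F open_U)
  have hE: "fibre_homogeneous U 2 ?E"
    using F(2) by (simp add: fibre_homogeneous_def power_mult_distrib)
  have dE: "(?E has_derivative (\<lambda>v. 2 * F w * frechet_derivative F (at w) v)) (at w)" if "w \<in> U" for w
    unfolding power2_eq_square
    using has_derivative_mult[OF has_derivative_smooth[OF F(1) that] has_derivative_smooth[OF F(1) that]]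
    by (simp add: algebra_simps)
  have "frechet_derivative ?E (at z) (X z) = 0"
    using contracted_euler_lagrange[OF hE sE z] EL by simp
  then have F0: "frechet_derivative F (at z) (X z) = 0"
    using fun_cong[OF frechet_derivative_at[OF dE[OF z]], of "X z"] F(3)[OF z] by simp
  have "pd_y i ?E w = 2 * F w * pd_y i F w" if "w \<in> U" for w
    using pd_y_eqI[OF dE[OF that]] by (simp add: pd_y_def)
  then have "frechet_derivative (pd_y i ?E) (at z) = frechet_derivative (\<lambda>w. 2 * F w * pd_y i F w) (at z)"
    by (rule frechet_derivative_cong_open(1)[OF open_U z])
  moreover have "((\<lambda>w. 2 * F w * pd_y i F w) has_derivative
      (\<lambda>v. 2 * F z * frechet_derivative (pd_y i F) (at z) v + 2 * frechet_derivative F (at z) v * pd_y i F z)) (at z)"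
    by (intro has_derivative_mult has_derivative_mult_right has_derivative_smooth z F smooth_on_pd_y)
  ultimately have "frechet_derivative (pd_y i ?E) (at z) (X z) = 2 * F z * frechet_derivative (pd_y i F) (at z) (X z)"
    using fun_cong[OF frechet_derivative_at, of _ _ z "X z"] F0 by fastforce
  moreover have "pd_x i ?E z = 2 * F z * pd_x i F z"
    using pd_x_eqI[OF dE[OF z]] by (simp add: pd_x_def)
  ultimately have "2 * F z * euler_lagrange X F i z = euler_lagrange X ?E i z"
    by (simp add: euler_lagrange_def algebra_simps)
  then show ?thesis using EL F(3)[OF z] by simp
qed

end

section \<open>Ordinary differential equations\<close>

lemma frechet_derivative_bound_on_compact:
  fixes f :: "'e::euclidean_space \<Rightarrow> 'f::real_normed_vector"
  assumes "smooth_on U f" "K \<subseteq> U" "compact K"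
  obtains L where "L > 0" "\<And>x. x \<in> K \<Longrightarrow> onorm (frechet_derivative f (at x)) \<le> L"
proof -
  let ?s = "\<lambda>x. \<Sum>b\<in>Basis. norm (frechet_derivative f (at x) b)"
  have "continuous_on K (\<lambda>x. frechet_derivative f (at x) b)" for b
    by (rule smooth_on_continuous_on[OF smooth_on_frechet_derivative[OF smooth_on_subset[OF assms(1,2)]]])
  then have "continuous_on K ?s" by (intro continuous_on_sum continuous_on_norm)
  then have "bounded (?s ` K)" using assms(3) compact_continuous_image compact_imp_bounded by blast
  then obtain L where L: "L > 0" "\<And>x. x \<in> K \<Longrightarrow> norm (?s x) \<le> L"
    unfolding bounded_pos by auto
  have "onorm (frechet_derivative f (at x)) \<le> L" if x: "x \<in> K" for x
  proof (rule onorm_bound)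
    fix v
    have "linear (frechet_derivative f (at x))"
      using assms(2) x by (intro has_derivative_linear[OF smooth_on_has_derivative[OF assms(1)]]) auto
    from linear_basis_expansion[OF this, of v]
    have "norm (frechet_derivative f (at x) v) \<le> (\<Sum>b\<in>Basis. norm ((v \<bullet> b) *\<^sub>R frechet_derivative f (at x) b))"
      by (metis norm_sum)
    also have "\<dots> \<le> (\<Sum>b\<in>Basis. norm v * norm (frechet_derivative f (at x) b))"
      by (auto intro!: sum_mono mult_right_mono Basis_le_norm)
    also have "\<dots> = norm v * ?s x" by (simp add: sum_distrib_left)
    also have "\<dots> \<le> norm v * L" using L(2)[OF x] by (intro mult_left_mono) auto
    finally show "norm (frechet_derivative f (at x) v) \<le> L * norm v" by (simp add: mult.commute)
  qed (use L in auto)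
  then show thesis using that L(1) by blast
qed

text \<open>The Picard operator on bounded continuous functions on the whole line; clamping the upper limit of
  integration to \<open>[-a, a]\<close> keeps its values bounded. The integrals start at the left endpoint \<open>-a\<close>, and
  the second one moves the initial value back to time 0, at the price of a larger Lipschitz constant.\<close>

lemma integral_equation_solution:
  fixes g :: "'e::euclidean_space \<Rightarrow> 'e"
  assumes bound: "\<And>x. norm (g x) \<le> B" and lip: "\<And>x y. dist (g x) (g y) \<le> L * dist x y"
    and "0 \<le> L" "0 < a" "6 * a * L \<le> 1"
  obtains w :: "real \<Rightarrow> 'e" where "continuous_on UNIV w"
    "\<And>t. t \<in> {- a..a} \<Longrightarrow> w t = z0 + integral {- a..t} (\<lambda>s. g (w s)) - integral {- a..0} (\<lambda>s. g (w s))"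
proof -
  define c where "c t = max (- a) (min a t)" for t
  have c: "c t \<in> {- a..a}" for t using assms(4) by (auto simp: c_def)
  have contg: "continuous_on S g" for S
    using assms(3) by (intro lipschitz_on_continuous_on[where L = L] lipschitz_onI lip)
  have gw: "continuous_on S (\<lambda>s. g (apply_bcontfun w s))" for S and w :: "real \<Rightarrow>\<^sub>C 'e"
    by (intro continuous_on_compose2[OF contg[of UNIV]]) auto
  define T where "T w t = z0 + integral {- a..c t} (\<lambda>s. g (w s)) - integral {- a..0} (\<lambda>s. g (w s))"
    for w :: "real \<Rightarrow> 'e" and t
  have T_bcont: "T (apply_bcontfun w) \<in> bcontfun" for w :: "real \<Rightarrow>\<^sub>C 'e"
  proof (rule bcontfun_normI)
    have "continuous_on {- a..a} (\<lambda>t. integral {- a..t} (\<lambda>s. g (w s)))"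
      by (intro indefinite_integral_continuous_1 integrable_continuous_real gw)
    then have "continuous_on UNIV (\<lambda>t. integral {- a..c t} (\<lambda>s. g (w s)))"
      by (rule continuous_on_compose2) (use c in \<open>auto simp: c_def intro!: continuous_intros\<close>)
    then show "continuous_on UNIV (T w)"
      unfolding T_def by (intro continuous_intros)
    fix t
    have "norm (integral {- a..c t} (\<lambda>s. g (w s))) \<le> B * (c t - - a)"
      using c[of t] by (intro integral_bound gw bound) auto
    moreover have "norm (integral {- a..0} (\<lambda>s. g (w s))) \<le> B * (0 - - a)"
      using assms(4) by (intro integral_bound gw bound) auto
    moreover have "B * (c t - - a) \<le> B * (2 * a)"
      using c[of t] order_trans[OF norm_ge_zero bound] by (intro mult_left_mono) auto
    ultimately show "norm (T w t) \<le> norm z0 + B * (2 * a) + B * a"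
      using norm_triangle_ineq4[of "z0 + integral {- a..c t} (\<lambda>s. g (w s))" "integral {- a..0} (\<lambda>s. g (w s))"]
        norm_triangle_ineq[of z0 "integral {- a..c t} (\<lambda>s. g (w s))"]
      unfolding T_def by simp
  qed
  define \<Phi> where "\<Phi> w = Bcontfun (T (apply_bcontfun w))" for w :: "real \<Rightarrow>\<^sub>C 'e"
  have \<Phi>: "apply_bcontfun (\<Phi> w) = T w" for w
    unfolding \<Phi>_def by (rule Bcontfun_inverse[OF T_bcont])
  have "dist (\<Phi> v) (\<Phi> w) \<le> (1/2) * dist v w" for v w
  proof (rule dist_bound)
    fix t
    let ?d = "\<lambda>s. g (v s) - g (w s)"
    let ?D = "L * dist v w"
    have d: "norm (?d s) \<le> ?D" for s
      using order_trans[OF lip mult_left_mono[OF dist_bounded assms(3)]] by (simp flip: dist_norm)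
    have int: "(\<lambda>s. g (apply_bcontfun w s)) integrable_on {x..y}" for x y and w :: "real \<Rightarrow>\<^sub>C 'e"
      by (intro integrable_continuous_real gw)
    have cd: "continuous_on S ?d" for S by (intro continuous_on_diff gw)
    have "norm (integral {- a..c t} ?d) \<le> ?D * (c t - - a)"
      using c[of t] by (intro integral_bound cd d) auto
    moreover have "norm (integral {- a..0} ?d) \<le> ?D * (0 - - a)"
      using assms(4) by (intro integral_bound cd d) auto
    moreover have "?D * (c t - - a) \<le> ?D * (2 * a)"
      using c[of t] assms(3) by (intro mult_left_mono) auto
    moreover have T_diff: "T v t - T w t = integral {- a..c t} ?d - integral {- a..0} ?d"
      by (simp add: T_def Henstock_Kurzweil_Integration.integral_diff int)
    ultimately have "norm (T v t - T w t) \<le> ?D * (2 * a) + ?D * a"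
      using norm_triangle_ineq4[of "integral {- a..c t} ?d" "integral {- a..0} ?d"]
      unfolding T_diff by (simp add: algebra_simps)
    \<comment> \<open>The two integrals have total length at most \<open>3a\<close>; the factor 6 makes the contraction constant \<open>1/2\<close>.\<close>
    also have "\<dots> = (6 * a * L) * (dist v w / 2)" by simp
    also have "\<dots> \<le> 1 * (dist v w / 2)" by (intro mult_right_mono assms) auto
    finally show "dist (\<Phi> v t) (\<Phi> w t) \<le> (1/2) * dist v w" by (simp add: dist_norm \<Phi>)
  qed
  then obtain w where "\<Phi> w = w" using banach_fix_type[of "1/2" \<Phi>] by auto
  then have w: "w t = T w t" for t using \<Phi>[of w] by simp
  show thesis
  proof (rule that[of w])
    fix t assume "t \<in> {- a..a}"
    then have "c t = t" by (auto simp: c_def)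
    with w[of t] show "w t = z0 + integral {- a..t} (\<lambda>s. g (w s)) - integral {- a..0} (\<lambda>s. g (w s))"
      by (simp add: T_def)
  qed simp
qed

text \<open>Composing \<open>f\<close> with the projection onto a small ball makes it bounded and globally Lipschitz, and for
  short times the solution does not leave that ball.\<close>

theorem autonomous_local_solution:
  fixes f :: "'e::euclidean_space \<Rightarrow> 'e"
  assumes "open U" "smooth_on U f" "z0 \<in> U"
  obtains a z where "a > 0" "z 0 = z0" "\<And>t. t \<in> {- a<..<a} \<Longrightarrow> z t \<in> U"
    "\<And>t. t \<in> {- a<..<a} \<Longrightarrow> (z has_vector_derivative f (z t)) (at t)"
proof -
  obtain r where r: "r > 0" "cball z0 r \<subseteq> U" using assms(1,3) open_contains_cball by metis
  define K where "K = cball z0 r"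
  have K: "K \<subseteq> U" "compact K" "convex K" "closed K" "K \<noteq> {}" using r by (auto simp: K_def)
  obtain L where L: "L > 0" "\<And>x. x \<in> K \<Longrightarrow> onorm (frechet_derivative f (at x)) \<le> L"
    using frechet_derivative_bound_on_compact[OF assms(2) K(1,2)] by blast
  have "bounded (f ` K)"
    using compact_continuous_image[OF smooth_on_continuous_on[OF smooth_on_subset[OF assms(2) K(1)]] K(2)]
    by (rule compact_imp_bounded)
  then obtain B where B: "B > 0" "\<And>x. x \<in> K \<Longrightarrow> norm (f x) \<le> B"
    unfolding bounded_pos by auto
  define g where "g = f \<circ> closest_point K"
  have inK: "closest_point K x \<in> K" for x by (rule closest_point_in_set[OF K(4,5)])
  have bound: "norm (g x) \<le> B" for x using B(2)[OF inK] by (simp add: g_def)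
  have lip: "dist (g x) (g y) \<le> L * dist x y" for x y
  proof -
    have "norm (f (closest_point K x) - f (closest_point K y)) \<le> L * norm (closest_point K x - closest_point K y)"
      using K(1) by (intro differentiable_bound[OF K(3) _ L(2) inK inK])
        (auto intro: has_derivative_at_withinI smooth_on_has_derivative[OF assms(2)])
    also have "\<dots> \<le> L * dist x y"
      using L(1) closest_point_lipschitz[OF K(3,4,5), of x y] by (simp flip: dist_norm)
    finally show ?thesis by (simp add: g_def dist_norm)
  qed
  define a where "a = min (1 / (6 * L)) (r / (3 * B))"
  have a: "a > 0" "6 * a * L \<le> 1" "3 * a * B \<le> r"
    using L(1) B(1) r(1) by (auto simp: a_def min_def field_simps)
  obtain z where z: "continuous_on UNIV z"
    "\<And>t. t \<in> {- a..a} \<Longrightarrow> z t = z0 + integral {- a..t} (\<lambda>s. g (z s)) - integral {- a..0} (\<lambda>s. g (z s))"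
    using integral_equation_solution[OF bound lip less_imp_le[OF L(1)] a(1,2)] by blast
  have "continuous_on UNIV g"
    using L(1) by (intro lipschitz_on_continuous_on[where L = L] lipschitz_onI lip) auto
  then have gz: "continuous_on S (\<lambda>s. g (z s))" for S
    by (rule continuous_on_compose2[OF _ continuous_on_subset[OF z(1)]]) auto
  have zK: "z t \<in> K" if t: "t \<in> {- a..a}" for t
  proof -
    have "norm (integral {- a..t} (\<lambda>s. g (z s))) \<le> B * (t - - a)"
      using t by (intro integral_bound gz bound) auto
    moreover have "norm (integral {- a..0} (\<lambda>s. g (z s))) \<le> B * (0 - - a)"
      using a(1) by (intro integral_bound gz bound) auto
    moreover have "B * (t - - a) \<le> B * (2 * a)"
      using t B(1) by (intro mult_left_mono) auto
    ultimately have "norm (z t - z0) \<le> B * (2 * a) + B * a"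
      using norm_triangle_ineq4[of "integral {- a..t} (\<lambda>s. g (z s))" "integral {- a..0} (\<lambda>s. g (z s))"]
      by (simp add: z(2)[OF t])
    then show ?thesis using a(3) by (simp add: K_def dist_norm norm_minus_commute algebra_simps)
  qed
  show thesis
  proof (rule that[OF a(1)])
    show "z 0 = z0" using z(2)[of 0] a(1) by simp
    fix t assume t: "t \<in> {- a<..<a}"
    then show "z t \<in> U" using zK[of t] K(1) by auto
    have "((\<lambda>t. integral {- a..t} (\<lambda>s. g (z s))) has_vector_derivative g (z t)) (at t within {- a..a})"
      using t by (intro integral_has_vector_derivative gz) auto
    then have "((\<lambda>t. z0 + integral {- a..t} (\<lambda>s. g (z s)) - integral {- a..0} (\<lambda>s. g (z s)))
        has_vector_derivative g (z t)) (at t)"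
      using t by (auto simp: at_within_Icc_at intro!: derivative_eq_intros)
    then have "(z has_vector_derivative g (z t)) (at t)"
      by (rule has_vector_derivative_transform_within_open[of _ _ _ "{- a<..<a}"])
        (use t z(2) in auto)
    moreover have "g (z t) = f (z t)"
      using zK[of t] t by (simp add: g_def closest_point_self)
    ultimately show "(z has_vector_derivative f (z t)) (at t)" by simp
  qed
qed

text \<open>Antiderivatives are needed on all of \<open>I\<close>, which may be unbounded, since a geodesic has to be
  reparametrised as a whole.\<close>

lemma antiderivative_on_open_interval:
  fixes p :: "real \<Rightarrow> real"
  assumes I: "open_interval I" and p: "continuous_on I p"
  obtains A where "\<And>t. t \<in> I \<Longrightarrow> (A has_real_derivative p t) (at t)"
proof -
  obtain t0 where t0: "t0 \<in> I" using I by (auto simp: open_interval_def)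
  have oI: "open I" "connected I" using I by (auto simp: open_interval_def)
  \<comment> \<open>The oriented integral from \<open>t0\<close> to \<open>t\<close>: one of the two intervals is empty or a point.\<close>
  define A where "A t = integral {t0..t} p - integral {t..t0} p" for t
  have "(A has_real_derivative p t) (at t)" if t: "t \<in> I" for t
  proof -
    have m: "min t t0 \<in> I" "max t t0 \<in> I" using t t0 by (auto simp: min_def max_def)
    obtain e1 where e1: "e1 > 0" "cball (min t t0) e1 \<subseteq> I" using oI(1) m open_contains_cball by metis
    obtain e2 where e2: "e2 > 0" "cball (max t t0) e2 \<subseteq> I" using oI(1) m open_contains_cball by metis
    define c where "c = min t t0 - e1"
    define d where "d = max t t0 + e2"
    have cd: "c \<in> I" "d \<in> I" "c < t" "c < t0" "t < d" "t0 < d"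
      using e1 e2 by (auto simp: c_def d_def dist_real_def subset_iff)
    have sub: "{c..d} \<subseteq> I" using connected_contains_Icc[OF oI(2) cd(1,2)] .
    have pcd: "continuous_on {c..d} p" using continuous_on_subset[OF p sub] .
    have int: "p integrable_on {x..y}" if "c \<le> x" "y \<le> d" for x y
      using that by (intro integrable_continuous_real continuous_on_subset[OF pcd]) auto
    have A: "integral {c..u} p - integral {c..t0} p = A u" if "u \<in> {c<..<d}" for u
    proof (cases "u \<le> t0")
      case True
      then have "integral {c..u} p + integral {u..t0} p = integral {c..t0} p"
        using that cd by (intro Henstock_Kurzweil_Integration.integral_combine int) auto
      moreover have "integral {t0..u} p = 0"
        using True by (cases "u = t0") auto
      ultimately show ?thesis by (simp add: A_def)
    next
      case False
      then have "integral {c..t0} p + integral {t0..u} p = integral {c..u} p"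
        using that cd by (intro Henstock_Kurzweil_Integration.integral_combine int) auto
      then show ?thesis using False by (simp add: A_def)
    qed
    have "((\<lambda>u. integral {c..u} p) has_real_derivative p t) (at t within {c..d})"
      using cd by (intro integral_has_real_derivative pcd) auto
    then have "((\<lambda>u. integral {c..u} p - integral {c..t0} p) has_real_derivative p t) (at t)"
      using cd by (auto simp: at_within_Icc_at intro!: derivative_eq_intros)
    then show ?thesis
      by (rule has_field_derivative_transform_within_open[of _ _ _ "{c<..<d}"]) (use cd A in auto)
  qed
  then show thesis by (rule that)
qed

text \<open>The equation \<open>\<phi>'' = - 2 p(\<phi>) \<phi>'\<^sup>2\<close> linearises for the inverse \<open>\<sigma>\<close> of \<open>\<phi>\<close>: it becomes \<open>\<sigma>'' = 2 p \<sigma>'\<close>, which two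
  quadratures solve on all of \<open>I\<close>.\<close>

lemma reparametrization_exists:
  assumes I: "open_interval I" and p: "smooth_on I p"
  obtains J \<phi> \<psi> where "orientation_preserving_reparam J I \<phi>"
    "\<And>s. s \<in> J \<Longrightarrow> \<psi> s > 0"
    "\<And>s. s \<in> J \<Longrightarrow> (\<phi> has_real_derivative \<psi> s) (at s)"
    "\<And>s. s \<in> J \<Longrightarrow> (\<psi> has_real_derivative - 2 * p (\<phi> s) * (\<psi> s)\<^sup>2) (at s)"
proof -
  have oI: "open I" "connected I" "I \<noteq> {}" using I by (auto simp: open_interval_def)
  have "continuous_on I (\<lambda>t. 2 * p t)"
    by (intro continuous_intros smooth_on_continuous_on p)
  then obtain A where A: "\<And>t. t \<in> I \<Longrightarrow> (A has_real_derivative 2 * p t) (at t)"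
    using antiderivative_on_open_interval[OF I] by blast
  have contA: "continuous_on I A"
    using A by (auto intro!: continuous_at_imp_continuous_on DERIV_isCont)
  obtain \<sigma> where \<sigma>: "\<And>t. t \<in> I \<Longrightarrow> (\<sigma> has_real_derivative exp (A t)) (at t)"
    using antiderivative_on_open_interval[OF I, of "\<lambda>t. exp (A t)"] continuous_on_exp[OF contA] by blast
  have cont\<sigma>: "continuous_on I \<sigma>"
    using \<sigma> by (auto intro!: continuous_at_imp_continuous_on DERIV_isCont)
  have mono: "\<sigma> s < \<sigma> t" if "s \<in> I" "t \<in> I" "s < t" for s t
  proof (rule DERIV_pos_imp_increasing[OF that(3)])
    fix x assume "s \<le> x" "x \<le> t"
    then have "x \<in> I" using connected_contains_Icc[OF oI(2) that(1,2)] by auto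
    then show "\<exists>y. (\<sigma> has_real_derivative y) (at x) \<and> 0 < y"
      using \<sigma> by (intro exI[of _ "exp (A x)"]) simp
  qed
  have inj: "inj_on \<sigma> I" using mono by (intro strict_mono_on_imp_inj_on strict_mono_onI)
  define J where "J = \<sigma> ` I"
  define \<phi> where "\<phi> = inv_into I \<sigma>"
  define \<psi> where "\<psi> s = exp (- A (\<phi> s))" for s
  have \<phi>\<sigma>: "\<phi> (\<sigma> t) = t" if "t \<in> I" for t unfolding \<phi>_def by (rule inv_into_f_f[OF inj that])
  have \<phi>I: "\<phi> s \<in> I" and \<sigma>\<phi>: "\<sigma> (\<phi> s) = s" if "s \<in> J" for s
    using that \<phi>\<sigma> by (auto simp: J_def)
  have "open J" unfolding J_def by (rule invariance_of_domain[OF cont\<sigma> oI(1) inj])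
  then have J: "open_interval J"
    using connected_continuous_image[OF cont\<sigma> oI(2)] oI(3) by (simp add: open_interval_def J_def)
  have d\<phi>: "(\<phi> has_real_derivative \<psi> s) (at s)" if "s \<in> J" for s
    unfolding has_field_derivative_def
  proof (rule has_derivative_inverse_strong_x[OF oI(1) \<phi>I[OF that] cont\<sigma> \<phi>\<sigma> _ _ \<sigma>\<phi>[OF that]])
    show "(\<sigma> has_derivative (*) (exp (A (\<phi> s)))) (at (\<phi> s))"
      using \<sigma>[OF \<phi>I[OF that]] by (simp add: has_field_derivative_def)
    show "(*) (exp (A (\<phi> s))) \<circ> (*) (\<psi> s) = id"
      by (auto simp: \<psi>_def fun_eq_iff exp_minus)
  qed
  have "smooth_on I A"
    by (rule smooth_on_antiderivative[OF oI(1) smooth_on_mult[OF oI(1) smooth_on_const[of _ 2] p]])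
      (simp add: A flip: has_real_derivative_iff_has_vector_derivative)
  then have "smooth_on I (\<lambda>t. exp (- A t))" by (intro smooth_on_exp smooth_on_minus oI(1))
  then have "smooth_on J \<phi>"
    using d\<phi> \<phi>I \<open>open J\<close> oI(1)
    by (elim smooth_on_autonomous_solution[rotated 2])
      (auto simp: \<psi>_def simp flip: has_real_derivative_iff_has_vector_derivative)
  moreover have "\<phi> ` J = I" unfolding J_def image_image using \<phi>\<sigma> by simp
  ultimately have rep: "orientation_preserving_reparam J I \<phi>"
    using J DERIV_imp_deriv[OF d\<phi>] by (simp add: orientation_preserving_reparam_def \<psi>_def)
  have "(\<psi> has_real_derivative - 2 * p (\<phi> s) * (\<psi> s)\<^sup>2) (at s)" if "s \<in> J" for s
  proof -
    have "((\<lambda>s. A (\<phi> s)) has_real_derivative 2 * p (\<phi> s) * \<psi> s) (at s)"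
      by (rule DERIV_chain2[OF A[OF \<phi>I[OF that]] d\<phi>[OF that]])
    then have "((\<lambda>s. exp (- A (\<phi> s))) has_real_derivative exp (- A (\<phi> s)) * - (2 * p (\<phi> s) * \<psi> s)) (at s)"
      by (intro DERIV_chain2[OF DERIV_exp] DERIV_minus)
    then show ?thesis by (simp add: \<psi>_def[abs_def] power2_eq_square algebra_simps)
  qed
  with rep d\<phi> show thesis by (intro that[of J \<phi> \<psi>]) (auto simp: \<psi>_def)
qed

section \<open>The slit tangent bundle as a manifold\<close>

lemma Ck_on_local:
  assumes "\<And>x. x \<in> S \<Longrightarrow> \<exists>V. open V \<and> x \<in> V \<and> Ck_on k V f"
  shows "Ck_on k S f"
  using assms
proof (induction k arbitrary: f)
  case 0
  show ?case
  proof (intro continuous_at_imp_continuous_on[of S f, folded Ck_on.simps(1)] ballI)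
    fix x assume "x \<in> S"
    then obtain V where "open V" "x \<in> V" "continuous_on V f" using 0 by (metis Ck_on.simps(1))
    then show "isCont f x" by (simp add: continuous_on_eq_continuous_at)
  qed
next
  case (Suc k)
  have "f differentiable (at x)" if "x \<in> S" for x
    using Suc.prems[OF that] by auto
  moreover have "Ck_on k S (\<lambda>x. frechet_derivative f (at x) v)" for v
    using Suc.prems by (intro Suc.IH) (metis Ck_on.simps(2))
  ultimately show ?case by simp
qed

lemma smooth_on_local:
  assumes "\<And>x. x \<in> S \<Longrightarrow> \<exists>V. open V \<and> x \<in> V \<and> smooth_on V f"
  shows "smooth_on S f"
  unfolding smooth_on_def using assms Ck_on_local by (metis smooth_on_def)

lemma tangent_bundle_iff:
  "X \<in> tangent_bundle B \<longleftrightarrow> (\<exists>c\<in>B. fst X \<in> chart_dom c) \<and>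
     (\<forall>c. \<not> (c \<in> B \<and> fst X \<in> chart_dom c) \<longrightarrow> snd X c = 0) \<and>
     (\<forall>c\<in>B. \<forall>d\<in>B. fst X \<in> chart_dom c \<inter> chart_dom d \<longrightarrow>
        snd X d = frechet_derivative (transition c d) (at (chart_map c (fst X))) (snd X c))"
  by (simp add: tangent_bundle_def case_prod_beta)

lemma tangent_outside:
  "X \<in> tangent_bundle B \<Longrightarrow> \<not> (c \<in> B \<and> fst X \<in> chart_dom c) \<Longrightarrow> snd X c = 0"
  unfolding tangent_bundle_iff by blast

lemma tangent_chart_change:
  "X \<in> tangent_bundle B \<Longrightarrow> c \<in> B \<Longrightarrow> d \<in> B \<Longrightarrow> fst X \<in> chart_dom c \<Longrightarrow> fst X \<in> chart_dom d \<Longrightarrow>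
    snd X d = frechet_derivative (transition c d) (at (chart_map c (fst X))) (snd X c)"
  unfolding tangent_bundle_iff by blast

text \<open>What the manifold and its slit tangent bundle have in common: charts with open overlaps and smooth
  transition maps, without reference to a topology on the points.\<close>

locale charted_space =
  fixes B :: "('b, 'e::euclidean_space) chart set"
  assumes inj_chart: "c \<in> B \<Longrightarrow> inj_on (chart_map c) (chart_dom c)"
    and open_overlap: "c \<in> B \<Longrightarrow> d \<in> B \<Longrightarrow> open (chart_map c ` (chart_dom c \<inter> chart_dom d))"
    and smooth_transition: "c \<in> B \<Longrightarrow> d \<in> B \<Longrightarrow>
      smooth_on (chart_map c ` (chart_dom c \<inter> chart_dom d)) (transition c d)"
begin

lemma chart_inv_chart_map: "c \<in> B \<Longrightarrow> p \<in> chart_dom c \<Longrightarrow> chart_inv c (chart_map c p) = p"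
  unfolding chart_inv_def by (rule inv_into_f_f[OF inj_chart])

lemma coord_rep_chart_map: "c \<in> B \<Longrightarrow> p \<in> chart_dom c \<Longrightarrow> coord_rep c f (chart_map c p) = f p"
  by (simp add: coord_rep_def chart_inv_chart_map)

lemma transition_chart_map:
  "c \<in> B \<Longrightarrow> p \<in> chart_dom c \<Longrightarrow> transition c d (chart_map c p) = chart_map d p"
  by (simp add: transition_def chart_inv_chart_map)

lemma open_chart_image: "c \<in> B \<Longrightarrow> open (chart_image c)"
  using open_overlap[of c c] by (simp add: chart_image_def)

lemma has_derivative_transition:
  "c \<in> B \<Longrightarrow> d \<in> B \<Longrightarrow> p \<in> chart_dom c \<Longrightarrow> p \<in> chart_dom d \<Longrightarrow>
    (transition c d has_derivative frechet_derivative (transition c d) (at (chart_map c p))) (at (chart_map c p))"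
  by (rule smooth_on_has_derivative[OF smooth_transition]) auto

lemma linear_transition_derivative:
  "c \<in> B \<Longrightarrow> d \<in> B \<Longrightarrow> p \<in> chart_dom c \<Longrightarrow> p \<in> chart_dom d \<Longrightarrow>
    linear (frechet_derivative (transition c d) (at (chart_map c p)))"
  by (rule has_derivative_linear[OF has_derivative_transition])

lemma transition_derivative_self:
  assumes "c \<in> B" "p \<in> chart_dom c"
  shows "frechet_derivative (transition c c) (at (chart_map c p)) v = v"
proof -
  have "frechet_derivative (transition c c) (at (chart_map c p)) = frechet_derivative (\<lambda>x. x) (at (chart_map c p))"
    using assms
    by (intro frechet_derivative_cong_open(1)[OF open_chart_image[OF assms(1)]])
      (auto simp: chart_image_def transition_chart_map)
  then show ?thesis by simp
qed

lemma tangent_eqI: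
  assumes "X \<in> tangent_bundle B" "Y \<in> tangent_bundle B" "fst X = fst Y"
    "c \<in> B" "fst X \<in> chart_dom c" "snd X c = snd Y c"
  shows "X = Y"
proof -
  have "snd X d = snd Y d" for d
  proof (cases "d \<in> B \<and> fst X \<in> chart_dom d")
    case True
    then show ?thesis
      using tangent_chart_change[OF assms(1,4)] tangent_chart_change[OF assms(2,4)] assms(3,5,6) by simp
  next
    case False
    then show ?thesis using tangent_outside[OF assms(1)] tangent_outside[OF assms(2)] assms(3) by simp
  qed
  with assms(3) show ?thesis by (auto simp: prod_eq_iff)
qed

lemma has_vector_derivative_chart_change:
  assumes cd: "c \<in> B" "d \<in> B" and I: "open I" "t \<in> I" "\<And>s. s \<in> I \<Longrightarrow> \<gamma> s \<in> chart_dom c \<inter> chart_dom d"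
    and v: "((chart_map c \<circ> \<gamma>) has_vector_derivative v) (at t)"
  shows "((chart_map d \<circ> \<gamma>) has_vector_derivative
    frechet_derivative (transition c d) (at (chart_map c (\<gamma> t))) v) (at t)"
proof -
  have p: "\<gamma> t \<in> chart_dom c" "\<gamma> t \<in> chart_dom d" using I by auto
  note D = has_derivative_transition[OF cd p]
  have "((transition c d \<circ> (chart_map c \<circ> \<gamma>)) has_derivative
      frechet_derivative (transition c d) (at (chart_map c (\<gamma> t))) \<circ> (\<lambda>r. r *\<^sub>R v)) (at t)"
    using v D by (intro diff_chain_at) (simp_all add: has_vector_derivative_def)
  then have "((transition c d \<circ> (chart_map c \<circ> \<gamma>)) has_vector_derivative
      frechet_derivative (transition c d) (at (chart_map c (\<gamma> t))) v) (at t)"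
    by (simp add: has_vector_derivative_def o_def linear_scale[OF has_derivative_linear[OF D]])
  then show ?thesis
    by (rule has_vector_derivative_transform_within_open[OF _ I(1,2)])
      (use I(3) cd in \<open>auto simp: transition_chart_map\<close>)
qed

text \<open>In place of continuity the curve has to stay, for times near \<open>t\<close>, in each chart that contains \<open>\<gamma> t\<close>.
  This makes the lemma applicable to curves in the slit tangent bundle, whose points carry no given
  topology.\<close>

lemma velocity_in_tangent_bundle:
  assumes t: "\<exists>c\<in>B. \<gamma> t \<in> chart_dom c"
    and V: "\<And>c. c \<in> B \<Longrightarrow> \<gamma> t \<in> chart_dom c \<Longrightarrow> \<exists>V. open V \<and> t \<in> V \<and> (\<forall>s\<in>V. \<gamma> s \<in> chart_dom c)"
    and v: "\<And>c. c \<in> B \<Longrightarrow> \<gamma> t \<in> chart_dom c \<Longrightarrow>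
      ((chart_map c \<circ> \<gamma>) has_vector_derivative vector_derivative (chart_map c \<circ> \<gamma>) (at t)) (at t)"
  shows "velocity B \<gamma> t \<in> tangent_bundle B"
proof -
  have chart_change: "vector_derivative (chart_map d \<circ> \<gamma>) (at t) = frechet_derivative (transition c d)
      (at (chart_map c (\<gamma> t))) (vector_derivative (chart_map c \<circ> \<gamma>) (at t))"
    if cd: "c \<in> B" "d \<in> B" "\<gamma> t \<in> chart_dom c" "\<gamma> t \<in> chart_dom d" for c d
  proof -
    obtain V W where "open V" "t \<in> V" "\<forall>s\<in>V. \<gamma> s \<in> chart_dom c"
      "open W" "t \<in> W" "\<forall>s\<in>W. \<gamma> s \<in> chart_dom d" using V cd by metis
    then show ?thesis
      by (intro vector_derivative_at has_vector_derivative_chart_change[OF cd(1,2), of "V \<inter> W"] v cd) auto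
  qed
  show ?thesis
    unfolding tangent_bundle_iff
  proof (intro conjI ballI allI impI)
    show "\<exists>c\<in>B. fst (velocity B \<gamma> t) \<in> chart_dom c" using t by (simp add: velocity_def)
    show "snd (velocity B \<gamma> t) c = 0" if "\<not> (c \<in> B \<and> fst (velocity B \<gamma> t) \<in> chart_dom c)" for c
      using that by (auto simp: velocity_def)
    show "snd (velocity B \<gamma> t) d = frechet_derivative (transition c d)
        (at (chart_map c (fst (velocity B \<gamma> t)))) (snd (velocity B \<gamma> t) c)"
      if "c \<in> B" "d \<in> B" "fst (velocity B \<gamma> t) \<in> chart_dom c \<inter> chart_dom d" for c d
      using chart_change[of c d] that by (simp add: velocity_def)
  qed
qed

end

locale manifold_atlas =
  fixes M :: "'a topology" and A :: "('a, 'e::euclidean_space) chart set"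
  assumes manifold: "smooth_manifold M A"
begin

lemma openin_chart_dom: "c \<in> A \<Longrightarrow> openin M (chart_dom c)"
  using manifold by (auto simp: smooth_manifold_def)

lemma chart_homeomorphism:
  "c \<in> A \<Longrightarrow> homeomorphic_map (subtopology M (chart_dom c)) (top_of_set (chart_image c)) (chart_map c)"
  using manifold by (auto simp: smooth_manifold_def)

lemma topspace_chart: "c \<in> A \<Longrightarrow> topspace (subtopology M (chart_dom c)) = chart_dom c"
  using openin_subset[OF openin_chart_dom, of c] by auto

lemma open_chart_map_image:
  assumes "c \<in> A" "openin M W" "W \<subseteq> chart_dom c"
  shows "open (chart_map c ` W)"
proof -
  have "openin (subtopology M (chart_dom c)) W"
    using assms(2,3) openin_subtopology_Int2 by (metis inf.absorb2 inf_commute openin_subtopology)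
  then have "openin (top_of_set (chart_image c)) (chart_map c ` W)"
    using homeomorphic_imp_open_map[OF chart_homeomorphism[OF assms(1)]] by (auto simp: open_map_def)
  moreover have "open (chart_image c)" using assms(1) manifold by (auto simp: smooth_manifold_def)
  ultimately show ?thesis by (rule openin_open_trans)
qed

sublocale charted_space A
proof
  fix c d assume c: "c \<in> A"
  show "inj_on (chart_map c) (chart_dom c)"
    using homeomorphic_imp_injective_map[OF chart_homeomorphism[OF c]] topspace_chart[OF c] by simp
  assume d: "d \<in> A"
  show "open (chart_map c ` (chart_dom c \<inter> chart_dom d))"
    using c d by (intro open_chart_map_image openin_Int openin_chart_dom) auto
  show "smooth_on (chart_map c ` (chart_dom c \<inter> chart_dom d)) (transition c d)"
    using c d manifold by (auto simp: smooth_manifold_def)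
qed

lemma continuous_chart_inv:
  assumes "c \<in> A"
  shows "continuous_map (top_of_set (chart_image c)) M (chart_inv c)"
proof -
  obtain g where g: "homeomorphic_maps (subtopology M (chart_dom c)) (top_of_set (chart_image c)) (chart_map c) g"
    using chart_homeomorphism[OF assms] homeomorphic_map_maps by blast
  have "g x = chart_inv c x" if x: "x \<in> chart_image c" for x
  proof -
    obtain p where p: "p \<in> chart_dom c" "x = chart_map c p" using x by (auto simp: chart_image_def)
    then have "g x = p" using g topspace_chart[OF assms] by (auto simp: homeomorphic_maps_def)
    then show ?thesis using chart_inv_chart_map[OF assms p(1)] p(2) by simp
  qed
  moreover have "continuous_map (top_of_set (chart_image c)) M g"
    using g continuous_map_in_subtopology by (auto simp: homeomorphic_maps_def)
  ultimately show ?thesis by (metis continuous_map_eq topspace_euclidean_subtopology)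
qed

lemma transition_derivative_cocycle:
  assumes "c \<in> A" "d \<in> A" "e \<in> A" "p \<in> chart_dom c" "p \<in> chart_dom d" "p \<in> chart_dom e"
  shows "frechet_derivative (transition c e) (at (chart_map c p)) v =
    frechet_derivative (transition d e) (at (chart_map d p))
      (frechet_derivative (transition c d) (at (chart_map c p)) v)"
proof -
  let ?W = "chart_map c ` (chart_dom c \<inter> chart_dom d \<inter> chart_dom e)"
  have "open ?W" using assms by (intro open_chart_map_image openin_Int openin_chart_dom) auto
  moreover have "chart_map c p \<in> ?W" using assms by auto
  ultimately have "frechet_derivative (transition c e) (at (chart_map c p)) =
      frechet_derivative (transition d e \<circ> transition c d) (at (chart_map c p))"
    using assms by (intro frechet_derivative_cong_open(1)[where S = ?W]) (auto simp: transition_chart_map)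
  moreover have "((transition d e \<circ> transition c d) has_derivative
      frechet_derivative (transition d e) (at (chart_map d p)) \<circ>
      frechet_derivative (transition c d) (at (chart_map c p))) (at (chart_map c p))"
    using assms has_derivative_transition[of d e p]
    by (intro diff_chain_at has_derivative_transition) (simp_all add: transition_chart_map)
  ultimately show ?thesis using frechet_derivative_at by (metis comp_apply)
qed

text \<open>The tangent vector with prescribed coordinates in one chart. That its other components are consistent
  is the cocycle property of the transition maps. These vectors show that the image of an induced chart
  is a full product.\<close>

definition tangent_of_coords :: "('a, 'e) chart \<Rightarrow> 'e \<times> 'e \<Rightarrow> ('a, 'e) tangent" where
  "tangent_of_coords c z = (chart_inv c (fst z), \<lambda>d. if d \<in> A \<and> chart_inv c (fst z) \<in> chart_dom d
     then frechet_derivative (transition c d) (at (fst z)) (snd z) else 0)"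

lemma tangent_of_coords:
  assumes "c \<in> A" "fst z \<in> chart_image c"
  shows "tangent_of_coords c z \<in> tangent_bundle A" "fst (tangent_of_coords c z) \<in> chart_dom c"
    "chart_map c (fst (tangent_of_coords c z)) = fst z" "snd (tangent_of_coords c z) c = snd z"
proof -
  obtain p where p: "p \<in> chart_dom c" "fst z = chart_map c p" using assms(2) by (auto simp: chart_image_def)
  have eq: "tangent_of_coords c z = (p, \<lambda>d. if d \<in> A \<and> p \<in> chart_dom d
      then frechet_derivative (transition c d) (at (chart_map c p)) (snd z) else 0)"
    by (simp add: tangent_of_coords_def p chart_inv_chart_map[OF assms(1) p(1)] cong: if_cong)
  show "tangent_of_coords c z \<in> tangent_bundle A"
    unfolding eq tangent_bundle_iff fst_conv snd_conv
  proof (intro conjI ballI allI impI)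
    show "\<exists>c\<in>A. p \<in> chart_dom c" using assms(1) p(1) by blast
    fix d e assume "d \<in> A" "e \<in> A" "p \<in> chart_dom d \<inter> chart_dom e"
    then show "(if e \<in> A \<and> p \<in> chart_dom e
        then frechet_derivative (transition c e) (at (chart_map c p)) (snd z) else 0) =
      frechet_derivative (transition d e) (at (chart_map d p)) (if d \<in> A \<and> p \<in> chart_dom d
        then frechet_derivative (transition c d) (at (chart_map c p)) (snd z) else 0)"
      using transition_derivative_cocycle[OF assms(1) _ _ p(1), of d e "snd z"] by simp
  qed auto
  show "fst (tangent_of_coords c z) \<in> chart_dom c" "chart_map c (fst (tangent_of_coords c z)) = fst z"
    "snd (tangent_of_coords c z) c = snd z"
    using p assms(1) by (auto simp: eq transition_derivative_self)
qed

lemma slit_component_nonzero: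
  assumes "u \<in> slit_tangent_bundle A" "c \<in> A" "fst u \<in> chart_dom c"
  shows "snd u c \<noteq> 0"
proof
  assume 0: "snd u c = 0"
  have u: "u \<in> tangent_bundle A" using assms(1) by (simp add: slit_tangent_bundle_def)
  have "snd u d = 0" for d
  proof (cases "d \<in> A \<and> fst u \<in> chart_dom d")
    case True
    then show ?thesis
      using tangent_chart_change[OF u assms(2) _ assms(3)] 0
        linear_0[OF linear_transition_derivative[OF assms(2) _ assms(3)]] by simp
  next
    case False
    then show ?thesis by (rule tangent_outside[OF u])
  qed
  then show False using assms(1) by (auto simp: slit_tangent_bundle_def)
qed

lemma slit_chart_dom: "chart_dom (slit_chart A c) = {u \<in> slit_tangent_bundle A. fst u \<in> chart_dom c}"
  and slit_chart_map: "chart_map (slit_chart A c) u = (chart_map c (fst u), snd u c)"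
  by (simp_all add: slit_chart_def)

lemma slit_overlap_image:
  assumes "c \<in> A" "d \<in> A"
  shows "chart_map (slit_chart A c) ` (chart_dom (slit_chart A c) \<inter> chart_dom (slit_chart A d)) =
    chart_map c ` (chart_dom c \<inter> chart_dom d) \<times> (- {0})" (is "?L = ?R")
proof
  show "?L \<subseteq> ?R"
    using slit_component_nonzero[OF _ assms(1)] by (force simp: slit_chart_dom slit_chart_map)
  show "?R \<subseteq> ?L"
  proof
    fix z assume z: "z \<in> ?R"
    then have fz: "fst z \<in> chart_image c" by (auto simp: chart_image_def mem_Times_iff)
    define u where "u = tangent_of_coords c z"
    note u = tangent_of_coords[OF assms(1) fz, folded u_def]
    have "fst z \<in> chart_map c ` (chart_dom c \<inter> chart_dom d)" using z by (simp add: mem_Times_iff)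
    then obtain p where p: "p \<in> chart_dom c" "p \<in> chart_dom d" "fst z = chart_map c p" by blast
    have "fst u = p" using inj_chart[OF assms(1)] u(2,3) p by (auto dest: inj_onD)
    moreover have "snd u \<noteq> (\<lambda>d. 0)" using u(4) z by auto
    ultimately have "u \<in> chart_dom (slit_chart A c) \<inter> chart_dom (slit_chart A d)"
      using u p by (auto simp: slit_chart_dom slit_tangent_bundle_def)
    moreover have "chart_map (slit_chart A c) u = z" using u by (simp add: slit_chart_map)
    ultimately show "z \<in> ?L" by force
  qed
qed

lemma slit_chart_image: "c \<in> A \<Longrightarrow> chart_image (slit_chart A c) = chart_image c \<times> (- {0})"
  using slit_overlap_image[of c c] by (simp add: chart_image_def)

lemma inj_slit_chart:
  assumes "c \<in> A"
  shows "inj_on (chart_map (slit_chart A c)) (chart_dom (slit_chart A c))"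
proof (rule inj_onI)
  fix u v assume "u \<in> chart_dom (slit_chart A c)" "v \<in> chart_dom (slit_chart A c)"
    and eq: "chart_map (slit_chart A c) u = chart_map (slit_chart A c) v"
  then have uv: "u \<in> tangent_bundle A" "v \<in> tangent_bundle A" "fst u \<in> chart_dom c" "fst v \<in> chart_dom c"
    by (auto simp: slit_chart_dom slit_tangent_bundle_def)
  have "fst u = fst v" using inj_onD[OF inj_chart[OF assms] _ uv(3,4)] eq by (simp add: slit_chart_map)
  then show "u = v" using eq uv assms by (intro tangent_eqI[of u v c]) (auto simp: slit_chart_map)
qed

lemma slit_transition:
  assumes "c \<in> A" "d \<in> A"
    and z: "z \<in> chart_map c ` (chart_dom c \<inter> chart_dom d) \<times> (- {0})"
  shows "transition (slit_chart A c) (slit_chart A d) z =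
    (transition c d (fst z), frechet_derivative (transition c d) (at (fst z)) (snd z))"
proof -
  obtain u where u: "u \<in> chart_dom (slit_chart A c)" "u \<in> chart_dom (slit_chart A d)"
    "z = chart_map (slit_chart A c) u"
    using z unfolding slit_overlap_image[OF assms(1,2), symmetric] by auto
  then have "chart_inv (slit_chart A c) z = u"
    unfolding chart_inv_def using inv_into_f_f[OF inj_slit_chart[OF assms(1)] u(1)] by simp
  moreover have "snd u d = frechet_derivative (transition c d) (at (chart_map c (fst u))) (snd u c)"
    using u(1,2) assms(1,2) by (intro tangent_chart_change) (auto simp: slit_chart_dom slit_tangent_bundle_def)
  ultimately show ?thesis
    using u assms by (simp add: transition_def[of "slit_chart A c"] slit_chart_map slit_chart_dom transition_chart_map)
qed

sublocale slit: charted_space "slit_atlas A"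
proof
  fix C assume "C \<in> slit_atlas A"
  then obtain c where c: "c \<in> A" "C = slit_chart A c" by (auto simp: slit_atlas_def)
  show "inj_on (chart_map C) (chart_dom C)" unfolding c(2) by (rule inj_slit_chart[OF c(1)])
  fix D assume "D \<in> slit_atlas A"
  then obtain d where d: "d \<in> A" "D = slit_chart A d" by (auto simp: slit_atlas_def)
  let ?V = "chart_map c ` (chart_dom c \<inter> chart_dom d)"
  have oV: "open ?V" by (rule open_overlap[OF c(1) d(1)])
  then show "open (chart_map C ` (chart_dom C \<inter> chart_dom D))"
    unfolding c(2) d(2) slit_overlap_image[OF c(1) d(1)] by (intro open_Times) auto
  define W where "W = ?V \<times> (- {0 :: 'e})"
  have oW: "open W" unfolding W_def using oV by (intro open_Times) auto
  have fst: "smooth_on W fst" and snd: "smooth_on W snd"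
    using oW by (auto intro!: smooth_on_linear bounded_linear_fst bounded_linear_snd)
  have sub: "fst ` W \<subseteq> ?V" by (auto simp: W_def)
  have tr: "smooth_on ?V (transition c d)" by (rule smooth_transition[OF c(1) d(1)])
  have "smooth_on W (\<lambda>z. (transition c d (fst z),
      \<Sum>b\<in>Basis. (snd z \<bullet> b) *\<^sub>R frechet_derivative (transition c d) (at (fst z)) b))"
    by (intro smooth_on_Pair oW smooth_on_sum smooth_on_scaleR smooth_on_inner smooth_on_const snd
        smooth_on_compose[OF oW oV sub fst tr]
        smooth_on_compose[OF oW oV sub fst smooth_on_frechet_derivative[OF tr]])
  moreover have "transition C D z = (transition c d (fst z),
      \<Sum>b\<in>Basis. (snd z \<bullet> b) *\<^sub>R frechet_derivative (transition c d) (at (fst z)) b)" if z: "z \<in> W" for z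
  proof -
    have "linear (frechet_derivative (transition c d) (at (fst z)))"
      using sub z by (intro has_derivative_linear[OF smooth_on_has_derivative[OF tr]]) auto
    from linear_basis_expansion[OF this, of "snd z"] show ?thesis
      using slit_transition[OF c(1) d(1)] z by (simp add: W_def c(2) d(2))
  qed
  ultimately have "smooth_on W (transition C D)" by (simp add: smooth_on_cong[OF oW, of "transition C D"])
  then show "smooth_on (chart_map C ` (chart_dom C \<inter> chart_dom D)) (transition C D)"
    unfolding c(2) d(2) slit_overlap_image[OF c(1) d(1)] W_def .
qed

lemma slit_atlas_memI: "c \<in> A \<Longrightarrow> slit_chart A c \<in> slit_atlas A"
  by (simp add: slit_atlas_def)

lemma slit_atlasE:
  assumes "C \<in> slit_atlas A"
  obtains c where "c \<in> A" "C = slit_chart A c"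
  using assms by (auto simp: slit_atlas_def)

text \<open>The Liouville field \<open>(0, y)\<close> is invariant under changes of induced charts: these are linear in \<open>y\<close>, so
  they carry the ray \<open>s \<mapsto> (x, s y)\<close>, whose velocity at \<open>s = 1\<close> is \<open>(0, y)\<close>, to a ray of the same kind.\<close>

lemma liouville_chart_change:
  assumes "C \<in> slit_atlas A" "D \<in> slit_atlas A" "u \<in> chart_dom C" "u \<in> chart_dom D"
  shows "frechet_derivative (transition C D) (at (chart_map C u)) (0, snd (chart_map C u)) = (0, snd (chart_map D u))"
proof -
  obtain c d where c: "c \<in> A" "C = slit_chart A c" and d: "d \<in> A" "D = slit_chart A d"
    using assms(1,2) by (auto elim!: slit_atlasE)
  let ?T = "frechet_derivative (transition c d) (at (chart_map c (fst u)))"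
  have cd: "fst u \<in> chart_dom c" "fst u \<in> chart_dom d" "snd u c \<noteq> 0"
    using assms c d slit_component_nonzero by (auto simp: slit_chart_dom)
  let ?l = "\<lambda>s::real. (chart_map c (fst u), s *\<^sub>R snd u c)"
  have "(?l has_derivative (\<lambda>s. (0, s *\<^sub>R snd u c))) (at 1)"
    by (auto intro!: derivative_eq_intros)
  moreover have "?l 1 = chart_map C u" by (simp add: c(2) slit_chart_map)
  ultimately have "((transition C D \<circ> ?l) has_derivative
      frechet_derivative (transition C D) (at (chart_map C u)) \<circ> (\<lambda>s. (0, s *\<^sub>R snd u c))) (at 1)"
    using slit.has_derivative_transition[OF assms] by (intro diff_chain_at) simp_all
  then have "((\<lambda>s. (chart_map d (fst u), s *\<^sub>R ?T (snd u c))) has_derivative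
      frechet_derivative (transition C D) (at (chart_map C u)) \<circ> (\<lambda>s. (0, s *\<^sub>R snd u c))) (at 1)"
  proof (rule has_derivative_transform_within_open[of _ _ _ _ "{0<..}"])
    fix s :: real assume "s \<in> {0<..}"
    then have "?l s \<in> chart_map c ` (chart_dom c \<inter> chart_dom d) \<times> (- {0})" using cd by auto
    from slit_transition[OF c(1) d(1) this]
    show "(transition C D \<circ> ?l) s = (chart_map d (fst u), s *\<^sub>R ?T (snd u c))"
      using linear_scale[OF linear_transition_derivative[OF c(1) d(1) cd(1,2)]] c d cd
      by (simp add: transition_chart_map)
  qed auto
  moreover have "((\<lambda>s. (chart_map d (fst u), s *\<^sub>R ?T (snd u c))) has_derivative
      (\<lambda>s. (0, s *\<^sub>R ?T (snd u c)))) (at 1)"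
    by (auto intro!: derivative_eq_intros)
  ultimately have "frechet_derivative (transition C D) (at (chart_map C u)) \<circ> (\<lambda>s. (0, s *\<^sub>R snd u c)) =
      (\<lambda>s. (0, s *\<^sub>R ?T (snd u c)))" by (rule has_derivative_unique)
  from fun_cong[OF this, of 1] have "frechet_derivative (transition C D) (at (chart_map C u)) (0, snd u c) =
      (0, ?T (snd u c))" by simp
  moreover have "snd u d = ?T (snd u c)"
    using assms c d by (intro tangent_chart_change) (auto simp: slit_chart_dom slit_tangent_bundle_def)
  ultimately show ?thesis by (simp add: c(2) d(2) slit_chart_map)
qed

end

section \<open>Geodesics in coordinates\<close>

lemma smooth_on_vector_derivative:
  fixes x :: "real \<Rightarrow> 'e::real_normed_vector"
  assumes "open V" "smooth_on V x"
  shows "smooth_on V (\<lambda>t. vector_derivative x (at t))"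
    and "t \<in> V \<Longrightarrow> (x has_vector_derivative vector_derivative x (at t)) (at t)"
proof -
  have diff: "x differentiable (at t)" if "t \<in> V" for t
    using smooth_on_has_derivative[OF assms(2) that] by (auto simp: differentiable_def)
  then show "t \<in> V \<Longrightarrow> (x has_vector_derivative vector_derivative x (at t)) (at t)"
    by (simp add: vector_derivative_works)
  have eq: "vector_derivative x (at t) = frechet_derivative x (at t) 1" if "t \<in> V" for t
    by (simp add: frechet_derivative_eq_vector_derivative[OF diff[OF that]])
  show "smooth_on V (\<lambda>t. vector_derivative x (at t))"
    by (rule smooth_on_cong[OF assms(1) eq, THEN iffD2, OF _ smooth_on_frechet_derivative[OF assms(2)]])
qed

definition coord_velocity :: "('a, 'e::euclidean_space) chart \<Rightarrow> (real \<Rightarrow> 'a) \<Rightarrow> real \<Rightarrow> 'e" where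
  "coord_velocity c \<gamma> t = vector_derivative (chart_map c \<circ> \<gamma>) (at t)"

abbreviation spray_field ::
  "('a, real^'n) chart set \<Rightarrow>
   (('a, real^'n) tangent \<Rightarrow> (('a, real^'n) tangent, (real^'n) \<times> (real^'n)) tangent) \<Rightarrow>
   ('a, real^'n) chart \<Rightarrow> (real^'n) \<times> (real^'n) \<Rightarrow> (real^'n) \<times> (real^'n)" where
  "spray_field A S c \<equiv> coord_rep (slit_chart A c) (vf_comp (slit_chart A c) S)"

locale spray_manifold = manifold_atlas M A for M :: "'a topology" and A :: "('a, real^'n) chart set"
begin

lemma spray_field_chart_map:
  "c \<in> A \<Longrightarrow> u \<in> chart_dom (slit_chart A c) \<Longrightarrow>
    spray_field A S c (chart_map (slit_chart A c) u) = snd (S u) (slit_chart A c)"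
  by (simp add: slit.coord_rep_chart_map slit_atlas_memI vf_comp_def)

lemma spray_domain_chart:
  assumes "spray A S" "c \<in> A"
  shows "spray_domain (chart_image (slit_chart A c)) (spray_field A S c)"
proof
  note C = slit_atlas_memI[OF assms(2)]
  let ?U = "chart_image (slit_chart A c)"
  show "open ?U" by (rule slit.open_chart_image[OF C])
  show "(x, r *\<^sub>R y) \<in> ?U" if "(x, y) \<in> ?U" "r > 0" for x y and r :: real
    using that by (auto simp: slit_chart_image[OF assms(2)])
  show "smooth_on ?U (spray_field A S c)"
    using assms(1) C by (auto simp: spray_def vector_field_def)
  have S: "spray_field A S c (x, y) = (y, - 2 *\<^sub>R spray_coeff (slit_chart A c) S (x, y))"
    "r > 0 \<Longrightarrow> spray_coeff (slit_chart A c) S (x, r *\<^sub>R y) = r\<^sup>2 *\<^sub>R spray_coeff (slit_chart A c) S (x, y)"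
    if "(x, y) \<in> ?U" for x y r
    using assms(1) C that unfolding spray_def by blast+
  show "fst (spray_field A S c z) = snd z" if "z \<in> ?U" for z
    using S(1)[of "fst z" "snd z"] that by simp
  show "snd (spray_field A S c (x, r *\<^sub>R y)) = r\<^sup>2 *\<^sub>R snd (spray_field A S c (x, y))"
    if "(x, y) \<in> ?U" "r > 0" for x y r
  proof -
    have "snd (spray_field A S c z) = - 2 *\<^sub>R spray_coeff (slit_chart A c) S z" for z
      by (simp add: spray_coeff_def)
    then show ?thesis using S(2)[OF that] by simp
  qed
qed

lemma spray_field_fst:
  "spray A S \<Longrightarrow> c \<in> A \<Longrightarrow> z \<in> chart_image (slit_chart A c) \<Longrightarrow> fst (spray_field A S c z) = snd z"
  by (rule spray_domain.fst_X[OF spray_domain_chart])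

lemma open_curve_preimage:
  assumes "open I" "smooth_curve M A I \<gamma>" "c \<in> A"
  shows "open {t \<in> I. \<gamma> t \<in> chart_dom c}"
proof -
  have "openin (top_of_set I) {t \<in> topspace (top_of_set I). \<gamma> t \<in> chart_dom c}"
    using assms(2,3) by (intro openin_continuous_map_preimage[of _ M] openin_chart_dom) (auto simp: smooth_curve_def)
  then show ?thesis using assms(1) by (auto intro: openin_open_trans)
qed

lemma smooth_curve_coords:
  assumes "open I" "smooth_curve M A I \<gamma>" "c \<in> A"
  shows "smooth_on {t \<in> I. \<gamma> t \<in> chart_dom c} (chart_map c \<circ> \<gamma>)"
    and "smooth_on {t \<in> I. \<gamma> t \<in> chart_dom c} (coord_velocity c \<gamma>)"
    and "t \<in> I \<Longrightarrow> \<gamma> t \<in> chart_dom c \<Longrightarrow> ((chart_map c \<circ> \<gamma>) has_vector_derivative coord_velocity c \<gamma> t) (at t)"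
proof -
  note V = open_curve_preimage[OF assms]
  show x: "smooth_on {t \<in> I. \<gamma> t \<in> chart_dom c} (chart_map c \<circ> \<gamma>)"
    using assms(2,3) by (simp add: smooth_curve_def)
  show "smooth_on {t \<in> I. \<gamma> t \<in> chart_dom c} (coord_velocity c \<gamma>)"
    using smooth_on_vector_derivative(1)[OF V x] by (simp add: coord_velocity_def[abs_def])
  show "t \<in> I \<Longrightarrow> \<gamma> t \<in> chart_dom c \<Longrightarrow> ((chart_map c \<circ> \<gamma>) has_vector_derivative coord_velocity c \<gamma> t) (at t)"
    using smooth_on_vector_derivative(2)[OF V x, of t] by (simp add: coord_velocity_def)
qed

lemma velocity_component:
  "c \<in> A \<Longrightarrow> \<gamma> t \<in> chart_dom c \<Longrightarrow> snd (velocity A \<gamma> t) c = coord_velocity c \<gamma> t"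
  by (simp add: velocity_def coord_velocity_def)

lemma fst_velocity: "fst (velocity B \<gamma> t) = \<gamma> t"
  by (simp add: velocity_def)

lemma velocity_curve_coords:
  assumes "open I" "smooth_curve M A I \<gamma>" "c \<in> A" "t \<in> I" "\<gamma> t \<in> chart_dom c"
    and a: "(coord_velocity c \<gamma> has_vector_derivative a) (at t)"
  shows "((chart_map (slit_chart A c) \<circ> velocity A \<gamma>) has_vector_derivative (coord_velocity c \<gamma> t, a)) (at t)"
proof -
  have "((\<lambda>s. ((chart_map c \<circ> \<gamma>) s, coord_velocity c \<gamma> s)) has_vector_derivative (coord_velocity c \<gamma> t, a)) (at t)"
    by (intro has_vector_derivative_Pair smooth_curve_coords(3)[OF assms(1-5)] a)
  then show ?thesis
    by (rule has_vector_derivative_transform_within_open[OF _ open_curve_preimage[OF assms(1-3)]])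
      (use assms(3-5) in \<open>auto simp: slit_chart_map velocity_component fst_velocity\<close>)
qed

text \<open>Read in one chart, \<open>S \<circ> \<gamma>' = \<gamma>''\<close> is the second-order system \<open>x'' = - 2G(x, x')\<close>.\<close>

lemma geodesic_coords:
  assumes S: "spray A S" and g: "geodesic M A S I \<gamma>" and t: "t \<in> I" and c: "c \<in> A" "\<gamma> t \<in> chart_dom c"
  shows "velocity A \<gamma> t \<in> chart_dom (slit_chart A c)"
    and "(chart_map c (\<gamma> t), coord_velocity c \<gamma> t) \<in> chart_image (slit_chart A c)"
    and "(coord_velocity c \<gamma> has_vector_derivative
      snd (spray_field A S c (chart_map c (\<gamma> t), coord_velocity c \<gamma> t))) (at t)"
proof -
  have I: "open I" "smooth_curve M A I \<gamma>" using g by (auto simp: geodesic_def open_interval_def)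
  let ?C = "slit_chart A c"
  let ?u = "velocity A \<gamma> t"
  have u: "?u \<in> slit_tangent_bundle A" "S ?u = velocity (slit_atlas A) (velocity A \<gamma>) t"
    using g t by (auto simp: geodesic_def)
  show uC: "?u \<in> chart_dom ?C" using u(1) c(2) by (simp add: slit_chart_dom fst_velocity)
  have cu: "chart_map ?C ?u = (chart_map c (\<gamma> t), coord_velocity c \<gamma> t)"
    using c by (simp add: slit_chart_map velocity_component fst_velocity)
  with uC show "(chart_map c (\<gamma> t), coord_velocity c \<gamma> t) \<in> chart_image ?C"
    by (metis chart_image_def image_eqI)
  obtain a where a: "(coord_velocity c \<gamma> has_vector_derivative a) (at t)"
    using smooth_on_vector_derivative(2)[OF open_curve_preimage[OF I c(1)] smooth_curve_coords(2)[OF I c(1)]] t c(2)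
    by blast
  have "snd (S ?u) ?C = vector_derivative (chart_map ?C \<circ> velocity A \<gamma>) (at t)"
    using u(2) uC slit_atlas_memI[OF c(1)] by (simp add: velocity_def[of "slit_atlas A"])
  also have "\<dots> = (coord_velocity c \<gamma> t, a)"
    by (rule vector_derivative_at[OF velocity_curve_coords[OF I c(1) t c(2) a]])
  finally have "snd (spray_field A S c (chart_map ?C ?u)) = a"
    using spray_field_chart_map[OF c(1) uC] by simp
  with a cu show "(coord_velocity c \<gamma> has_vector_derivative
      snd (spray_field A S c (chart_map c (\<gamma> t), coord_velocity c \<gamma> t))) (at t)" by simp
qed

text \<open>It is enough to check the second-order system in one chart around each point: \<open>S \<circ> \<gamma>'\<close> and \<open>\<gamma>''\<close> are
  tangent vectors of the slit tangent bundle, hence equal once they agree in one chart.\<close>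

lemma geodesicI:
  assumes S: "spray A S" and I: "open_interval I" and \<gamma>: "smooth_curve M A I \<gamma>"
    and eq: "\<And>t. t \<in> I \<Longrightarrow> \<exists>c\<in>A. \<gamma> t \<in> chart_dom c \<and> coord_velocity c \<gamma> t \<noteq> 0 \<and>
      (coord_velocity c \<gamma> has_vector_derivative
        snd (spray_field A S c (chart_map c (\<gamma> t), coord_velocity c \<gamma> t))) (at t)"
  shows "geodesic M A S I \<gamma>"
proof -
  have oI: "open I" using I by (simp add: open_interval_def)
  have nbhd: "\<exists>V. open V \<and> t \<in> V \<and> (\<forall>s\<in>V. s \<in> I \<and> \<gamma> s \<in> chart_dom c)"
    if "c \<in> A" "t \<in> I" "\<gamma> t \<in> chart_dom c" for c t
    using open_curve_preimage[OF oI \<gamma> that(1)] that by (intro exI[of _ "{t \<in> I. \<gamma> t \<in> chart_dom c}"]) auto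
  have slit: "velocity A \<gamma> t \<in> slit_tangent_bundle A" if t: "t \<in> I" for t
  proof -
    obtain c where c: "c \<in> A" "\<gamma> t \<in> chart_dom c" "coord_velocity c \<gamma> t \<noteq> 0" using eq[OF t] by blast
    have "velocity A \<gamma> t \<in> tangent_bundle A"
    proof (rule velocity_in_tangent_bundle)
      show "\<exists>c\<in>A. \<gamma> t \<in> chart_dom c" using c by blast
      show "\<exists>V. open V \<and> t \<in> V \<and> (\<forall>s\<in>V. \<gamma> s \<in> chart_dom d)" if "d \<in> A" "\<gamma> t \<in> chart_dom d" for d
        using nbhd[OF that(1) t that(2)] by blast
      show "((chart_map d \<circ> \<gamma>) has_vector_derivative vector_derivative (chart_map d \<circ> \<gamma>) (at t)) (at t)"
        if "d \<in> A" "\<gamma> t \<in> chart_dom d" for d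
        using smooth_curve_coords(3)[OF oI \<gamma> that(1) t that(2)] by (simp add: coord_velocity_def)
    qed
    moreover have "snd (velocity A \<gamma> t) \<noteq> (\<lambda>c. 0)" using c by (metis velocity_component)
    ultimately show ?thesis by (simp add: slit_tangent_bundle_def)
  qed
  have "S (velocity A \<gamma> t) = velocity (slit_atlas A) (velocity A \<gamma>) t" if t: "t \<in> I" for t
  proof -
    obtain c where c: "c \<in> A" "\<gamma> t \<in> chart_dom c"
      and a: "(coord_velocity c \<gamma> has_vector_derivative
        snd (spray_field A S c (chart_map c (\<gamma> t), coord_velocity c \<gamma> t))) (at t)" using eq[OF t] by blast
    let ?C = "slit_chart A c"
    let ?u = "velocity A \<gamma> t"
    note C = slit_atlas_memI[OF c(1)]
    have uC: "?u \<in> chart_dom ?C" using slit[OF t] c by (simp add: slit_chart_dom fst_velocity)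
    have cu: "chart_map ?C ?u = (chart_map c (\<gamma> t), coord_velocity c \<gamma> t)"
      using c by (simp add: slit_chart_map velocity_component fst_velocity)
    have Su: "S ?u \<in> tangent_bundle (slit_atlas A)" "fst (S ?u) = ?u"
      using S C uC by (auto simp: spray_def vector_field_def)
    have vel: "velocity (slit_atlas A) (velocity A \<gamma>) t \<in> tangent_bundle (slit_atlas A)"
    proof (rule slit.velocity_in_tangent_bundle)
      show "\<exists>C\<in>slit_atlas A. ?u \<in> chart_dom C" using C uC by blast
      fix D assume D: "D \<in> slit_atlas A" "?u \<in> chart_dom D"
      then obtain d where d: "d \<in> A" "D = slit_chart A d" by (auto elim: slit_atlasE)
      with D have "\<gamma> t \<in> chart_dom d" by (simp add: slit_chart_dom fst_velocity)
      note d = d this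
      obtain V where "open V" "t \<in> V" "\<forall>s\<in>V. s \<in> I \<and> \<gamma> s \<in> chart_dom d" using nbhd[OF d(1) t d(3)] by blast
      then show "\<exists>V. open V \<and> t \<in> V \<and> (\<forall>s\<in>V. velocity A \<gamma> s \<in> chart_dom D)"
        using slit by (intro exI[of _ V]) (auto simp: d(2) slit_chart_dom fst_velocity)
      obtain b where "(coord_velocity d \<gamma> has_vector_derivative b) (at t)"
        using smooth_on_vector_derivative(2)[OF open_curve_preimage[OF oI \<gamma> d(1)]
            smooth_curve_coords(2)[OF oI \<gamma> d(1)]] t d(3) by blast
      from velocity_curve_coords[OF oI \<gamma> d(1) t d(3) this]
      show "((chart_map D \<circ> velocity A \<gamma>) has_vector_derivative
          vector_derivative (chart_map D \<circ> velocity A \<gamma>) (at t)) (at t)"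
        by (metis d(2) vector_derivative_at)
    qed
    show ?thesis
    proof (rule slit.tangent_eqI[OF Su(1) vel _ C])
      show "fst (S ?u) = fst (velocity (slit_atlas A) (velocity A \<gamma>) t)" by (simp add: Su fst_velocity)
      show "fst (S ?u) \<in> chart_dom ?C" using uC by (simp add: Su)
      have "snd (velocity (slit_atlas A) (velocity A \<gamma>) t) ?C =
          vector_derivative (chart_map ?C \<circ> velocity A \<gamma>) (at t)"
        using C uC by (simp add: velocity_def[of "slit_atlas A"])
      also have "\<dots> = (coord_velocity c \<gamma> t, snd (spray_field A S c (chart_map ?C ?u)))"
        unfolding cu by (rule vector_derivative_at[OF velocity_curve_coords[OF oI \<gamma> c(1) t c(2) a]])
      also have "\<dots> = spray_field A S c (chart_map ?C ?u)"
      proof -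
        have "chart_map ?C ?u \<in> chart_image ?C" using uC by (auto simp: chart_image_def)
        from spray_field_fst[OF S c(1) this] show ?thesis unfolding cu by (simp add: prod_eq_iff)
      qed
      also have "\<dots> = snd (S ?u) ?C" by (rule spray_field_chart_map[OF c(1) uC])
      finally show "snd (S ?u) ?C = snd (velocity (slit_atlas A) (velocity A \<gamma>) t) ?C" ..
    qed
  qed
  with slit I \<gamma> show ?thesis by (simp add: geodesic_def)
qed

lemma geodesic_exists:
  assumes S: "spray A S" and c: "c \<in> A" and z0: "z0 \<in> chart_image (slit_chart A c)"
  obtains I \<gamma> where "geodesic M A S I \<gamma>" "0 \<in> I" "\<gamma> 0 \<in> chart_dom c"
    "chart_map c (\<gamma> 0) = fst z0" "coord_velocity c \<gamma> 0 = snd z0"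
proof -
  let ?U = "chart_image (slit_chart A c)"
  let ?X = "spray_field A S c"
  interpret X: spray_domain ?U ?X by (rule spray_domain_chart[OF S c])
  obtain a z where a: "a > 0" "z 0 = z0" and zU: "\<And>t. t \<in> {- a<..<a} \<Longrightarrow> z t \<in> ?U"
    and z: "\<And>t. t \<in> {- a<..<a} \<Longrightarrow> (z has_vector_derivative ?X (z t)) (at t)"
    using autonomous_local_solution[OF X.open_U X.smooth_X z0] by blast
  define I where "I = {- a<..<a}"
  note zU = zU[folded I_def] and z = z[folded I_def]
  have I: "open I" "open_interval I" "0 \<in> I" using a by (auto simp: I_def open_interval_def)
  have sz: "smooth_on I z"
    by (rule smooth_on_autonomous_solution[OF I(1) X.open_U X.smooth_X _ z]) (use zU in auto)
  define x where "x t = fst (z t)" for t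
  define \<gamma> where "\<gamma> t = chart_inv c (x t)" for t
  have xI: "x t \<in> chart_image c" if "t \<in> I" for t
    using zU[OF that] by (auto simp: x_def slit_chart_image[OF c] mem_Times_iff)
  have sx: "smooth_on I x" unfolding x_def[abs_def] by (rule smooth_on_fst[OF I(1) sz])
  have \<gamma>dom: "\<gamma> t \<in> chart_dom c" and cx: "chart_map c (\<gamma> t) = x t" if t: "t \<in> I" for t
  proof -
    obtain p where p: "p \<in> chart_dom c" "x t = chart_map c p" using xI[OF t] by (auto simp: chart_image_def)
    then show "\<gamma> t \<in> chart_dom c" "chart_map c (\<gamma> t) = x t" using chart_inv_chart_map[OF c] by (auto simp: \<gamma>_def)
  qed
  have dx: "(x has_vector_derivative snd (z t)) (at t)" if t: "t \<in> I" for t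
  proof -
    have "((\<lambda>t. fst (z t)) has_vector_derivative fst (?X (z t))) (at t)"
      using bounded_linear.has_vector_derivative[OF bounded_linear_fst z[OF t]] .
    then show ?thesis using X.fst_X[OF zU[OF t]] by (simp add: x_def[abs_def])
  qed
  have vel: "coord_velocity c \<gamma> t = snd (z t)" if t: "t \<in> I" for t
    unfolding coord_velocity_def
    by (rule vector_derivative_at, rule has_vector_derivative_transform_within_open[OF dx[OF t] I(1) t])
      (simp add: cx)
  have curve: "smooth_curve M A I \<gamma>"
    unfolding smooth_curve_def
  proof (intro conjI ballI)
    have "continuous_map (top_of_set I) (top_of_set (chart_image c)) x"
      using smooth_on_continuous_on[OF sx] xI by auto
    from continuous_map_compose[OF this continuous_chart_inv[OF c]]
    show "continuous_map (top_of_set I) M \<gamma>" by (simp add: \<gamma>_def[abs_def] o_def)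
    fix d assume d: "d \<in> A"
    let ?V = "chart_map c ` (chart_dom c \<inter> chart_dom d)"
    have eq: "{t \<in> I. \<gamma> t \<in> chart_dom d} = {t \<in> I. x t \<in> ?V}"
    proof -
      have "\<gamma> t \<in> chart_dom d \<longleftrightarrow> x t \<in> ?V" if t: "t \<in> I" for t
        using \<gamma>dom[OF t] cx[OF t] chart_inv_chart_map[OF c] by (force simp: \<gamma>_def)
      then show ?thesis by auto
    qed
    have oV: "open ?V" by (rule open_overlap[OF c d])
    have "open (I \<inter> x -` ?V)"
      by (rule continuous_open_preimage[OF smooth_on_continuous_on[OF sx] I(1) oV])
    moreover have "I \<inter> x -` ?V = {t \<in> I. x t \<in> ?V}" by auto
    ultimately have oW: "open {t \<in> I. x t \<in> ?V}" by simp
    have "smooth_on {t \<in> I. x t \<in> ?V} (\<lambda>t. transition c d (x t))"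
      by (rule smooth_on_compose[OF oW oV _ smooth_on_subset[OF sx] smooth_transition[OF c d]]) auto
    moreover have chart_d: "(chart_map d \<circ> \<gamma>) t = transition c d (x t)" if "t \<in> {t \<in> I. x t \<in> ?V}" for t
      using transition_chart_map[OF c \<gamma>dom[of t]] cx[of t] that by simp
    ultimately show "smooth_on {t \<in> I. \<gamma> t \<in> chart_dom d} (chart_map d \<circ> \<gamma>)"
      unfolding eq by (simp only: smooth_on_cong[OF oW chart_d])
  qed
  have "geodesic M A S I \<gamma>"
  proof (rule geodesicI[OF S I(2) curve])
    fix t assume t: "t \<in> I"
    have "((\<lambda>t. snd (z t)) has_vector_derivative snd (?X (z t))) (at t)"
      using bounded_linear.has_vector_derivative[OF bounded_linear_snd z[OF t]] .
    then have "(coord_velocity c \<gamma> has_vector_derivative snd (?X (z t))) (at t)"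
      by (rule has_vector_derivative_transform_within_open[OF _ I(1) t]) (simp add: vel)
    moreover have "z t = (chart_map c (\<gamma> t), coord_velocity c \<gamma> t)"
      using cx[OF t] vel[OF t] by (simp add: x_def prod_eq_iff)
    moreover have "coord_velocity c \<gamma> t \<noteq> 0"
      using zU[OF t] vel[OF t] by (auto simp: slit_chart_image[OF c] mem_Times_iff)
    ultimately show "\<exists>c\<in>A. \<gamma> t \<in> chart_dom c \<and> coord_velocity c \<gamma> t \<noteq> 0 \<and>
      (coord_velocity c \<gamma> has_vector_derivative
        snd (spray_field A S c (chart_map c (\<gamma> t), coord_velocity c \<gamma> t))) (at t)"
      using c \<gamma>dom[OF t] by (intro bexI[of _ c]) simp_all
  qed
  then show thesis using I(3) \<gamma>dom[OF I(3)] cx[OF I(3)] vel[OF I(3)] a(2)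
    by (intro that) (simp_all add: x_def)
qed

text \<open>First and second derivative of a reparametrised curve, \<open>(x \<circ> \<phi>)' = \<phi>' x'\<close> and
  \<open>(x \<circ> \<phi>)'' = \<phi>'' x' + \<phi>'\<^sup>2 x''\<close>, with \<open>\<psi> = \<phi>'\<close>.\<close>

lemma coord_velocity_reparam:
  assumes I: "open I" "smooth_curve M A I \<gamma>" and J: "open J" "\<phi> ` J \<subseteq> I"
    and "\<forall>s\<in>J. (\<phi> has_real_derivative \<psi> s) (at s)"
    and c: "c \<in> A" and s: "s \<in> J" "\<gamma> (\<phi> s) \<in> chart_dom c"
  shows "coord_velocity c (\<gamma> \<circ> \<phi>) s = \<psi> s *\<^sub>R coord_velocity c \<gamma> (\<phi> s)"
    and "(\<psi> has_real_derivative b) (at s) \<Longrightarrow> (coord_velocity c \<gamma> has_vector_derivative a) (at (\<phi> s)) \<Longrightarrow>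
      (coord_velocity c (\<gamma> \<circ> \<phi>) has_vector_derivative
        b *\<^sub>R coord_velocity c \<gamma> (\<phi> s) + (\<psi> s)\<^sup>2 *\<^sub>R a) (at s)"
proof -
  have \<phi>: "(\<phi> has_real_derivative \<psi> s) (at s)" if "s \<in> J" for s
    using assms(5) that by blast
  have vel: "coord_velocity c (\<gamma> \<circ> \<phi>) s = \<psi> s *\<^sub>R coord_velocity c \<gamma> (\<phi> s)"
    if s: "s \<in> J" "\<gamma> (\<phi> s) \<in> chart_dom c" for s
  proof -
    have "(((chart_map c \<circ> \<gamma>) \<circ> \<phi>) has_vector_derivative \<psi> s *\<^sub>R coord_velocity c \<gamma> (\<phi> s)) (at s)"
      using J(2) s by (intro vector_diff_chain_at smooth_curve_coords(3)[OF I c])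
        (auto simp: \<phi> simp flip: has_real_derivative_iff_has_vector_derivative)
    then show ?thesis unfolding coord_velocity_def[of c "\<gamma> \<circ> \<phi>"] by (simp add: o_assoc vector_derivative_at)
  qed
  then show "coord_velocity c (\<gamma> \<circ> \<phi>) s = \<psi> s *\<^sub>R coord_velocity c \<gamma> (\<phi> s)" using s by blast
  assume b: "(\<psi> has_real_derivative b) (at s)" and a: "(coord_velocity c \<gamma> has_vector_derivative a) (at (\<phi> s))"
  have "((coord_velocity c \<gamma> \<circ> \<phi>) has_vector_derivative \<psi> s *\<^sub>R a) (at s)"
    using \<phi>[OF s(1)] a by (intro vector_diff_chain_at) (simp_all add: has_real_derivative_iff_has_vector_derivative)
  from has_vector_derivative_scaleR[OF b this]
  have "((\<lambda>s. \<psi> s *\<^sub>R coord_velocity c \<gamma> (\<phi> s)) has_vector_derivative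
      b *\<^sub>R coord_velocity c \<gamma> (\<phi> s) + (\<psi> s)\<^sup>2 *\<^sub>R a) (at s)"
    by (simp add: power2_eq_square add.commute)
  moreover have "continuous_on J \<phi>" using \<phi> by (auto intro!: continuous_at_imp_continuous_on DERIV_isCont)
  then have "open (J \<inter> \<phi> -` {t \<in> I. \<gamma> t \<in> chart_dom c})"
    by (rule continuous_open_preimage[OF _ J(1) open_curve_preimage[OF I c]])
  ultimately show "(coord_velocity c (\<gamma> \<circ> \<phi>) has_vector_derivative
      b *\<^sub>R coord_velocity c \<gamma> (\<phi> s) + (\<psi> s)\<^sup>2 *\<^sub>R a) (at s)"
    by (rule has_vector_derivative_transform_within_open) (use s J(2) vel in auto)
qed

lemma smooth_curve_reparam:
  assumes I: "open I" "smooth_curve M A I \<gamma>" and J: "open J" "\<phi> ` J \<subseteq> I" "smooth_on J \<phi>"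
  shows "smooth_curve M A J (\<gamma> \<circ> \<phi>)"
  unfolding smooth_curve_def
proof (intro conjI ballI)
  have "continuous_map (top_of_set J) (top_of_set I) \<phi>"
    using smooth_on_continuous_on[OF J(3)] J(2) by auto
  then show "continuous_map (top_of_set J) M (\<gamma> \<circ> \<phi>)"
    by (rule continuous_map_compose) (use I(2) in \<open>simp add: smooth_curve_def\<close>)
  fix c assume c: "c \<in> A"
  let ?V = "{t \<in> I. \<gamma> t \<in> chart_dom c}"
  let ?W = "J \<inter> \<phi> -` ?V"
  have oW: "open ?W"
    by (rule continuous_open_preimage[OF smooth_on_continuous_on[OF J(3)] J(1) open_curve_preimage[OF I c]])
  have "smooth_on ?W (\<lambda>s. (chart_map c \<circ> \<gamma>) (\<phi> s))"
    by (rule smooth_on_compose[OF oW open_curve_preimage[OF I c] _ smooth_on_subset[OF J(3)] smooth_curve_coords(1)[OF I c]]) auto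
  moreover have "?W = {s \<in> J. (\<gamma> \<circ> \<phi>) s \<in> chart_dom c}" using J(2) by auto
  ultimately show "smooth_on {s \<in> J. (\<gamma> \<circ> \<phi>) s \<in> chart_dom c} (chart_map c \<circ> (\<gamma> \<circ> \<phi>))"
    by (simp add: o_def)
qed

end

section \<open>Projectively related sprays\<close>

text \<open>\<open>S' = S - 2 P C\<close> with the Liouville field \<open>C\<close>, expressed in all induced charts.\<close>

definition projective_factor ::
  "('a, real^'n) chart set \<Rightarrow>
   (('a, real^'n) tangent \<Rightarrow> (('a, real^'n) tangent, (real^'n) \<times> (real^'n)) tangent) \<Rightarrow>
   (('a, real^'n) tangent \<Rightarrow> (('a, real^'n) tangent, (real^'n) \<times> (real^'n)) tangent) \<Rightarrow>
   (('a, real^'n) tangent \<Rightarrow> real) \<Rightarrow> bool" where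
  "projective_factor A S S' P \<longleftrightarrow> (\<forall>c\<in>A. \<forall>z\<in>chart_image (slit_chart A c).
     spray_field A S' c z = spray_field A S c z - (0, (2 * coord_rep (slit_chart A c) P z) *\<^sub>R snd z))"

definition projective_change ::
  "('a, real^'n) chart set \<Rightarrow>
   (('a, real^'n) tangent \<Rightarrow> (('a, real^'n) tangent, (real^'n) \<times> (real^'n)) tangent) \<Rightarrow>
   (('a, real^'n) tangent \<Rightarrow> real) \<Rightarrow>
   ('a, real^'n) tangent \<Rightarrow> (('a, real^'n) tangent, (real^'n) \<times> (real^'n)) tangent" where
  "projective_change A S P u = (u, \<lambda>C. if C \<in> slit_atlas A \<and> u \<in> chart_dom C
     then snd (S u) C - (0, (2 * P u) *\<^sub>R snd (chart_map C u)) else 0)"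

context spray_manifold
begin

lemma slit_coordsE:
  assumes "c \<in> A" "z \<in> chart_image (slit_chart A c)"
  obtains u where "u \<in> chart_dom (slit_chart A c)" "chart_map (slit_chart A c) u = z"
  using assms(2) by (auto simp: chart_image_def)

lemma smooth_fun_coords:
  "smooth_fun (slit_atlas A) f \<Longrightarrow> c \<in> A \<Longrightarrow> smooth_on (chart_image (slit_chart A c)) (coord_rep (slit_chart A c) f)"
  by (simp add: smooth_fun_def slit_atlas_memI)

lemma scale_slit_tangent:
  assumes "u \<in> slit_tangent_bundle A" "r > 0"
  shows "scale_tangent r u \<in> slit_tangent_bundle A"
proof -
  have u: "u \<in> tangent_bundle A" "snd u \<noteq> (\<lambda>c. 0)" using assms(1) by (auto simp: slit_tangent_bundle_def)
  have "scale_tangent r u \<in> tangent_bundle A"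
    unfolding tangent_bundle_iff
  proof (intro conjI ballI allI impI)
    show "\<exists>c\<in>A. fst (scale_tangent r u) \<in> chart_dom c"
      using u(1) unfolding tangent_bundle_iff scale_tangent_def fst_conv by blast
    show "snd (scale_tangent r u) c = 0" if "\<not> (c \<in> A \<and> fst (scale_tangent r u) \<in> chart_dom c)" for c
      using tangent_outside[OF u(1), of c] that by (simp add: scale_tangent_def)
    fix c d assume *: "c \<in> A" "d \<in> A" "fst (scale_tangent r u) \<in> chart_dom c \<inter> chart_dom d"
    then have dom: "fst u \<in> chart_dom c" "fst u \<in> chart_dom d" by (auto simp: scale_tangent_def)
    show "snd (scale_tangent r u) d = frechet_derivative (transition c d)
        (at (chart_map c (fst (scale_tangent r u)))) (snd (scale_tangent r u) c)"
      using tangent_chart_change[OF u(1) *(1,2) dom]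
      by (simp add: scale_tangent_def linear_scale[OF linear_transition_derivative[OF *(1,2) dom]])
  qed
  moreover have "snd (scale_tangent r u) \<noteq> (\<lambda>c. 0)"
    using u(2) assms(2) by (simp add: scale_tangent_def fun_eq_iff)
  ultimately show ?thesis by (simp add: slit_tangent_bundle_def)
qed

lemma scale_tangent_coords:
  assumes "c \<in> A" "u \<in> chart_dom (slit_chart A c)" "r > 0"
  shows "scale_tangent r u \<in> chart_dom (slit_chart A c)"
    and "chart_map (slit_chart A c) (scale_tangent r u) =
      (fst (chart_map (slit_chart A c) u), r *\<^sub>R snd (chart_map (slit_chart A c) u))"
  using assms scale_slit_tangent[of u r]
  by (simp_all add: slit_chart_dom slit_chart_map) (simp_all add: scale_tangent_def)

lemma pos_homogeneous_coords:
  "pos_homogeneous_on (slit_tangent_bundle A) k f \<longleftrightarrow>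
    (\<forall>c\<in>A. fibre_homogeneous (chart_image (slit_chart A c)) k (coord_rep (slit_chart A c) f))"
    (is "?L \<longleftrightarrow> ?R")
proof
  assume L: ?L
  show ?R
    unfolding fibre_homogeneous_def
  proof (intro ballI allI impI)
    fix c x y and r :: real assume c: "c \<in> A" and r: "0 < r" and z: "(x, y) \<in> chart_image (slit_chart A c)"
    obtain u where u: "u \<in> chart_dom (slit_chart A c)" "chart_map (slit_chart A c) u = (x, y)"
      using slit_coordsE[OF c z] by blast
    note su = scale_tangent_coords[OF c u(1) r]
    have "coord_rep (slit_chart A c) f (x, r *\<^sub>R y) = f (scale_tangent r u)"
      using slit.coord_rep_chart_map[OF slit_atlas_memI[OF c] su(1), of f] unfolding su(2) u(2) by simp
    also have "\<dots> = r ^ k * f u" using L u(1) r by (simp add: pos_homogeneous_on_def slit_chart_dom)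
    also have "f u = coord_rep (slit_chart A c) f (x, y)"
      using slit.coord_rep_chart_map[OF slit_atlas_memI[OF c] u(1), of f] by (simp add: u(2))
    finally show "coord_rep (slit_chart A c) f (x, r *\<^sub>R y) = r ^ k * coord_rep (slit_chart A c) f (x, y)" .
  qed
next
  assume R: ?R
  show ?L
    unfolding pos_homogeneous_on_def
  proof (intro ballI allI impI)
    fix u and r :: real assume u: "u \<in> slit_tangent_bundle A" and r: "0 < r"
    then obtain c where c: "c \<in> A" "fst u \<in> chart_dom c"
      unfolding slit_tangent_bundle_def mem_Collect_eq tangent_bundle_iff by blast
    let ?C = "slit_chart A c"
    have uC: "u \<in> chart_dom ?C" using u c by (simp add: slit_chart_dom)
    note su = scale_tangent_coords[OF c(1) uC r]
    have "f (scale_tangent r u) = coord_rep ?C f (chart_map ?C (scale_tangent r u))"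
      using slit.coord_rep_chart_map[OF slit_atlas_memI[OF c(1)] su(1), of f] by simp
    also have "\<dots> = r ^ k * coord_rep ?C f (chart_map ?C u)"
      using R c(1) r imageI[OF uC, of "chart_map ?C"] unfolding su(2)
      by (simp add: fibre_homogeneous_def chart_image_def)
    also have "coord_rep ?C f (chart_map ?C u) = f u"
      by (rule slit.coord_rep_chart_map[OF slit_atlas_memI[OF c(1)] uC])
    finally show "f (scale_tangent r u) = r ^ k * f u" .
  qed
qed

text \<open>Along a geodesic of \<open>S\<close> the factor becomes a function \<open>p(t) = P(\<gamma>'(t))\<close> of time. A reparametrisation with
  \<open>\<phi>'' = - 2 p(\<phi>) \<phi>'\<^sup>2\<close> absorbs it, because \<open>\<phi>'' x' + \<phi>'\<^sup>2 x''\<close> is then \<open>\<phi>'\<^sup>2\<close> times the acceleration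
  prescribed by \<open>S - 2PC\<close> and sprays are homogeneous of degree 2.\<close>

lemma geodesic_reparam:
  assumes S: "spray A S" and S': "spray A S'" and P: "smooth_fun (slit_atlas A) P"
    and SP: "projective_factor A S S' P" and g: "geodesic M A S I \<gamma>"
  shows "\<exists>J \<phi>. orientation_preserving_reparam J I \<phi> \<and> geodesic M A S' J (\<gamma> \<circ> \<phi>)"
proof -
  have I: "open_interval I" "open I" "smooth_curve M A I \<gamma>" using g by (auto simp: geodesic_def open_interval_def)
  define p where "p t = P (velocity A \<gamma> t)" for t
  have p_coords: "p t = coord_rep (slit_chart A c) P (chart_map c (\<gamma> t), coord_velocity c \<gamma> t)"
    if "t \<in> I" "c \<in> A" "\<gamma> t \<in> chart_dom c" for t c
    using slit.coord_rep_chart_map[OF slit_atlas_memI[OF that(2)] geodesic_coords(1)[OF S g that], of P] that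
    by (simp add: p_def slit_chart_map velocity_component fst_velocity)
  have chart: "\<exists>c\<in>A. \<gamma> t \<in> chart_dom c" if "t \<in> I" for t
  proof -
    have "velocity A \<gamma> t \<in> tangent_bundle A" using g that by (simp add: geodesic_def slit_tangent_bundle_def)
    then show ?thesis unfolding tangent_bundle_iff fst_velocity by blast
  qed
  have "smooth_on I p"
  proof (rule smooth_on_local)
    fix t assume t: "t \<in> I"
    obtain c where c: "c \<in> A" "\<gamma> t \<in> chart_dom c" using chart[OF t] by blast
    let ?V = "{t \<in> I. \<gamma> t \<in> chart_dom c}"
    have V: "open ?V" by (rule open_curve_preimage[OF I(2,3) c(1)])
    have "smooth_on ?V (\<lambda>t. coord_rep (slit_chart A c) P ((chart_map c \<circ> \<gamma>) t, coord_velocity c \<gamma> t))"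
      using geodesic_coords(2)[OF S g _ c(1)]
      by (intro smooth_on_compose[OF V slit.open_chart_image[OF slit_atlas_memI[OF c(1)]] _
            smooth_on_Pair[OF V smooth_curve_coords(1,2)[OF I(2,3) c(1)]] smooth_fun_coords[OF P c(1)]]) auto
    then have "smooth_on ?V p"
      by (rule smooth_on_cong[OF V, THEN iffD2, rotated]) (simp add: p_coords c(1))
    then show "\<exists>V. open V \<and> t \<in> V \<and> smooth_on V p" using V t c(2) by blast
  qed
  then obtain J \<phi> \<psi> where rep: "orientation_preserving_reparam J I \<phi>"
    and \<psi>: "\<And>s. s \<in> J \<Longrightarrow> \<psi> s > 0" "\<And>s. s \<in> J \<Longrightarrow> (\<phi> has_real_derivative \<psi> s) (at s)"
      "\<And>s. s \<in> J \<Longrightarrow> (\<psi> has_real_derivative - 2 * p (\<phi> s) * (\<psi> s)\<^sup>2) (at s)"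
    using reparametrization_exists[OF I(1)] by blast
  have J: "open_interval J" "open J" "\<phi> ` J \<subseteq> I" "smooth_on J \<phi>"
    using rep by (auto simp: orientation_preserving_reparam_def open_interval_def)
  have "geodesic M A S' J (\<gamma> \<circ> \<phi>)"
  proof (rule geodesicI[OF S' J(1) smooth_curve_reparam[OF I(2,3) J(2-4)]])
    fix s assume s: "s \<in> J"
    then have t: "\<phi> s \<in> I" using J(3) by auto
    obtain c where c: "c \<in> A" "\<gamma> (\<phi> s) \<in> chart_dom c" using chart[OF t] by blast
    let ?U = "chart_image (slit_chart A c)"
    let ?x = "chart_map c (\<gamma> (\<phi> s))" and ?y = "coord_velocity c \<gamma> (\<phi> s)"
    interpret X': spray_domain ?U "spray_field A S' c" by (rule spray_domain_chart[OF S' c(1)])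
    note geo = geodesic_coords(2,3)[OF S g t c]
    have "\<forall>s\<in>J. (\<phi> has_real_derivative \<psi> s) (at s)" using \<psi>(2) by blast
    note vel = coord_velocity_reparam[OF I(2,3) J(2,3) this c(1) s c(2)]
    have "(coord_velocity c (\<gamma> \<circ> \<phi>) has_vector_derivative
        (- 2 * p (\<phi> s) * (\<psi> s)\<^sup>2) *\<^sub>R ?y + (\<psi> s)\<^sup>2 *\<^sub>R snd (spray_field A S c (?x, ?y))) (at s)"
      by (rule vel(2)[OF \<psi>(3)[OF s] geo(2)])
    moreover have "(- 2 * p (\<phi> s) * (\<psi> s)\<^sup>2) *\<^sub>R ?y + (\<psi> s)\<^sup>2 *\<^sub>R snd (spray_field A S c (?x, ?y)) =
        snd (spray_field A S' c (?x, \<psi> s *\<^sub>R ?y))"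
    proof -
      have difference: "snd (spray_field A S' c (?x, ?y)) = snd (spray_field A S c (?x, ?y)) - (2 * p (\<phi> s)) *\<^sub>R ?y"
        using SP c(1) geo(1) p_coords[OF t c] by (simp add: projective_factor_def)
      show ?thesis
        unfolding X'.snd_X[OF geo(1) \<psi>(1)[OF s]] difference by (simp add: algebra_simps)
    qed
    moreover have "?y \<noteq> 0" using geo(1) by (auto simp: slit_chart_image[OF c(1)])
    ultimately show "\<exists>c\<in>A. (\<gamma> \<circ> \<phi>) s \<in> chart_dom c \<and> coord_velocity c (\<gamma> \<circ> \<phi>) s \<noteq> 0 \<and>
        (coord_velocity c (\<gamma> \<circ> \<phi>) has_vector_derivative
          snd (spray_field A S' c (chart_map c ((\<gamma> \<circ> \<phi>) s), coord_velocity c (\<gamma> \<circ> \<phi>) s))) (at s)"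
      using c vel(1) \<psi>(1)[OF s] by (intro bexI[of _ c]) simp_all
  qed
  with rep show ?thesis by blast
qed

lemma projective_factor_imp_related:
  assumes S: "spray A S" and S': "spray A S'" and P: "smooth_fun (slit_atlas A) P"
    and SP: "projective_factor A S S' P"
  shows "projectively_related M A S S'"
proof -
  have coord_minus: "coord_rep C (\<lambda>u. - P u) z = - coord_rep C P z"
    for C :: "(('a, real^'n) tangent, (real^'n) \<times> (real^'n)) chart" and z
    by (simp add: coord_rep_def)
  have P': "smooth_fun (slit_atlas A) (\<lambda>u. - P u)"
    unfolding smooth_fun_def
  proof
    fix C assume C: "C \<in> slit_atlas A"
    have "coord_rep C (\<lambda>u. - P u) = (\<lambda>z. - coord_rep C P z)" by (simp add: fun_eq_iff coord_minus)
    then show "smooth_on (chart_image C) (coord_rep C (\<lambda>u. - P u))"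
      using P C slit.open_chart_image[OF C] by (simp add: smooth_fun_def smooth_on_minus)
  qed
  have "projective_factor A S' S (\<lambda>u. - P u)"
    using SP by (simp add: projective_factor_def coord_minus)
  then show ?thesis
    using geodesic_reparam[OF S S' P SP] geodesic_reparam[OF S' S P'] by (simp add: projectively_related_def)
qed

text \<open>Compare accelerations at one point: through \<open>z\<close> passes a geodesic of \<open>S\<close>, and some reparametrisation of it is
  a geodesic of \<open>S'\<close>. By homogeneity its second-order system at this point says that the two sprays
  differ by a multiple of the velocity.\<close>

lemma related_imp_proportional:
  assumes S: "spray A S" and S': "spray A S'" and rel: "projectively_related M A S S'"
    and c: "c \<in> A" and z: "z \<in> chart_image (slit_chart A c)"
  shows "\<exists>r. spray_field A S' c z = spray_field A S c z - (0, (2 * r) *\<^sub>R snd z)"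
proof -
  let ?U = "chart_image (slit_chart A c)"
  interpret X': spray_domain ?U "spray_field A S' c" by (rule spray_domain_chart[OF S' c])
  obtain I \<gamma> where g: "geodesic M A S I \<gamma>" and I: "0 \<in> I" "\<gamma> 0 \<in> chart_dom c"
    and \<gamma>0: "chart_map c (\<gamma> 0) = fst z" "coord_velocity c \<gamma> 0 = snd z"
    using geodesic_exists[OF S c z] by blast
  obtain J \<phi> where rep: "orientation_preserving_reparam J I \<phi>" and g': "geodesic M A S' J (\<gamma> \<circ> \<phi>)"
    using rel g unfolding projectively_related_def by blast
  have oI: "open I" "smooth_curve M A I \<gamma>" using g by (auto simp: geodesic_def open_interval_def)
  have J: "open J" "\<phi> ` J \<subseteq> I" "smooth_on J \<phi>" "\<And>s. s \<in> J \<Longrightarrow> deriv \<phi> s > 0"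
    using rep by (auto simp: orientation_preserving_reparam_def open_interval_def)
  obtain s where s: "s \<in> J" "\<phi> s = 0" using rep I(1) by (auto simp: orientation_preserving_reparam_def)
  define \<psi> where "\<psi> t = vector_derivative \<phi> (at t)" for t
  have \<phi>: "(\<phi> has_real_derivative \<psi> t) (at t)" if "t \<in> J" for t
    using smooth_on_vector_derivative(2)[OF J(1,3) that]
    by (simp add: \<psi>_def has_real_derivative_iff_has_vector_derivative)
  then have pos: "\<psi> s > 0" using J(4)[OF s(1)] DERIV_imp_deriv[OF \<phi>[OF s(1)]] by simp
  obtain b where b: "(\<psi> has_real_derivative b) (at s)"
    using smooth_on_vector_derivative(2)[OF J(1) smooth_on_vector_derivative(1)[OF J(1,3)] s(1)]
    unfolding \<psi>_def[abs_def] has_real_derivative_iff_has_vector_derivative by blast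
  have dom: "\<gamma> (\<phi> s) \<in> chart_dom c" "(\<gamma> \<circ> \<phi>) s \<in> chart_dom c" using I(2) s(2) by simp_all
  have "\<forall>s\<in>J. (\<phi> has_real_derivative \<psi> s) (at s)" using \<phi> by blast
  note vel = coord_velocity_reparam[OF oI J(1,2) this c s(1) dom(1)]
  have "(coord_velocity c \<gamma> has_vector_derivative snd (spray_field A S c z)) (at (\<phi> s))"
    using geodesic_coords(3)[OF S g I(1) c I(2)] by (simp add: s(2) \<gamma>0)
  note vel(2)[OF b this]
  moreover have "(coord_velocity c (\<gamma> \<circ> \<phi>) has_vector_derivative
      snd (spray_field A S' c (fst z, \<psi> s *\<^sub>R snd z))) (at s)"
  proof -
    have "chart_map c ((\<gamma> \<circ> \<phi>) s) = fst z" "coord_velocity c (\<gamma> \<circ> \<phi>) s = \<psi> s *\<^sub>R snd z"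
      using vel(1) by (simp_all only: o_apply[of \<gamma> \<phi> s] s(2) \<gamma>0)
    then show ?thesis using geodesic_coords(3)[OF S' g' s(1) c dom(2)] by metis
  qed
  ultimately have "snd (spray_field A S' c (fst z, \<psi> s *\<^sub>R snd z)) =
      b *\<^sub>R snd z + (\<psi> s)\<^sup>2 *\<^sub>R snd (spray_field A S c z)"
    using vector_derivative_unique_at by (fastforce simp: s(2) \<gamma>0)
  then have "(\<psi> s)\<^sup>2 *\<^sub>R snd (spray_field A S' c z) = b *\<^sub>R snd z + (\<psi> s)\<^sup>2 *\<^sub>R snd (spray_field A S c z)"
    using X'.snd_X[of "fst z" "snd z" "\<psi> s"] z pos by simp
  then have "(1 / (\<psi> s)\<^sup>2) *\<^sub>R (\<psi> s)\<^sup>2 *\<^sub>R snd (spray_field A S' c z) =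
      (1 / (\<psi> s)\<^sup>2) *\<^sub>R (b *\<^sub>R snd z + (\<psi> s)\<^sup>2 *\<^sub>R snd (spray_field A S c z))" by simp
  then have "snd (spray_field A S' c z) = (b / (\<psi> s)\<^sup>2) *\<^sub>R snd z + snd (spray_field A S c z)"
    using pos by (simp add: scaleR_add_right)
  \<comment> \<open>With \<open>b = \<phi>''\<close> the factor is \<open>P = - \<phi>'' / (2 \<phi>'\<^sup>2)\<close>.\<close>
  then have "spray_field A S' c z = spray_field A S c z - (0, (2 * (- b / (2 * (\<psi> s)\<^sup>2))) *\<^sub>R snd z)"
    using spray_field_fst[OF S c z] spray_field_fst[OF S' c z] by (simp add: prod_eq_iff)
  then show ?thesis by blast
qed

text \<open>The pointwise factors form one function on the slit tangent bundle, because the Liouville field does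
  not depend on the chart. Smoothness and homogeneity follow from the explicit formula
  \<open>P = (X - X') \<bullet> y / (2 y \<bullet> y)\<close> for the vertical parts \<open>X\<close> and \<open>X'\<close> of the two sprays.\<close>

lemma related_imp_projective_factor:
  assumes S: "spray A S" and S': "spray A S'" and rel: "projectively_related M A S S'"
  obtains P where "smooth_fun (slit_atlas A) P" "pos_homogeneous_on (slit_tangent_bundle A) 1 P"
    "projective_factor A S S' P"
proof -
  define good where "good u r \<longleftrightarrow> (\<forall>C\<in>slit_atlas A. u \<in> chart_dom C \<longrightarrow>
      snd (S' u) C = snd (S u) C - (0, (2 * r) *\<^sub>R snd (chart_map C u)))" for u r
  have tangents: "S u \<in> tangent_bundle (slit_atlas A)" "fst (S u) = u"
    "S' u \<in> tangent_bundle (slit_atlas A)" "fst (S' u) = u"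
    if "C \<in> slit_atlas A" "u \<in> chart_dom C" for C u
    using S S' that by (auto simp: spray_def vector_field_def)
  have ex: "\<exists>r. good u r" if C: "C \<in> slit_atlas A" "u \<in> chart_dom C" for C u
  proof -
    obtain c where c: "c \<in> A" "C = slit_chart A c" using slit_atlasE[OF C(1)] by blast
    have "chart_map C u \<in> chart_image C" using C(2) by (auto simp: chart_image_def)
    then obtain r where r: "spray_field A S' c (chart_map C u) =
        spray_field A S c (chart_map C u) - (0, (2 * r) *\<^sub>R snd (chart_map C u))"
      using related_imp_proportional[OF S S' rel c(1)] unfolding c(2) by blast
    then have rC: "snd (S' u) C = snd (S u) C - (0, (2 * r) *\<^sub>R snd (chart_map C u))"
      using spray_field_chart_map[OF c(1)] C(2) by (simp add: c(2))
    have "snd (S' u) D = snd (S u) D - (0, (2 * r) *\<^sub>R snd (chart_map D u))"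
      if D: "D \<in> slit_atlas A" "u \<in> chart_dom D" for D
    proof -
      let ?T = "frechet_derivative (transition C D) (at (chart_map C u))"
      note lin = slit.linear_transition_derivative[OF C(1) D(1) C(2) D(2)]
      note t = tangents[OF C]
      have "snd (S' u) D = ?T (snd (S' u) C)" "snd (S u) D = ?T (snd (S u) C)"
        using tangent_chart_change[OF t(1) C(1) D(1)] tangent_chart_change[OF t(3) C(1) D(1)] t(2,4) C(2) D(2)
        by simp_all
      moreover have "?T ((2 * r) *\<^sub>R (0, snd (chart_map C u))) = (2 * r) *\<^sub>R (0, snd (chart_map D u))"
        unfolding linear_scale[OF lin] liouville_chart_change[OF C(1) D(1) C(2) D(2)] ..
      ultimately show ?thesis unfolding rC by (simp add: linear_diff[OF lin])
    qed
    then show ?thesis unfolding good_def by blast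
  qed
  define P where "P u = (SOME r. good u r)" for u
  have P: "snd (S' u) C = snd (S u) C - (0, (2 * P u) *\<^sub>R snd (chart_map C u))"
    if C: "C \<in> slit_atlas A" "u \<in> chart_dom C" for C u
    using someI_ex[OF ex[OF C]] C unfolding P_def good_def by blast
  have factor: "projective_factor A S S' P"
    unfolding projective_factor_def
  proof (intro ballI)
    fix c z assume c: "c \<in> A" and z: "z \<in> chart_image (slit_chart A c)"
    obtain u where u: "u \<in> chart_dom (slit_chart A c)" "chart_map (slit_chart A c) u = z"
      using slit_coordsE[OF c z] by blast
    show "spray_field A S' c z = spray_field A S c z - (0, (2 * coord_rep (slit_chart A c) P z) *\<^sub>R snd z)"
      using P[OF slit_atlas_memI[OF c] u(1)] spray_field_chart_map[OF c u(1)]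
        slit.coord_rep_chart_map[OF slit_atlas_memI[OF c] u(1), of P] by (simp add: u(2))
  qed
  have coords: "coord_rep (slit_chart A c) P z =
      ((snd (spray_field A S c z) - snd (spray_field A S' c z)) \<bullet> snd z) / (2 * (snd z \<bullet> snd z))"
    if c: "c \<in> A" and z: "z \<in> chart_image (slit_chart A c)" for c z
  proof -
    have "snd z \<noteq> 0" using z by (auto simp: slit_chart_image[OF c] mem_Times_iff)
    then show ?thesis using factor c z by (simp add: projective_factor_def)
  qed
  have "smooth_fun (slit_atlas A) P"
    unfolding smooth_fun_def
  proof
    fix C assume "C \<in> slit_atlas A"
    then obtain c where c: "c \<in> A" "C = slit_chart A c" by (rule slit_atlasE)
    let ?U = "chart_image C"
    interpret X: spray_domain ?U "spray_field A S c" using spray_domain_chart[OF S c(1)] by (simp add: c(2))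
    interpret X': spray_domain ?U "spray_field A S' c" using spray_domain_chart[OF S' c(1)] by (simp add: c(2))
    have sy: "smooth_on ?U snd" by (intro smooth_on_linear bounded_linear_snd X.open_U)
    have "smooth_on ?U (\<lambda>z. ((snd (spray_field A S c z) - snd (spray_field A S' c z)) \<bullet> snd z) / (2 * (snd z \<bullet> snd z)))"
      by (intro smooth_on_divide smooth_on_inner smooth_on_diff smooth_on_mult smooth_on_const smooth_on_snd
          X.smooth_X X'.smooth_X sy X.open_U)
        (auto simp: slit_chart_image[OF c(1)] mem_Times_iff c(2))
    then show "smooth_on ?U (coord_rep C P)"
      using coords[OF c(1)] unfolding c(2)
      by (subst smooth_on_cong[OF X.open_U[unfolded c(2)]]) auto
  qed
  moreover have "pos_homogeneous_on (slit_tangent_bundle A) 1 P"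
    unfolding pos_homogeneous_coords fibre_homogeneous_def
  proof (intro ballI allI impI)
    fix c x y and r :: real assume c: "c \<in> A" and r: "0 < r" and z: "(x, y) \<in> chart_image (slit_chart A c)"
    interpret X: spray_domain "chart_image (slit_chart A c)" "spray_field A S c" by (rule spray_domain_chart[OF S c])
    interpret X': spray_domain "chart_image (slit_chart A c)" "spray_field A S' c" by (rule spray_domain_chart[OF S' c])
    show "coord_rep (slit_chart A c) P (x, r *\<^sub>R y) = r ^ 1 * coord_rep (slit_chart A c) P (x, y)"
      unfolding coords[OF c X.cone[OF z r]] coords[OF c z] X.snd_X[OF z r] X'.snd_X[OF z r]
      using r by (simp add: power2_eq_square flip: scaleR_diff_right)
  qed
  ultimately show thesis using factor by (rule that)
qed

lemma projective_change:
  assumes S: "spray A S" and P: "smooth_fun (slit_atlas A) P" and hom: "pos_homogeneous_on (slit_tangent_bundle A) 1 P"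
  shows "projective_factor A S (projective_change A S P) P" and "spray A (projective_change A S P)"
proof -
  let ?S = "projective_change A S P"
  show factor: "projective_factor A S ?S P"
    unfolding projective_factor_def
  proof (intro ballI)
    fix c z assume c: "c \<in> A" and z: "z \<in> chart_image (slit_chart A c)"
    obtain u where u: "u \<in> chart_dom (slit_chart A c)" "chart_map (slit_chart A c) u = z"
      using slit_coordsE[OF c z] by blast
    show "spray_field A ?S c z = spray_field A S c z - (0, (2 * coord_rep (slit_chart A c) P z) *\<^sub>R snd z)"
      using spray_field_chart_map[OF c u(1), of S] spray_field_chart_map[OF c u(1), of ?S]
        slit.coord_rep_chart_map[OF slit_atlas_memI[OF c] u(1), of P] u(1) slit_atlas_memI[OF c]
      by (simp add: u(2) projective_change_def)
  qed
  have tangent: "?S u \<in> tangent_bundle (slit_atlas A)" if C: "C \<in> slit_atlas A" "u \<in> chart_dom C" for C u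
    unfolding tangent_bundle_iff
  proof (intro conjI ballI allI impI)
    show "\<exists>C\<in>slit_atlas A. fst (?S u) \<in> chart_dom C" using C by (auto simp: projective_change_def)
    show "snd (?S u) D = 0" if "\<not> (D \<in> slit_atlas A \<and> fst (?S u) \<in> chart_dom D)" for D
      using that by (auto simp: projective_change_def)
    fix D E assume D: "D \<in> slit_atlas A" and E: "E \<in> slit_atlas A"
      and "fst (?S u) \<in> chart_dom D \<inter> chart_dom E"
    then have u: "u \<in> chart_dom D" "u \<in> chart_dom E" by (auto simp: projective_change_def)
    let ?T = "frechet_derivative (transition D E) (at (chart_map D u))"
    note lin = slit.linear_transition_derivative[OF D E u]
    have Su: "S u \<in> tangent_bundle (slit_atlas A)" "fst (S u) = u"
      using S C by (auto simp: spray_def vector_field_def)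
    have "snd (S u) E = ?T (snd (S u) D)"
      using tangent_chart_change[OF Su(1) D E] Su(2) u by simp
    moreover have "?T ((2 * P u) *\<^sub>R (0, snd (chart_map D u))) = (2 * P u) *\<^sub>R (0, snd (chart_map E u))"
      unfolding linear_scale[OF lin] liouville_chart_change[OF D E u] ..
    ultimately show "snd (?S u) E = frechet_derivative (transition D E)
        (at (chart_map D (fst (?S u)))) (snd (?S u) D)"
      using D E u by (simp add: projective_change_def linear_diff[OF lin])
  qed
  show "spray A ?S"
    unfolding spray_def vector_field_def
  proof (intro conjI ballI)
    show "?S u \<in> tangent_bundle (slit_atlas A)" if "u \<in> (\<Union>C\<in>slit_atlas A. chart_dom C)" for u
      using that tangent by blast
    show "fst (?S u) = u" for u by (simp add: projective_change_def)
    fix C assume "C \<in> slit_atlas A"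
    then obtain c where c: "c \<in> A" "C = slit_chart A c" by (rule slit_atlasE)
    let ?U = "chart_image C"
    interpret X: spray_domain ?U "spray_field A S c" using spray_domain_chart[OF S c(1)] by (simp add: c(2))
    have eq: "coord_rep C (vf_comp C ?S) z = spray_field A S c z - (0, (2 * coord_rep C P z) *\<^sub>R snd z)"
      if "z \<in> ?U" for z
      using factor c that by (simp add: projective_factor_def)
    have "smooth_on ?U (\<lambda>z. spray_field A S c z - (0, (2 * coord_rep C P z) *\<^sub>R snd z))"
      using smooth_fun_coords[OF P c(1)] unfolding c(2)[symmetric]
      by (intro smooth_on_diff X.open_U X.smooth_X[folded c(2)] smooth_on_Pair smooth_on_const smooth_on_scaleR
          smooth_on_mult smooth_on_snd smooth_on_ident)
    then show "smooth_on ?U (coord_rep C (vf_comp C ?S))"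
      by (rule smooth_on_cong[OF X.open_U eq, THEN iffD2, rotated])
    have homP: "coord_rep C P (x, r *\<^sub>R y) = r * coord_rep C P (x, y)" if "(x, y) \<in> ?U" "r > 0" for x y r
      using hom c that unfolding pos_homogeneous_coords fibre_homogeneous_def by simp
    fix z assume z: "z \<in> ?U"
    obtain x y where xy: "z = (x, y)" by fastforce
    have "spray_coeff C ?S (x, r *\<^sub>R y) = r\<^sup>2 *\<^sub>R spray_coeff C ?S (x, y)" if r: "r > 0" for r
      unfolding spray_coeff_def eq[OF z[unfolded xy]] eq[OF X.cone[OF z[unfolded xy] r]]
      by (simp add: X.snd_X[OF z[unfolded xy] r] homP[OF z[unfolded xy] r] algebra_simps power2_eq_square)
    moreover have "coord_rep C (vf_comp C ?S) (x, y) = (y, - 2 *\<^sub>R spray_coeff C ?S (x, y))"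
      using eq[OF z] X.fst_X[OF z] by (simp add: spray_coeff_def xy prod_eq_iff)
    ultimately show "case z of (x, y) \<Rightarrow> coord_rep C (vf_comp C ?S) (x, y) = (y, - 2 *\<^sub>R spray_coeff C ?S (x, y)) \<and>
        (\<forall>r>0. spray_coeff C ?S (x, r *\<^sub>R y) = r\<^sup>2 *\<^sub>R spray_coeff C ?S (x, y))"
      by (simp add: xy)
  qed
qed

section \<open>Sprays projectively related to a Finsler structure\<close>

lemma nabla_eq_cov_deriv:
  assumes S: "spray A S" and c: "c \<in> A" and z: "z \<in> chart_image (slit_chart A c)"
  shows "nabla (slit_chart A c) S h z $ i $ j = cov_deriv (spray_field A S c) h z i j"
proof -
  let ?X = "spray_field A S c"
  interpret X: spray_domain "chart_image (slit_chart A c)" ?X by (rule spray_domain_chart[OF S c])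
  have "nonlin_conn (slit_chart A c) S k i z = - (1/2) * snd (frechet_derivative ?X (at z) (0, axis i 1)) $ k" for k i
  proof -
    have "((\<lambda>w. - (1/2) * (snd (?X w) $ k)) has_derivative
        (\<lambda>v. - (1/2) * (snd (frechet_derivative ?X (at z) v) $ k))) (at z)"
      by (intro has_derivative_mult_right bounded_linear.has_derivative[OF bounded_linear_vec_nth]
          has_derivative_snd X.has_derivative_smooth[OF X.smooth_X z])
    from pd_y_eqI[OF this, of i] show ?thesis by (simp add: nonlin_conn_def spray_coeff_def)
  qed
  then show ?thesis
    by (simp add: nabla_def vf_apply_def cov_deriv_def sum_distrib_left sum_negf mult.assoc)
qed

lemma finsler_coords:
  assumes F: "finsler A F" and c: "c \<in> A"
  shows "smooth_on (chart_image (slit_chart A c)) (coord_rep (slit_chart A c) F)"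
    and "fibre_homogeneous (chart_image (slit_chart A c)) 1 (coord_rep (slit_chart A c) F)"
    and "z \<in> chart_image (slit_chart A c) \<Longrightarrow> coord_rep (slit_chart A c) F z > 0"
    and "smooth_on (chart_image (slit_chart A c)) (\<lambda>w. (coord_rep (slit_chart A c) F w)\<^sup>2)"
    and "fibre_homogeneous (chart_image (slit_chart A c)) 2 (\<lambda>w. (coord_rep (slit_chart A c) F w)\<^sup>2)"
proof -
  let ?U = "chart_image (slit_chart A c)"
  let ?F = "coord_rep (slit_chart A c) F"
  show s: "smooth_on ?U ?F" using F c by (intro smooth_fun_coords) (auto simp: finsler_def)
  have "pos_homogeneous_on (slit_tangent_bundle A) 1 F"
    using F by (auto simp: finsler_def pos_homogeneous_on_def slit_tangent_bundle_def)
  then show h: "fibre_homogeneous ?U 1 ?F" using c by (simp add: pos_homogeneous_coords)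
  show "?F z > 0" if z: "z \<in> ?U"
  proof -
    obtain u where u: "u \<in> chart_dom (slit_chart A c)" "chart_map (slit_chart A c) u = z"
      using slit_coordsE[OF c z] by blast
    then show ?thesis
      using F slit.coord_rep_chart_map[OF slit_atlas_memI[OF c] u(1), of F]
      by (simp add: finsler_def slit_chart_dom)
  qed
  show "smooth_on ?U (\<lambda>w. (?F w)\<^sup>2)"
    unfolding power2_eq_square by (intro smooth_on_mult s slit.open_chart_image slit_atlas_memI c)
  show "fibre_homogeneous ?U 2 (\<lambda>w. (?F w)\<^sup>2)"
    using h by (simp add: fibre_homogeneous_def power_mult_distrib)
qed

lemma euler_lagrange_projective_factor:
  assumes S: "spray A S" and SP: "projective_factor A S S' P" and c: "c \<in> A"
    and z: "z \<in> chart_image (slit_chart A c)"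
    and L: "smooth_on (chart_image (slit_chart A c)) L" "fibre_homogeneous (chart_image (slit_chart A c)) (Suc k) L"
  shows "euler_lagrange (spray_field A S' c) L i z =
    euler_lagrange (spray_field A S c) L i z - 2 * coord_rep (slit_chart A c) P z * (k * pd_y i L z)"
proof -
  interpret X: spray_domain "chart_image (slit_chart A c)" "spray_field A S c" by (rule spray_domain_chart[OF S c])
  have "spray_field A S' c z = spray_field A S c z - (0, (2 * coord_rep (slit_chart A c) P z) *\<^sub>R snd z)"
    using SP c z by (simp add: projective_factor_def)
  then show ?thesis
    using X.euler_lagrange_projective_change[OF L(2,1) z, of "coord_rep (slit_chart A c) P" i]
    by (simp add: euler_lagrange_def)
qed

lemma is_geodesic_spray_iff:
  "is_geodesic_spray A F S \<longleftrightarrow> spray A S \<and> (\<forall>c\<in>A. \<forall>z\<in>chart_image (slit_chart A c). \<forall>i.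
     euler_lagrange (spray_field A S c) (\<lambda>w. (coord_rep (slit_chart A c) F w)\<^sup>2) i z = 0)"
  by (simp add: is_geodesic_spray_def euler_lagrange_def vf_apply_def slit_atlas_def)

text \<open>For two sprays \<open>S\<close> and \<open>S - 2PC\<close> the Euler-Lagrange expressions of \<open>F\<^sup>2\<close> differ by \<open>2P \<partial>F\<^sup>2/\<partial>y\<^sup>i\<close>. So the
  equations on the right say that \<open>S - 2PC\<close> is a geodesic spray of \<open>F\<close>.\<close>

lemma projectively_related_finsler_iff:
  assumes S: "spray A S" and F: "finsler A F"
  shows "projectively_related_finsler M A S F \<longleftrightarrow>
    (\<exists>P. smooth_fun (slit_atlas A) P \<and> pos_homogeneous_on (slit_tangent_bundle A) 1 P \<and>
      (\<forall>c\<in>A. \<forall>z\<in>chart_image (slit_chart A c). \<forall>i.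
        euler_lagrange (spray_field A S c) (\<lambda>w. (coord_rep (slit_chart A c) F w)\<^sup>2) i z =
          2 * coord_rep (slit_chart A c) P z * pd_y i (\<lambda>w. (coord_rep (slit_chart A c) F w)\<^sup>2) z))"
    (is "?L \<longleftrightarrow> (\<exists>P. ?smooth P \<and> ?hom P \<and> ?eq P)")
proof -
  have geo: "is_geodesic_spray A F S' \<longleftrightarrow> spray A S' \<and> ?eq P" if SP: "projective_factor A S S' P" for S' P
    using euler_lagrange_projective_factor[OF S SP _ _ finsler_coords(4)[OF F], of _ _ 1]
      finsler_coords(5)[OF F]
    by (simp add: is_geodesic_spray_iff numeral_2_eq_2)
  show ?thesis
  proof
    assume ?L
    then obtain S' where S': "is_geodesic_spray A F S'" "projectively_related M A S S'"
      by (auto simp: projectively_related_finsler_def)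
    then have "spray A S'" by (simp add: is_geodesic_spray_def)
    from related_imp_projective_factor[OF S this S'(2)]
    obtain P where "?smooth P" "?hom P" "projective_factor A S S' P" by blast
    then show "\<exists>P. ?smooth P \<and> ?hom P \<and> ?eq P" using geo S'(1) by blast
  next
    assume "\<exists>P. ?smooth P \<and> ?hom P \<and> ?eq P"
    then obtain P where P: "?smooth P" "?hom P" "?eq P" by blast
    note change = projective_change[OF S P(1,2)]
    have "is_geodesic_spray A F (projective_change A S P)" using geo[OF change(1)] change(2) P(3) by blast
    moreover have "projectively_related M A S (projective_change A S P)"
      by (rule projective_factor_imp_related[OF S change(2) P(1) change(1)])
    ultimately show ?L by (auto simp: projectively_related_finsler_def)
  qed
qed

lemma metric_equation_chart:
  assumes S: "spray A S" and F: "finsler A F" and P: "smooth_fun (slit_atlas A) P"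
    "pos_homogeneous_on (slit_tangent_bundle A) 1 P" and c: "c \<in> A"
  shows "(\<forall>(x, y)\<in>chart_image (slit_chart A c). \<forall>i j.
      nabla (slit_chart A c) S (metric_tensor (slit_chart A c) F) (x, y) $ i $ j =
        2 * coord_rep (slit_chart A c) P (x, y) * metric_tensor (slit_chart A c) F (x, y) $ i $ j
        + pd_y i (coord_rep (slit_chart A c) P) (x, y)
            * (\<Sum>k\<in>UNIV. metric_tensor (slit_chart A c) F (x, y) $ k $ j * y $ k)
        + pd_y j (coord_rep (slit_chart A c) P) (x, y)
            * (\<Sum>k\<in>UNIV. metric_tensor (slit_chart A c) F (x, y) $ i $ k * y $ k))
    \<longleftrightarrow> (\<forall>z\<in>chart_image (slit_chart A c). \<forall>i.
      euler_lagrange (spray_field A S c) (\<lambda>w. (coord_rep (slit_chart A c) F w)\<^sup>2) i z =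
        2 * coord_rep (slit_chart A c) P z * pd_y i (\<lambda>w. (coord_rep (slit_chart A c) F w)\<^sup>2) z)"
proof -
  let ?C = "slit_chart A c"
  let ?U = "chart_image ?C"
  interpret X: spray_domain ?U "spray_field A S c" by (rule spray_domain_chart[OF S c])
  have E: "smooth_on ?U (\<lambda>w. (coord_rep ?C F w)\<^sup>2)" "fibre_homogeneous ?U 2 (\<lambda>w. (coord_rep ?C F w)\<^sup>2)"
    by (rule finsler_coords[OF F c])+
  have P': "smooth_on ?U (coord_rep ?C P)" "fibre_homogeneous ?U 1 (coord_rep ?C P)"
    using smooth_fun_coords[OF P(1) c] P(2) c by (simp_all add: pos_homogeneous_coords)
  have g: "metric_tensor ?C F = (\<lambda>w. \<chi> i j. (1/2) * pd_y i (pd_y j (\<lambda>w. (coord_rep ?C F w)\<^sup>2)) w)"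
    by (simp add: fun_eq_iff metric_tensor_def)
  have "nabla ?C S (metric_tensor ?C F) (x, y) $ i $ j =
        2 * coord_rep ?C P (x, y) * metric_tensor ?C F (x, y) $ i $ j
        + pd_y i (coord_rep ?C P) (x, y) * (\<Sum>k\<in>UNIV. metric_tensor ?C F (x, y) $ k $ j * y $ k)
        + pd_y j (coord_rep ?C P) (x, y) * (\<Sum>k\<in>UNIV. metric_tensor ?C F (x, y) $ i $ k * y $ k)
      \<longleftrightarrow> 2 * cov_deriv (spray_field A S c) (fibre_hessian (\<lambda>w. (coord_rep ?C F w)\<^sup>2)) (x, y) i j =
        pd_y j (\<lambda>w. 2 * coord_rep ?C P w * pd_y i (\<lambda>w. (coord_rep ?C F w)\<^sup>2) w) (x, y)
        + pd_y i (\<lambda>w. 2 * coord_rep ?C P w * pd_y j (\<lambda>w. (coord_rep ?C F w)\<^sup>2) w) (x, y)"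
    if "(x, y) \<in> ?U" for x y i j
    using X.metric_equation_iff[OF E P'(1) that g, of i j] nabla_eq_cov_deriv[OF S c that] by simp
  then show ?thesis
    unfolding X.projective_equation_iff[OF E P', symmetric] by (simp add: Ball_def split_paired_all)
qed

text \<open>The tensor is the fibre Hessian of \<open>F\<close>. The Euler-Lagrange expression of \<open>F\<close> vanishes for the geodesic spray
  and is the same for all projectively related sprays, since \<open>\<partial>F/\<partial>y\<^sup>i\<close> has degree 0.\<close>

lemma angular_metric_parallel:
  assumes S: "spray A S" and F: "finsler A F" and rel: "projectively_related_finsler M A S F"
    and c: "c \<in> A" and z: "z \<in> chart_image (slit_chart A c)"
  shows "nabla (slit_chart A c) S
      (\<lambda>w. \<chi> i j. (1 / coord_rep (slit_chart A c) F w) *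
         (metric_tensor (slit_chart A c) F w $ i $ j
           - pd_y i (coord_rep (slit_chart A c) F) w * pd_y j (coord_rep (slit_chart A c) F) w)) z $ i $ j = 0"
    (is "nabla ?C S ?h z $ i $ j = 0")
proof -
  let ?U = "chart_image ?C"
  let ?F = "coord_rep ?C F"
  obtain S' where geo: "is_geodesic_spray A F S'" and SS': "projectively_related M A S S'"
    using rel by (auto simp: projectively_related_finsler_def)
  then have S': "spray A S'" by (simp add: is_geodesic_spray_def)
  obtain P where SP: "projective_factor A S S' P" using related_imp_projective_factor[OF S S' SS'] by blast
  interpret X: spray_domain ?U "spray_field A S c" by (rule spray_domain_chart[OF S c])
  interpret X': spray_domain ?U "spray_field A S' c" by (rule spray_domain_chart[OF S' c])
  note Fc = finsler_coords[OF F c]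
  have "euler_lagrange (spray_field A S c) ?F i w = 0" if w: "w \<in> ?U" for i w
  proof -
    have "euler_lagrange (spray_field A S' c) ?F i w = 0"
      using geo c w by (intro X'.euler_lagrange_energy_imp_length[OF Fc(1-3) _ w]) (simp_all add: is_geodesic_spray_iff)
    moreover have "euler_lagrange (spray_field A S' c) ?F i w = euler_lagrange (spray_field A S c) ?F i w"
      using euler_lagrange_projective_factor[OF S SP c w Fc(1), of 0 i] Fc(2) by simp
    ultimately show ?thesis by simp
  qed
  then have "pd_y j (euler_lagrange (spray_field A S c) ?F i) z = pd_y j (\<lambda>_. 0) z" for i j
    by (rule pd_y_cong[OF X.open_U z])
  then have "cov_deriv (spray_field A S c) (fibre_hessian ?F) z i j = 0"
    using X.cov_deriv_fibre_hessian[OF Fc(1) z, of i j] by (simp add: pd_y_def[of _ "\<lambda>_. 0"])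
  moreover have "?h w = fibre_hessian ?F w" if w: "w \<in> ?U" for w
    using X.angular_metric_eq_fibre_hessian[OF Fc(1) w] Fc(3)[OF w]
    by (simp add: fibre_hessian_def metric_tensor_def vec_eq_iff)
  then have "cov_deriv (spray_field A S c) ?h z i j = cov_deriv (spray_field A S c) (fibre_hessian ?F) z i j"
    by (rule cov_deriv_cong[OF X.open_U z])
  ultimately show ?thesis using nabla_eq_cov_deriv[OF S c z] by simp
qed

end

theorem theorem1p2:
  fixes M :: "'a topology"
    and A :: "('a, real^'n) chart set"
    and S :: "('a, real^'n) tangent \<Rightarrow> (('a, real^'n) tangent, (real^'n) \<times> (real^'n)) tangent"
    and F :: "('a, real^'n) tangent \<Rightarrow> real"
  assumes "smooth_manifold M A"
    and "connected_space M"
    and "spray A S"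
    and "finsler A F"
  shows
    "(projectively_related_finsler M A S F \<longleftrightarrow>
       (\<exists>P. smooth_fun (slit_atlas A) P \<and>
            pos_homogeneous_on (slit_tangent_bundle A) 1 P \<and>
            (\<forall>C\<in>slit_atlas A. \<forall>(x, y)\<in>chart_image C. \<forall>i j.
               nabla C S (metric_tensor C F) (x, y) $ i $ j =
                 2 * coord_rep C P (x, y) * metric_tensor C F (x, y) $ i $ j
                 + pd_y i (coord_rep C P) (x, y)
                     * (\<Sum>k\<in>UNIV. metric_tensor C F (x, y) $ k $ j * y $ k)
                 + pd_y j (coord_rep C P) (x, y)
                     * (\<Sum>k\<in>UNIV. metric_tensor C F (x, y) $ i $ k * y $ k))))
     \<and>
     (projectively_related_finsler M A S F \<longrightarrow>
       (\<forall>C\<in>slit_atlas A. \<forall>z\<in>chart_image C. \<forall>i j.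
          nabla C S
            (\<lambda>w. \<chi> i j. (1 / coord_rep C F w) *
               (metric_tensor C F w $ i $ j - pd_y i (coord_rep C F) w * pd_y j (coord_rep C F) w))
            z $ i $ j = 0))"
proof -
  interpret spray_manifold M A
    using assms(1) by (simp add: spray_manifold_def manifold_atlas_def)
  note S = assms(3) and F = assms(4)
  show ?thesis
  proof (intro conjI impI ballI allI)
    show "projectively_related_finsler M A S F \<longleftrightarrow>
       (\<exists>P. smooth_fun (slit_atlas A) P \<and>
            pos_homogeneous_on (slit_tangent_bundle A) 1 P \<and>
            (\<forall>C\<in>slit_atlas A. \<forall>(x, y)\<in>chart_image C. \<forall>i j.
               nabla C S (metric_tensor C F) (x, y) $ i $ j =
                 2 * coord_rep C P (x, y) * metric_tensor C F (x, y) $ i $ j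
                 + pd_y i (coord_rep C P) (x, y)
                     * (\<Sum>k\<in>UNIV. metric_tensor C F (x, y) $ k $ j * y $ k)
                 + pd_y j (coord_rep C P) (x, y)
                     * (\<Sum>k\<in>UNIV. metric_tensor C F (x, y) $ i $ k * y $ k)))"
      unfolding projectively_related_finsler_iff[OF S F] slit_atlas_def ball_simps
      by (intro ex_cong1 conj_cong refl ball_cong metric_equation_chart[OF S F, symmetric])
        (simp_all add: slit_atlas_def)
    fix C z i j
    assume rel: "projectively_related_finsler M A S F" and C: "C \<in> slit_atlas A" and z: "z \<in> chart_image C"
    obtain c where "c \<in> A" "C = slit_chart A c" using slit_atlasE[OF C] by blast
    then show "nabla C S
        (\<lambda>w. \<chi> i j. (1 / coord_rep C F w) *
          (metric_tensor C F w $ i $ j - pd_y i (coord_rep C F) w * pd_y j (coord_rep C F) w)) z $ i $ j = 0"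
      using angular_metric_parallel[OF S F rel] z by blast
  qed
qed

end
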